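(* Let $A$ be a finite dimensional Hopf algebra over a field $k$ with invertible antipode $\gamma$, let $m\ge 0$ and $\mu,\nu\in\{\pm\}^m$. The composition $$J'\circ\pi\colon \mathcal{CT}(\mu;\nu)\to\bigotimes_{\mu_i=+}H(A)_i^{\nu_i}\ \otimes\bigotimes_{\mu_j=-}(H(A)^{\mathrm{op}})_j^{\nu_j}$$ of the restriction to $\mathcal{CT}(\mu;\nu)$ of $\pi\colon\mathcal{CT}\to\mathcal{CD}$ (sending a colored singular triangulation to its type) and the universal quantum invariant $J'$ of colored diagrams is an invariant under $\sim'_{ct}$. If $\gamma^2=1$, then $J'\circ\pi$ is also an invariant under $\sim_{ct}$.
   Context: **Algebra.** $\bar\gamma=\gamma^{-1}$; $A^*$ is the dual Hopf algebra, $\bar\gamma^*$ the transpose of $\bar\gamma$; $\{e_a\}$, $\{e^a\}$ dual bases of $A$, $A^*$; $\Delta(x)=\sum x'\otimes x''$. The Heisenberg double is $H(A)=A^*\otimes A$ with product $(f\otimes a)(g\otimes b)=\sum f\,g(?\,a')\otimes a''b$ ("?" is the place of the variable) and unit $1\otimes1$; write $x$ for $1\otimes x$, $f$ for $f\otimes1$. Let $\tilde e_a=\gamma(e_a)$, $\tilde e^a=\bar\gamma^*(e^a)$ and $S=\sum e_a\otimes e^a\in H(A)\otimes H(A)$, $S'=\sum\tilde e_a\otimes e^a\in H(A)^{\mathrm{op}}\otimes H(A)$, $S''=\sum e_a\otimes\tilde e^a\in H(A)\otimes H(A)^{\mathrm{op}}$, $\tilde S=\sum\tilde e_a\otimes\tilde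 e^a\in H(A)^{\mathrm{op}}\otimes H(A)^{\mathrm{op}}$. Inverses: $S^{-1}=\sum\gamma(e_a)\otimes e^a$, $(S')^{-1}=\sum\gamma(\tilde e_a)\otimes e^a$, $(S'')^{-1}=\sum\gamma(e_a)\otimes\tilde e^a$, $\tilde S^{-1}=\sum\gamma(\tilde e_a)\otimes\tilde e^a$. With $N_B=\mathrm{Span}_k\{ab-ba\mid a,b\in B\}$, put $H(A)_i^+=H(A)$, $H(A)_i^-=H(A)/N_{H(A)}$, $(H(A)^{\mathrm{op}})_i^+=H(A)^{\mathrm{op}}$, $(H(A)^{\mathrm{op}})_i^-=H(A)^{\mathrm{op}}/N_{H(A)^{\mathrm{op}}}$. **Colored diagrams.** A colored diagram is an oriented virtual tangle diagram in a square, with ordered components, each component being thin or thick, obtained by pasting horizontally and vertically copies of: vertical strand, crossing $X_+$ (over-strand joining upper right to lower left), crossing $X_-$ (over-strand joining upper left to lower right), local maximum, local minimum, and the virtual crossing, called a symmetry. "Crossing" means real crossing. $\mathcal{CD}$ is the set of colored diagrams; $\mathcal{CD}(\mu;\nu)$ consists of those $Z=Z_1\cup\dots\cup Z_m$ with $Z_i$ thin iff $\mu_i=+$ (thick iff $\mu_i=-$), and $\partial Z_i\ne\emptyset$ iff $\nu_i=+$ (closed iff $\nu_i=-$). **$J'$.** At each crossing let $Y=S,S',S'',\tilde S$ according to whether (under-strand, over-strand) is (thin, thin), (thick, thin), (thin, thick), (thick, thick). At an $X_+$ put the label $(\gamma'\otimes(\bar\gamma^* )')(Y)$, at an $X_-$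 put $(\gamma'\otimes(\bar\gamma^* )')(Y^{-1})$, the first factor (in $A$) on the under-strand and the second (in $A^*$) on the over-strand; $\gamma'$ (resp. $(\bar\gamma^* )'$) is $\gamma$ (resp. $\bar\gamma^*$) if the strand concerned is oriented upwards and the identity otherwise. The $i$th tensorand of $J'(Z)$ is the product of the labels on $Z_i$, read against the orientation and written from left to right, in $H(A)$ if $Z_i$ is thin and in $H(A)^{\mathrm{op}}$ if thick (class modulo commutators, arbitrary starting point, if $Z_i$ is closed). **Colored moves on $\mathcal{CD}$** (local, both directions). (1) Colored Pachner $(2,3)$ moves. Three strands $1,2,3$ with top endpoints in the order $1,2,3$ from left to right and bottom endpoints in the order $3,2,1$; all crossings are of type $X_+$, strand 1 under strands 2 and 3, strand 2 under strand 3. Strands 1 and 3 have arbitrary orientation and thickness; strand 2 is oriented downwards. If strand 2 is thin: crossings of $\{2,3\},\{1,3\},\{1,2\}$ from top to bottom $\leftrightarrow$ crossing of $\{1,2\}$, symmetry of $\{1,3\}$, crossing of $\{2,3\}$ from top to bottom. If strand 2 is thick: crossings of $\{1,2\},\{1,3\},\{2,3\}$ from top to bottom $\leftrightarrow$ crossing of $\{2,3\}$, symmetry of $\{1,3\}$, crossing of $\{1,2\}$ from top to bottom. There are also versions with strand 2 oriented upwards, each obtained from a version with strand 2 downwards by planar isotopies. (2) Colored $(0,2)$ moves: $X_+$ stacked on $X_-$, or $X_-$ on $X_+$, $\leftrightarrow$ two parallel vertical strands (arbitrary orientations and thickness). (3) Symmetry moves (arbitrary orientations and thickness): two stacked symmetries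 $\leftrightarrow$ two vertical strands; the braid relation for three symmetries; moving a strand having symmetries with both strands of a crossing across that crossing; moving a strand having a symmetry with one leg of a maximum or minimum across it. (4) Planar isotopies (arbitrary orientations and thickness): exchange of heights of distant pieces; zigzag straightening; slide moves: a transversal strand starting between the legs of a maximum (or minimum) and crossing its left leg $\leftrightarrow$ the same strand crossing its right leg, over/under information preserved. $\sim_c$ is generated by all colored moves; $\sim'_c$ by all colored moves except the slide moves in (4) of a real crossing across a maximum or minimum oriented from left to right and the moves (1) with strand 2 oriented upwards. **Colored cell complexes.** To a colored diagram $Z$ one associates a cell complex $\mathcal C(Z)$: take one tetrahedron with ordered vertices $v_0,v_1,v_2,v_3$ per crossing, with $\partial_i$ the face opposite to $v_i$. Reverse the orientations of all thick strands. With these new orientations, at a positive crossing the under-strand enters the tetrahedron through $\partial_1$ and leaves through $\partial_0$, and the over-strand enters through $\partial_3$ and leaves through $\partial_2$; at a negative crossing the under-strand enters through $\partial_0$ and leaves through $\partial_1$, and the over-strand enters through $\partial_2$ and leaves through $\partial_3$. Two faces are glued, by the affine map preserving the order of vertices, iff they are consecutive along a strand of $Z$ (i.e. joined by an arc of a strand containing no crossing). **Colored singular triangulations.** A singular triangulation is a finite cell decomposition into simplices such that each characteristic map restricted to a face is the composition of an affine isomorphism and another characteristic map. A colored singular triangulation of type $Z$ is a singular triangulation $X$ obtained from $\mathcal C(Z)$ by identifying finitely many (possibly zero) pairs of edges and pairs of vertices; $Z$ is part of the data. $\mathcal{CT}(Z)$ is the set of these, $\mathcal{CT}=\bigcup_Z\mathcal{CT}(Z)$,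 $\mathcal{CT}(\mu;\nu)=\bigcup_{Z\in\mathcal{CD}(\mu;\nu)}\mathcal{CT}(Z)$, and $\pi(X)=Z$ for $X\in\mathcal{CT}(Z)$. **Colored moves on $\mathcal{CT}$.** Let $X\in\mathcal{CT}(Z)$, $X'\in\mathcal{CT}(Z')$ with projections $\psi\colon\mathcal C(Z)\to X$, $\psi'\colon\mathcal C(Z')\to X'$. They are related by a given colored move if $Z$ and $Z'$ are related by that colored move and $\psi=\psi'$ on the exteriors $\mathcal C(Z)\setminus W=\mathcal C(Z')\setminus W'$, where $W$, $W'$ are the subcomplexes formed by the tetrahedra of the crossings involved in the move. $\sim_{ct}$ (resp. $\sim'_{ct}$) is the equivalence relation on $\mathcal{CT}$ generated by the colored moves generating $\sim_c$ (resp. $\sim'_c$). *)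

theory Defs
  imports Complex_Main "HOL-Library.Function_Algebras" "HOL-Library.FuncSet"
begin

section \<open>Tensor products\<close>

text \<open>
  Over a field, \<open>V \<otimes> W\<close> is realised inside the dual of the space of bilinear forms on
  \<open>V \<times> W\<close>: the pure tensor \<open>v \<otimes> w\<close> is evaluation at \<open>(v, w)\<close>, and \<open>V \<otimes> W\<close> is the set of finite
  sums of pure tensors (the scalar can be absorbed in a factor).  Tensors are normalised to be \<open>0\<close>
  at functions which are not bilinear forms.  For a tensor \<open>t = \<Sum>v\<^sub>i \<otimes> w\<^sub>i\<close> and a bilinear form
  \<open>\<beta>\<close>, the application \<open>t \<beta>\<close> is \<open>\<Sum>\<beta> v\<^sub>i w\<^sub>i\<close>.  The additive structure on functions is the pointwise
  one of Function_Algebras; the pointwise product of that theory is never used.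
\<close>

type_synonym ('v, 'w, 'k) tensor = "('v \<Rightarrow> 'w \<Rightarrow> 'k) \<Rightarrow> 'k"

definition fscale :: "'k::field \<Rightarrow> ('x \<Rightarrow> 'k) \<Rightarrow> 'x \<Rightarrow> 'k" where
  "fscale c f = (\<lambda>x. c * f x)"

definition bilinear_form ::
  "('k::field \<Rightarrow> 'v::ab_group_add \<Rightarrow> 'v) \<Rightarrow> 'v set \<Rightarrow> ('k \<Rightarrow> 'w::ab_group_add \<Rightarrow> 'w) \<Rightarrow> 'w set
    \<Rightarrow> ('v \<Rightarrow> 'w \<Rightarrow> 'k) \<Rightarrow> bool" where
  "bilinear_form s\<^sub>V V s\<^sub>W W \<beta> \<longleftrightarrow>
     (\<forall>v\<in>V. \<forall>v'\<in>V. \<forall>w\<in>W. \<beta> (v + v') w = \<beta> v w + \<beta> v' w) \<and>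
     (\<forall>v\<in>V. \<forall>w\<in>W. \<forall>w'\<in>W. \<beta> v (w + w') = \<beta> v w + \<beta> v w') \<and>
     (\<forall>c. \<forall>v\<in>V. \<forall>w\<in>W. \<beta> (s\<^sub>V c v) w = c * \<beta> v w \<and> \<beta> v (s\<^sub>W c w) = c * \<beta> v w)"

definition tens ::
  "('k::field \<Rightarrow> 'v::ab_group_add \<Rightarrow> 'v) \<Rightarrow> 'v set \<Rightarrow> ('k \<Rightarrow> 'w::ab_group_add \<Rightarrow> 'w) \<Rightarrow> 'w set
    \<Rightarrow> ('v \<times> 'w) list \<Rightarrow> ('v, 'w, 'k) tensor" where
  "tens s\<^sub>V V s\<^sub>W W ps =
     (\<lambda>\<beta>. if bilinear_form s\<^sub>V V s\<^sub>W W \<beta> then \<Sum>(v, w)\<leftarrow>ps. \<beta> v w else 0)"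

definition tensor_space ::
  "('k::field \<Rightarrow> 'v::ab_group_add \<Rightarrow> 'v) \<Rightarrow> 'v set \<Rightarrow> ('k \<Rightarrow> 'w::ab_group_add \<Rightarrow> 'w) \<Rightarrow> 'w set
    \<Rightarrow> ('v, 'w, 'k) tensor set" where
  "tensor_space s\<^sub>V V s\<^sub>W W = {tens s\<^sub>V V s\<^sub>W W ps | ps. set ps \<subseteq> V \<times> W}"


section \<open>Hopf algebras\<close>

text \<open>The ring structure is that of the type \<open>'a\<close>; it is the carrier of the algebra.\<close>

record ('k, 'a) hopf =
  smult :: "'k \<Rightarrow> 'a \<Rightarrow> 'a"
  comul :: "'a \<Rightarrow> ('a, 'a, 'k) tensor"
  counit :: "'a \<Rightarrow> 'k"
  antipode :: "'a \<Rightarrow> 'a"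

abbreviation tens2 :: "('k::field, 'a::ring_1) hopf \<Rightarrow> ('a \<times> 'a) list \<Rightarrow> ('a, 'a, 'k) tensor" where
  "tens2 A \<equiv> tens (smult A) UNIV (smult A) UNIV"

definition trilinear_form :: "('k::field, 'a::ring_1) hopf \<Rightarrow> ('a \<Rightarrow> 'a \<Rightarrow> 'a \<Rightarrow> 'k) \<Rightarrow> bool" where
  "trilinear_form A \<tau> \<longleftrightarrow>
     (\<forall>w. bilinear_form (smult A) UNIV (smult A) UNIV (\<lambda>u v. \<tau> u v w)) \<and>
     (\<forall>u. bilinear_form (smult A) UNIV (smult A) UNIV (\<tau> u))"

text \<open>
  In the axioms, \<open>comul A x = tens2 A ps\<close> says that \<open>ps\<close> lists the pairs \<open>(x', x'')\<close> of some
  Sweedler sum \<open>\<Delta>(x) = \<Sum>x' \<otimes> x''\<close>.  Coassociativity is an equality in \<open>A \<otimes> A \<otimes> A\<close>, tested on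
  trilinear forms.
\<close>

locale hopf_algebra =
  fixes A :: "('k::field, 'a::ring_1) hopf"
  assumes vector_space: "vector_space (smult A)"
    and smult_mult_left: "smult A c x * y = smult A c (x * y)"
    and smult_mult_right: "x * smult A c y = smult A c (x * y)"
    and comul_in: "comul A x \<in> tensor_space (smult A) UNIV (smult A) UNIV"
    and comul_add: "comul A (x + y) = comul A x + comul A y"
    and comul_smult: "comul A (smult A c x) = fscale c (comul A x)"
    and counit_linear: "Vector_Spaces.linear (smult A) (*) (counit A)"
    and coassoc: "comul A x = tens2 A ps \<Longrightarrow> trilinear_form A \<tau> \<Longrightarrow>
      (\<Sum>(u, v)\<leftarrow>ps. comul A u (\<lambda>u' u''. \<tau> u' u'' v)) =
      (\<Sum>(u, v)\<leftarrow>ps. comul A v (\<lambda>v' v''. \<tau> u v' v''))"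
    and counit_left: "comul A x = tens2 A ps \<Longrightarrow> (\<Sum>(u, v)\<leftarrow>ps. smult A (counit A u) v) = x"
    and counit_right: "comul A x = tens2 A ps \<Longrightarrow> (\<Sum>(u, v)\<leftarrow>ps. smult A (counit A v) u) = x"
    and comul_one: "comul A 1 = tens2 A [(1, 1)]"
    and comul_mult: "comul A x = tens2 A ps \<Longrightarrow> comul A y = tens2 A qs \<Longrightarrow>
      comul A (x * y) = tens2 A [(u * u', v * v'). (u, v) \<leftarrow> ps, (u', v') \<leftarrow> qs]"
    and counit_one: "counit A 1 = 1"
    and counit_mult: "counit A (x * y) = counit A x * counit A y"
    and antipode_linear: "Vector_Spaces.linear (smult A) (smult A) (antipode A)"
    and antipode_left: "comul A x = tens2 A ps \<Longrightarrow>
      (\<Sum>(u, v)\<leftarrow>ps. antipode A u * v) = smult A (counit A x) 1"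
    and antipode_right: "comul A x = tens2 A ps \<Longrightarrow>
      (\<Sum>(u, v)\<leftarrow>ps. u * antipode A v) = smult A (counit A x) 1"


section \<open>The Heisenberg double\<close>

definition dual_space :: "('k::field, 'a::ring_1) hopf \<Rightarrow> ('a \<Rightarrow> 'k) set" where
  "dual_space A = {f. Vector_Spaces.linear (smult A) (*) f}"

text \<open>The product of \<open>A\<^sup>*\<close>: \<open>(fg)(x) = \<Sum>f(x') g(x'')\<close>; its unit is the counit.\<close>

definition dual_mult :: "('k::field, 'a::ring_1) hopf \<Rightarrow> ('a \<Rightarrow> 'k) \<Rightarrow> ('a \<Rightarrow> 'k) \<Rightarrow> 'a \<Rightarrow> 'k" where
  "dual_mult A f g = (\<lambda>x. comul A x (\<lambda>u v. f u * g v))"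

type_synonym ('k, 'a) heis = "('a \<Rightarrow> 'k, 'a, 'k) tensor"

definition heis :: "('k::field, 'a::ring_1) hopf \<Rightarrow> ('k, 'a) heis set" where
  "heis A = tensor_space fscale (dual_space A) (smult A) UNIV"

definition hpure :: "('k::field, 'a::ring_1) hopf \<Rightarrow> ('a \<Rightarrow> 'k) \<Rightarrow> 'a \<Rightarrow> ('k, 'a) heis" where
  "hpure A f a = tens fscale (dual_space A) (smult A) UNIV [(f, a)]"

text \<open>The bilinear extension of \<open>(f \<otimes> a)(g \<otimes> b) = \<Sum>f g(?a') \<otimes> a''b\<close>.\<close>

definition heis_mult ::
  "('k::field, 'a::ring_1) hopf \<Rightarrow> ('k, 'a) heis \<Rightarrow> ('k, 'a) heis \<Rightarrow> ('k, 'a) heis" where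
  "heis_mult A s t = (\<lambda>\<beta>.
     if bilinear_form fscale (dual_space A) (smult A) UNIV \<beta>
     then s (\<lambda>f a. t (\<lambda>g b. comul A a (\<lambda>a' a''. \<beta> (dual_mult A f (\<lambda>x. g (x * a'))) (a'' * b))))
     else 0)"

definition heis_one :: "('k::field, 'a::ring_1) hopf \<Rightarrow> ('k, 'a) heis" where
  "heis_one A = hpure A (counit A) 1"

definition of_alg :: "('k::field, 'a::ring_1) hopf \<Rightarrow> 'a \<Rightarrow> ('k, 'a) heis" where
  "of_alg A x = hpure A (counit A) x"

definition of_dual :: "('k::field, 'a::ring_1) hopf \<Rightarrow> ('a \<Rightarrow> 'k) \<Rightarrow> ('k, 'a) heis" where
  "of_dual A f = hpure A f 1"

text \<open>
  The product of \<open>H(A)\<close> for a thin strand (\<open>True\<close>) and of \<open>H(A)\<^sup>o\<^sup>p\<close> for a thick strand (\<open>False\<close>).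
\<close>

definition strand_mult ::
  "('k::field, 'a::ring_1) hopf \<Rightarrow> bool \<Rightarrow> ('k, 'a) heis \<Rightarrow> ('k, 'a) heis \<Rightarrow> ('k, 'a) heis" where
  "strand_mult A is_thin s t = (if is_thin then heis_mult A s t else heis_mult A t s)"

definition commutator_span ::
  "('k::field, 'a::ring_1) hopf \<Rightarrow> bool \<Rightarrow> ('k, 'a) heis set" where
  "commutator_span A is_thin = module.span fscale
     {strand_mult A is_thin s t - strand_mult A is_thin t s | s t. s \<in> heis A \<and> t \<in> heis A}"


section \<open>The target of the universal invariant\<close>

text \<open>
  The signs \<open>+\<close> and \<open>-\<close> are \<open>True\<close> and \<open>False\<close>.  The \<open>i\<close>th tensorand is the quotient of the vector
  space \<open>H(A)\<close> (which is also that of \<open>H(A)\<^sup>o\<^sup>p\<close>) by \<open>slot_kernel A \<mu>\<^sub>i \<nu>\<^sub>i\<close>; its elements are cosets.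
\<close>

definition slot_kernel ::
  "('k::field, 'a::ring_1) hopf \<Rightarrow> bool \<Rightarrow> bool \<Rightarrow> ('k, 'a) heis set" where
  "slot_kernel A \<mu>\<^sub>i \<nu>\<^sub>i = (if \<nu>\<^sub>i then {0} else commutator_span A \<mu>\<^sub>i)"

definition coset :: "('k::field, 'a::ring_1) heis set \<Rightarrow> ('k, 'a) heis \<Rightarrow> ('k, 'a) heis set" where
  "coset N s = (\<lambda>n. s + n) ` N"

definition slot_space ::
  "('k::field, 'a::ring_1) hopf \<Rightarrow> ('k, 'a) heis set \<Rightarrow> ('k, 'a) heis set set" where
  "slot_space A N = coset N ` heis A"

text \<open>
  The tensor product of \<open>m\<close> quotients \<open>H(A)/N\<^sub>i\<close>, realised as above by means of the multilinear
  forms on \<open>\<Prod>\<^sub>i H(A)/N\<^sub>i\<close>.  For \<open>m = 0\<close> it is the ground field.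
\<close>

definition multilinear_form ::
  "('k::field, 'a::ring_1) hopf \<Rightarrow> (nat \<Rightarrow> ('k, 'a) heis set) \<Rightarrow> nat
    \<Rightarrow> ((nat \<Rightarrow> ('k, 'a) heis set) \<Rightarrow> 'k) \<Rightarrow> bool" where
  "multilinear_form A N m \<phi> \<longleftrightarrow>
     (\<forall>i<m. \<forall>x \<in> (\<Pi>\<^sub>E j\<in>{..<m}. slot_space A (N j)). \<forall>s\<in>heis A. \<forall>t\<in>heis A. \<forall>c.
        \<phi> (x(i := coset (N i) (s + t))) = \<phi> (x(i := coset (N i) s)) + \<phi> (x(i := coset (N i) t)) \<and>
        \<phi> (x(i := coset (N i) (fscale c s))) = c * \<phi> (x(i := coset (N i) s)))"

definition mpure ::
  "('k::field, 'a::ring_1) hopf \<Rightarrow> (nat \<Rightarrow> ('k, 'a) heis set) \<Rightarrow> nat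
    \<Rightarrow> (nat \<Rightarrow> ('k, 'a) heis set) \<Rightarrow> ((nat \<Rightarrow> ('k, 'a) heis set) \<Rightarrow> 'k) \<Rightarrow> 'k" where
  "mpure A N m x = (\<lambda>\<phi>. if multilinear_form A N m \<phi> then \<phi> x else 0)"

definition target ::
  "('k::field, 'a::ring_1) hopf \<Rightarrow> bool list \<Rightarrow> bool list
    \<Rightarrow> (((nat \<Rightarrow> ('k, 'a) heis set) \<Rightarrow> 'k) \<Rightarrow> 'k) set" where
  "target A \<mu> \<nu> =
     (let N = (\<lambda>i. slot_kernel A (\<mu> ! i) (\<nu> ! i)) in
      module.span fscale
        (mpure A N (length \<mu>) ` (\<Pi>\<^sub>E j\<in>{..<length \<mu>}. slot_space A (N j))))"


section \<open>Colored diagrams\<close>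

text \<open>
  A strand passing through an elementary piece carries the index of its component (counted from
  \<open>0\<close>) and its orientation.  A diagram is a vertical stack of layers, listed from top to bottom; a
  layer is a horizontal row of elementary pieces, listed from left to right.
  In \<open>Crossing x a b\<close> the strand \<open>a\<close> joins upper left to lower right and \<open>b\<close> joins upper right to
  lower left.  In \<open>Cap a\<close> (local maximum) and \<open>Cup a\<close> (local minimum), \<open>a\<close> describes the left leg.
\<close>

datatype dir = Up | Down

fun opposite :: "dir \<Rightarrow> dir" where
  "opposite Up = Down"
| "opposite Down = Up"

type_synonym strand = "nat \<times> dir"

datatype xtype = XPlus | XMinus | Virtual

datatype piece = Vert strand | Crossing xtype strand strand | Cap strand | Cup strand

type_synonym layer = "piece list"

record diagram =
  layers :: "layer list"
  thin :: "bool list"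

fun upper :: "piece \<Rightarrow> strand list" where
  "upper (Vert a) = [a]"
| "upper (Crossing x a b) = [a, b]"
| "upper (Cap a) = []"
| "upper (Cup a) = [a, (fst a, opposite (snd a))]"

fun lower :: "piece \<Rightarrow> strand list" where
  "lower (Vert a) = [a]"
| "lower (Crossing x a b) = [b, a]"
| "lower (Cap a) = [a, (fst a, opposite (snd a))]"
| "lower (Cup a) = []"

definition uppers :: "layer \<Rightarrow> strand list" where
  "uppers l = concat (map upper l)"

definition lowers :: "layer \<Rightarrow> strand list" where
  "lowers l = concat (map lower l)"

abbreviation verts :: "strand list \<Rightarrow> layer" where
  "verts \<equiv> map Vert"

definition composable :: "layer list \<Rightarrow> bool" where
  "composable ls \<longleftrightarrow> (\<forall>r. Suc r < length ls \<longrightarrow> lowers (ls ! r) = uppers (ls ! Suc r))"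

datatype role = Under | Over

type_synonym point = "nat \<times> nat"
type_synonym crossing = "nat \<times> nat"

text \<open>
  An arc \<open>(i, p, q, x)\<close> is the portion of component \<open>i\<close> inside one elementary piece, running from
  \<open>p\<close> to \<open>q\<close> along the orientation; \<open>x\<close> records the role of the strand if the piece is a real
  crossing.  In a piece, the point \<open>(0, i)\<close> is its \<open>i\<close>th upper and \<open>(1, i)\<close> its \<open>i\<close>th lower end.
\<close>

definition through :: "strand \<Rightarrow> nat \<Rightarrow> nat \<Rightarrow> role option \<Rightarrow> nat \<times> point \<times> point \<times> role option" where
  "through a i j x =
     (if snd a = Down then (fst a, (0, i), (1, j), x) else (fst a, (1, j), (0, i), x))"

fun role_left :: "xtype \<Rightarrow> role option" where
  "role_left XPlus = Some Under"
| "role_left XMinus = Some Over"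
| "role_left Virtual = None"

fun role_right :: "xtype \<Rightarrow> role option" where
  "role_right XPlus = Some Over"
| "role_right XMinus = Some Under"
| "role_right Virtual = None"

fun piece_arcs :: "piece \<Rightarrow> (nat \<times> point \<times> point \<times> role option) set" where
  "piece_arcs (Vert a) = {through a 0 0 None}"
| "piece_arcs (Crossing x a b) = {through a 0 1 (role_left x), through b 1 0 (role_right x)}"
| "piece_arcs (Cap a) =
     {if snd a = Up then (fst a, (1, 0), (1, 1), None) else (fst a, (1, 1), (1, 0), None)}"
| "piece_arcs (Cup a) =
     {if snd a = Down then (fst a, (0, 0), (0, 1), None) else (fst a, (0, 1), (0, 0), None)}"

text \<open>
  In a diagram, the point \<open>(l, i)\<close> is the \<open>i\<close>th strand end, from the left, on the horizontal line
  between layers \<open>l - 1\<close> and \<open>l\<close>; the crossing \<open>(r, j)\<close> is the \<open>j\<close>th piece of layer \<open>r\<close>.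
\<close>

definition place :: "layer \<Rightarrow> nat \<Rightarrow> nat \<Rightarrow> point \<Rightarrow> point" where
  "place l r j p =
     (r + fst p,
      length (if fst p = 0 then uppers (take j l) else lowers (take j l)) + snd p)"

type_synonym arc = "nat \<times> point \<times> point \<times> (crossing \<times> role) option"

abbreviation arc_comp :: "arc \<Rightarrow> nat" where "arc_comp a \<equiv> fst a"
abbreviation arc_source :: "arc \<Rightarrow> point" where "arc_source a \<equiv> fst (snd a)"
abbreviation arc_target :: "arc \<Rightarrow> point" where "arc_target a \<equiv> fst (snd (snd a))"
abbreviation arc_passage :: "arc \<Rightarrow> (crossing \<times> role) option" where
  "arc_passage a \<equiv> snd (snd (snd a))"

definition arcs :: "diagram \<Rightarrow> arc set" where
  "arcs Z =
     {(i, place (layers Z ! r) r j p, place (layers Z ! r) r j q, map_option (Pair (r, j)) x)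
       | i p q x r j.
         r < length (layers Z) \<and> j < length (layers Z ! r) \<and>
         (i, p, q, x) \<in> piece_arcs (layers Z ! r ! j)}"

text \<open>
  A traversal lists the arcs of the \<open>i\<close>th component in the order in which they are met along the
  orientation; for a closed component the starting point is arbitrary.
\<close>

definition traversal :: "diagram \<Rightarrow> nat \<Rightarrow> arc list \<Rightarrow> bool" where
  "traversal Z i as \<longleftrightarrow>
     as \<noteq> [] \<and> distinct as \<and> set as = {a \<in> arcs Z. arc_comp a = i} \<and>
     (\<forall>k. Suc k < length as \<longrightarrow> arc_target (as ! k) = arc_source (as ! Suc k))"

text \<open>
  The existence of traversals says that the strands labelled \<open>i\<close> form exactly one component.
\<close>

definition colored_diagram :: "diagram \<Rightarrow> bool" where
  "colored_diagram Z \<longleftrightarrow>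
     layers Z \<noteq> [] \<and> composable (layers Z) \<and>
     (\<forall>a\<in>arcs Z. arc_comp a < length (thin Z)) \<and>
     (\<forall>i<length (thin Z). \<exists>as. traversal Z i as)"

definition has_boundary :: "diagram \<Rightarrow> nat \<Rightarrow> bool" where
  "has_boundary Z i \<longleftrightarrow>
     i \<in> fst ` (set (uppers (hd (layers Z))) \<union> set (lowers (last (layers Z))))"

definition CD :: "bool list \<Rightarrow> bool list \<Rightarrow> diagram set" where
  "CD \<mu> \<nu> = {Z. colored_diagram Z \<and> thin Z = \<mu> \<and> map (has_boundary Z) [0..<length \<mu>] = \<nu>}"

definition crossings :: "diagram \<Rightarrow> crossing set" where
  "crossings Z =
     {(r, j). r < length (layers Z) \<and> j < length (layers Z ! r) \<and>
        (\<exists>x a b. layers Z ! r ! j = Crossing x a b \<and> x \<noteq> Virtual)}"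

definition xtype_of :: "diagram \<Rightarrow> crossing \<Rightarrow> xtype" where
  "xtype_of Z c = (case layers Z ! fst c ! snd c of Crossing x a b \<Rightarrow> x)"

definition strand_of :: "diagram \<Rightarrow> crossing \<Rightarrow> role \<Rightarrow> strand" where
  "strand_of Z c \<rho> =
     (case layers Z ! fst c ! snd c of
        Crossing x a b \<Rightarrow> if role_left x = Some \<rho> then a else b)"


section \<open>The universal quantum invariant\<close>

text \<open>
  With \<open>Y = \<Sum>\<^sub>e u\<^sub>e \<otimes> o\<^sub>e\<close> indexed by the basis \<open>B\<close>, the label of a crossing is expanded into its
  summands.  The tensor \<open>Y\<close> has \<open>u\<^sub>e = \<gamma>(e)\<close> or \<open>e\<close> according to whether the under-strand is thick or
  thin, and \<open>o\<^sub>e = (\<gamma>\<^sup>-\<^sup>1)\<^sup>*(e\<^sup>*)\<close> or \<open>e\<^sup>*\<close> according to whether the over-strand is thick or thin;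
  \<open>Y\<^sup>-\<^sup>1\<close> is obtained by replacing \<open>u\<^sub>e\<close> with \<open>\<gamma>(u\<^sub>e)\<close>.
\<close>

definition dual_basis :: "('k::field, 'a::ring_1) hopf \<Rightarrow> 'a set \<Rightarrow> 'a \<Rightarrow> 'a \<Rightarrow> 'k" where
  "dual_basis A B e = (\<lambda>x. module.representation (smult A) B x e)"

definition antipode_inv_dual :: "('k::field, 'a::ring_1) hopf \<Rightarrow> ('a \<Rightarrow> 'k) \<Rightarrow> 'a \<Rightarrow> 'k" where
  "antipode_inv_dual A f = f \<circ> inv (antipode A)"

definition under_label ::
  "('k::field, 'a::ring_1) hopf \<Rightarrow> diagram \<Rightarrow> crossing \<Rightarrow> 'a \<Rightarrow> 'a" where
  "under_label A Z c e =
     (let a = strand_of Z c Under;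
          u = (if thin Z ! fst a then e else antipode A e);
          u = (if xtype_of Z c = XPlus then u else antipode A u)
      in if snd a = Up then antipode A u else u)"

definition over_label ::
  "('k::field, 'a::ring_1) hopf \<Rightarrow> 'a set \<Rightarrow> diagram \<Rightarrow> crossing \<Rightarrow> 'a \<Rightarrow> 'a \<Rightarrow> 'k" where
  "over_label A B Z c e =
     (let a = strand_of Z c Over;
          f = dual_basis A B e;
          f = (if thin Z ! fst a then f else antipode_inv_dual A f)
      in if snd a = Up then antipode_inv_dual A f else f)"

text \<open>A state \<open>\<sigma>\<close> chooses a basis element, that is a summand of the label, at each crossing.\<close>

fun passage_label ::
  "('k::field, 'a::ring_1) hopf \<Rightarrow> 'a set \<Rightarrow> diagram \<Rightarrow> (crossing \<Rightarrow> 'a) \<Rightarrow> crossing \<times> role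
    \<Rightarrow> ('k, 'a) heis" where
  "passage_label A B Z \<sigma> (c, Under) = of_alg A (under_label A Z c (\<sigma> c))"
| "passage_label A B Z \<sigma> (c, Over) = of_dual A (over_label A B Z c (\<sigma> c))"

definition component_product ::
  "('k::field, 'a::ring_1) hopf \<Rightarrow> 'a set \<Rightarrow> diagram \<Rightarrow> (crossing \<Rightarrow> 'a) \<Rightarrow> nat \<Rightarrow> ('k, 'a) heis" where
  "component_product A B Z \<sigma> i =
     (let as = (SOME as. traversal Z i as);
          ls = map (passage_label A B Z \<sigma>) (rev (List.map_filter arc_passage as))
      in foldr (strand_mult A (thin Z ! i)) ls (heis_one A))"

definition universal_invariant ::
  "('k::field, 'a::ring_1) hopf \<Rightarrow> 'a set \<Rightarrow> diagram
    \<Rightarrow> ((nat \<Rightarrow> ('k, 'a) heis set) \<Rightarrow> 'k) \<Rightarrow> 'k" where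
  "universal_invariant A B Z =
     (let m = length (thin Z);
          N = (\<lambda>i. slot_kernel A (thin Z ! i) (has_boundary Z i))
      in \<Sum>\<sigma> \<in> (\<Pi>\<^sub>E c\<in>crossings Z. B).
           mpure A N m (\<lambda>i\<in>{..<m}. coset (N i) (component_product A B Z \<sigma> i)))"


section \<open>Colored moves\<close>

text \<open>
  A pattern relates two stacks of layers with the same boundary; \<open>th i\<close> says that component \<open>i\<close> is
  thin.  Patterns are given in one direction only, the relations below being generated as
  equivalence relations.
\<close>

definition flip :: "xtype \<Rightarrow> xtype" where
  "flip x = (case x of XPlus \<Rightarrow> XMinus | XMinus \<Rightarrow> XPlus | Virtual \<Rightarrow> Virtual)"

abbreviation reverse :: "strand \<Rightarrow> strand" where
  "reverse a \<equiv> (fst a, opposite (snd a))"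

abbreviation XP :: "strand \<Rightarrow> strand \<Rightarrow> piece" where "XP \<equiv> Crossing XPlus"
abbreviation XM :: "strand \<Rightarrow> strand \<Rightarrow> piece" where "XM \<equiv> Crossing XMinus"
abbreviation Sy :: "strand \<Rightarrow> strand \<Rightarrow> piece" where "Sy \<equiv> Crossing Virtual"

text \<open>
  \<open>pachner_A\<close> is the Pachner move of a thin, \<open>pachner_B\<close> that of a thick strand \<open>b\<close> oriented
  downwards; a half turn of the picture, which reverses \<open>b\<close>, exchanges the two.
\<close>

inductive pachner_A :: "strand \<Rightarrow> strand \<Rightarrow> strand \<Rightarrow> layer list \<Rightarrow> layer list \<Rightarrow> bool" for a b c where
  "pachner_A a b c
     [[Vert a, XP b c], [XP a c, Vert b], [Vert c, XP a b]]
     [[XP a b, Vert c], [Vert b, Sy a c], [XP b c, Vert a]]"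

inductive pachner_B :: "strand \<Rightarrow> strand \<Rightarrow> strand \<Rightarrow> layer list \<Rightarrow> layer list \<Rightarrow> bool" for a b c where
  "pachner_B a b c
     [[XP a b, Vert c], [Vert b, XP a c], [XP b c, Vert a]]
     [[Vert a, XP b c], [Sy a c, Vert b], [Vert c, XP a b]]"

text \<open>
  A strand \<open>t\<close> starting between the legs of a maximum or minimum and crossing its left leg \<open>l\<close>, and
  the same strand crossing the right leg.
\<close>

inductive cap_slide :: "xtype \<Rightarrow> strand \<Rightarrow> strand \<Rightarrow> layer list \<Rightarrow> layer list \<Rightarrow> bool" for x t l where
  "cap_slide x t l
     [[Vert t, Cap l], [Crossing x t l, Vert (reverse l)]]
     [[Cap l, Vert t], [Vert l, Crossing (flip x) (reverse l) t]]"

inductive cup_slide :: "xtype \<Rightarrow> strand \<Rightarrow> strand \<Rightarrow> layer list \<Rightarrow> layer list \<Rightarrow> bool" for x t l where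
  "cup_slide x t l
     [[Crossing x l t, Vert (reverse l)], [Vert t, Cup l]]
     [[Vert l, Crossing (flip x) t (reverse l)], [Cup l, Vert t]]"

definition trivial_layer :: "layer \<Rightarrow> bool" where
  "trivial_layer l \<longleftrightarrow> (\<forall>p\<in>set l. \<exists>a. p = Vert a)"

text \<open>
  The patterns generating \<open>\<sim>'\<^sub>c\<close>.  A maximum is oriented from left to right if its left leg is
  oriented upwards, a minimum if its left leg is oriented downwards.  The braid relation for three
  symmetries is the case \<open>x = Virtual\<close> of \<open>sym_crossing_1\<close>.
\<close>

inductive basic_pattern :: "(nat \<Rightarrow> bool) \<Rightarrow> layer list \<Rightarrow> layer list \<Rightarrow> bool" for th where
  pachner_thin: "\<lbrakk>snd b = Down; th (fst b); pachner_A a b c W W'\<rbrakk> \<Longrightarrow> basic_pattern th W W'"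
| pachner_thick: "\<lbrakk>snd b = Down; \<not> th (fst b); pachner_B a b c W W'\<rbrakk> \<Longrightarrow> basic_pattern th W W'"
| zero_two_1: "basic_pattern th [[XP a b], [XM b a]] [[Vert a, Vert b]]"
| zero_two_2: "basic_pattern th [[XM a b], [XP b a]] [[Vert a, Vert b]]"
| sym_sym: "basic_pattern th [[Sy a b], [Sy b a]] [[Vert a, Vert b]]"
| sym_crossing_1: "basic_pattern th
    [[Crossing x a b, Vert c], [Vert b, Sy a c], [Sy b c, Vert a]]
    [[Vert a, Sy b c], [Sy a c, Vert b], [Vert c, Crossing x a b]]"
| sym_crossing_2: "basic_pattern th
    [[Vert a, Crossing x b c], [Sy a c, Vert b], [Vert c, Sy a b]]
    [[Sy a b, Vert c], [Vert b, Sy a c], [Crossing x b c, Vert a]]"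
| sym_crossing_3: "basic_pattern th
    [[Sy a b, Vert c], [Vert b, Crossing x a c], [Sy b c, Vert a]]
    [[Vert a, Sy b c], [Crossing x a c, Vert b], [Vert c, Sy a b]]"
| cap_slide: "\<lbrakk>x = Virtual \<or> snd l = Down; cap_slide x t l W W'\<rbrakk> \<Longrightarrow> basic_pattern th W W'"
| cup_slide: "\<lbrakk>x = Virtual \<or> snd l = Up; cup_slide x t l W W'\<rbrakk> \<Longrightarrow> basic_pattern th W W'"
| zigzag_1: "basic_pattern th [[Vert a, Cap (reverse a)], [Cup a, Vert a]] [[Vert a]]"
| zigzag_2: "basic_pattern th [[Cap a, Vert a], [Vert a, Cup (reverse a)]] [[Vert a]]"
| stretch: "basic_pattern th [verts as] []"
| height_left: "\<lbrakk>\<not> trivial_layer f; \<not> trivial_layer g\<rbrakk> \<Longrightarrow>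
    basic_pattern th [f @ verts (uppers g), verts (lowers f) @ g] [f @ g]"
| height_right: "\<lbrakk>\<not> trivial_layer f; \<not> trivial_layer g\<rbrakk> \<Longrightarrow>
    basic_pattern th [verts (uppers f) @ g, f @ verts (lowers g)] [f @ g]"

inductive colored_pattern :: "(nat \<Rightarrow> bool) \<Rightarrow> layer list \<Rightarrow> layer list \<Rightarrow> bool" for th where
  basic: "basic_pattern th W W' \<Longrightarrow> colored_pattern th W W'"
| pachner_thin_up: "\<lbrakk>snd b = Up; th (fst b); pachner_B a b c W W'\<rbrakk> \<Longrightarrow> colored_pattern th W W'"
| pachner_thick_up: "\<lbrakk>snd b = Up; \<not> th (fst b); pachner_A a b c W W'\<rbrakk> \<Longrightarrow> colored_pattern th W W'"
| cap_slide_right: "cap_slide x t l W W' \<Longrightarrow> colored_pattern th W W'"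
| cup_slide_right: "cup_slide x t l W W' \<Longrightarrow> colored_pattern th W W'"

text \<open>
  \<open>move_at P h n n' Z Z'\<close>: below the first \<open>h\<close> layers, which are common, a block of \<open>n\<close> layers of
  \<open>Z\<close> consisting of one side of a pattern and of vertical strands to its left and right is replaced
  by the corresponding block of \<open>n'\<close> layers for the other side.  Moves next to other pieces are
  reached by means of the patterns \<open>stretch\<close>, \<open>height_left\<close> and \<open>height_right\<close>.
\<close>

definition move_at ::
  "((nat \<Rightarrow> bool) \<Rightarrow> layer list \<Rightarrow> layer list \<Rightarrow> bool) \<Rightarrow> nat \<Rightarrow> nat \<Rightarrow> nat
    \<Rightarrow> diagram \<Rightarrow> diagram \<Rightarrow> bool" where
  "move_at P h n n' Z Z' \<longleftrightarrow>
     (\<exists>ls ls' W W' L R.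
        thin Z' = thin Z \<and> P (\<lambda>i. thin Z ! i) W W' \<and>
        h = length ls \<and> n = length W \<and> n' = length W' \<and>
        layers Z = ls @ map (\<lambda>w. verts L @ w @ verts R) W @ ls' \<and>
        layers Z' = ls @ map (\<lambda>w. verts L @ w @ verts R) W' @ ls')"


section \<open>Colored cell complexes\<close>

text \<open>
  A point of the disjoint union of the tetrahedra is a crossing together with the list of the
  barycentric coordinates with respect to \<open>v\<^sub>0, v\<^sub>1, v\<^sub>2, v\<^sub>3\<close>.  The complex \<open>C(Z)\<close> and its quotients
  are given by the kernels of the projections from this disjoint union, that is by equivalence
  relations; the spaces are the sets of classes with the quotient topology.
\<close>

type_synonym tet_point = "crossing \<times> real list"

definition std_simplex :: "nat \<Rightarrow> real list set" where
  "std_simplex d = {t. length t = Suc d \<and> (\<forall>x\<in>set t. 0 \<le> x) \<and> sum_list t = 1}"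

definition tet_points :: "diagram \<Rightarrow> tet_point set" where
  "tet_points Z = crossings Z \<times> std_simplex 3"

definition generated_equiv :: "'p set \<Rightarrow> ('p \<times> 'p) set \<Rightarrow> ('p \<times> 'p) set" where
  "generated_equiv S r = {(x, y). x \<in> S \<and> y \<in> S \<and> equivclp (\<lambda>u v. (u, v) \<in> r) x y}"

text \<open>
  Directions and signs are taken after reversing the thick strands.  An \<open>X\<^sub>+\<close> is positive iff both
  strands point upwards or both downwards; an \<open>X\<^sub>-\<close> is positive iff they do not.
\<close>

definition new_dir :: "diagram \<Rightarrow> strand \<Rightarrow> dir" where
  "new_dir Z a = (if thin Z ! fst a then snd a else opposite (snd a))"

definition positive :: "diagram \<Rightarrow> crossing \<Rightarrow> bool" where
  "positive Z c \<longleftrightarrow>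
     (xtype_of Z c = XPlus \<longleftrightarrow>
      new_dir Z (strand_of Z c Under) = new_dir Z (strand_of Z c Over))"

text \<open>The index \<open>i\<close> of the face \<open>\<partial>\<^sub>i\<close> through which a strand enters and leaves a tetrahedron.\<close>

fun entry_face :: "bool \<Rightarrow> role \<Rightarrow> nat" where
  "entry_face pos Under = (if pos then 1 else 0)"
| "entry_face pos Over = (if pos then 3 else 2)"

fun exit_face :: "bool \<Rightarrow> role \<Rightarrow> nat" where
  "exit_face pos Under = (if pos then 0 else 1)"
| "exit_face pos Over = (if pos then 2 else 3)"

text \<open>\<open>(c', \<rho>')\<close> is the passage following \<open>(c, \<rho>)\<close> along component \<open>i\<close> in the original orientation.\<close>

definition consecutive :: "diagram \<Rightarrow> nat \<Rightarrow> crossing \<times> role \<Rightarrow> crossing \<times> role \<Rightarrow> bool" where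
  "consecutive Z i x y \<longleftrightarrow>
     (\<exists>a\<in>arcs Z. \<exists>b\<in>arcs Z. arc_comp a = i \<and> arc_comp b = i \<and>
        arc_passage a = Some x \<and> arc_passage b = Some y \<and>
        (arc_target a, arc_source b)
          \<in> {(arc_source d, arc_target d) | d. d \<in> arcs Z \<and> arc_passage d = None}\<^sup>*)"

definition new_consecutive :: "diagram \<Rightarrow> nat \<Rightarrow> crossing \<times> role \<Rightarrow> crossing \<times> role \<Rightarrow> bool" where
  "new_consecutive Z i x y \<longleftrightarrow> (if thin Z ! i then consecutive Z i x y else consecutive Z i y x)"

text \<open>The point of \<open>\<partial>\<^sub>i\<close> with barycentric coordinates \<open>s\<close> with respect to its ordered vertices.\<close>

definition face_point :: "nat \<Rightarrow> real list \<Rightarrow> real list" where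
  "face_point i s = take i s @ 0 # drop i s"

definition face_gluing :: "diagram \<Rightarrow> (tet_point \<times> tet_point) set" where
  "face_gluing Z =
     {((c, face_point (exit_face (positive Z c) \<rho>) s),
       (c', face_point (entry_face (positive Z c') \<rho>') s))
      | i c \<rho> c' \<rho>' s. new_consecutive Z i (c, \<rho>) (c', \<rho>') \<and> s \<in> std_simplex 2}"

definition cell_complex :: "diagram \<Rightarrow> (tet_point \<times> tet_point) set" where
  "cell_complex Z = generated_equiv (tet_points Z) (face_gluing Z)"


section \<open>Colored singular triangulations\<close>

definition face_of :: "crossing \<Rightarrow> nat set \<Rightarrow> tet_point set" where
  "face_of c F = {c} \<times> {t \<in> std_simplex 3. \<forall>k<4. k \<notin> F \<longrightarrow> t ! k = 0}"

definition open_face_of :: "crossing \<Rightarrow> nat set \<Rightarrow> tet_point set" where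
  "open_face_of c F = {c} \<times> {t \<in> std_simplex 3. \<forall>k<4. k \<notin> F \<longleftrightarrow> t ! k = 0}"

text \<open>The affine map from the face \<open>F\<close> to the face \<open>G\<close> induced by a bijection \<open>h\<close> of vertices.\<close>

definition affine_face_map :: "nat set \<Rightarrow> nat set \<Rightarrow> (nat \<Rightarrow> nat) \<Rightarrow> real list \<Rightarrow> real list" where
  "affine_face_map F G h t = map (\<lambda>k. if k \<in> G then t ! inv_into F h k else 0) [0..<4]"

text \<open>
  The images of the faces of the tetrahedra of \<open>Z\<close> form a singular triangulation: characteristic
  maps are injective on open simplices, and two faces whose open simplices meet in the quotient
  define the same cell, their characteristic maps differing by an affine isomorphism.
\<close>

definition singular_triangulation :: "diagram \<Rightarrow> (tet_point \<times> tet_point) set \<Rightarrow> bool" where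
  "singular_triangulation Z E \<longleftrightarrow>
     (\<forall>c\<in>crossings Z. \<forall>F. F \<noteq> {} \<and> F \<subseteq> {..<4} \<longrightarrow>
        (\<forall>x\<in>open_face_of c F. \<forall>y\<in>open_face_of c F. (x, y) \<in> E \<longrightarrow> x = y)) \<and>
     (\<forall>c\<in>crossings Z. \<forall>d\<in>crossings Z. \<forall>F G.
        F \<noteq> {} \<and> F \<subseteq> {..<4} \<and> G \<noteq> {} \<and> G \<subseteq> {..<4} \<and>
        (\<exists>x\<in>open_face_of c F. \<exists>y\<in>open_face_of d G. (x, y) \<in> E) \<longrightarrow>
        (\<exists>h. bij_betw h F G \<and>
           (\<forall>t. (c, t) \<in> face_of c F \<longrightarrow> ((c, t), (d, affine_face_map F G h t)) \<in> E)))"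

text \<open>
  Edges are given with a direction, so that a pair of edges determines the affine isomorphism by
  which they are identified.
\<close>

definition edges :: "diagram \<Rightarrow> (crossing \<times> nat \<times> nat) set" where
  "edges Z = {(c, v, w). c \<in> crossings Z \<and> v < 4 \<and> w < 4 \<and> v \<noteq> w}"

definition edge_point :: "nat \<Rightarrow> nat \<Rightarrow> real \<Rightarrow> real list" where
  "edge_point v w s = map (\<lambda>k. if k = v then 1 - s else if k = w then s else 0) [0..<4]"

definition vertex_point :: "nat \<Rightarrow> real list" where
  "vertex_point v = map (\<lambda>k. if k = v then 1 else 0) [0..<4]"

definition edge_gluing ::
  "((crossing \<times> nat \<times> nat) \<times> (crossing \<times> nat \<times> nat)) set \<Rightarrow> (tet_point \<times> tet_point) set" where
  "edge_gluing P =
     {((c, edge_point v w s), (c', edge_point v' w' s)) | c v w c' v' w' s.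
        ((c, v, w), (c', v', w')) \<in> P \<and> 0 \<le> s \<and> s \<le> 1}"

definition vertex_gluing ::
  "((crossing \<times> nat) \<times> (crossing \<times> nat)) set \<Rightarrow> (tet_point \<times> tet_point) set" where
  "vertex_gluing Q =
     {((c, vertex_point v), (c', vertex_point v')) | c v c' v'. ((c, v), (c', v')) \<in> Q}"

text \<open>A colored singular triangulation is its type together with the kernel of the projection.\<close>

type_synonym ctriang = "diagram \<times> (tet_point \<times> tet_point) set"

definition CT :: "ctriang set" where
  "CT = {(Z, E). colored_diagram Z \<and> singular_triangulation Z E \<and>
     (\<exists>P Q. finite P \<and> P \<subseteq> edges Z \<times> edges Z \<and>
        finite Q \<and> Q \<subseteq> (crossings Z \<times> {..<4}) \<times> (crossings Z \<times> {..<4}) \<and>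
        E = generated_equiv (tet_points Z) (face_gluing Z \<union> edge_gluing P \<union> vertex_gluing Q))}"

definition ct_type :: "ctriang \<Rightarrow> diagram" where
  "ct_type X = fst X"

definition CT_of :: "bool list \<Rightarrow> bool list \<Rightarrow> ctriang set" where
  "CT_of \<mu> \<nu> = {X \<in> CT. ct_type X \<in> CD \<mu> \<nu>}"

text \<open>
  The points of the tetrahedra which represent points of \<open>C(Z) \ W\<close>, where \<open>W\<close> is formed by the
  tetrahedra of the crossings in layers \<open>h, ..., h + n - 1\<close>.
\<close>

definition exterior :: "diagram \<Rightarrow> nat \<Rightarrow> nat \<Rightarrow> tet_point set" where
  "exterior Z h n =
     {x \<in> tet_points Z. \<forall>y. (x, y) \<in> cell_complex Z \<longrightarrow> \<not> (h \<le> fst (fst y) \<and> fst (fst y) < h + n)}"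

definition shift :: "nat \<Rightarrow> nat \<Rightarrow> nat \<Rightarrow> tet_point \<Rightarrow> tet_point" where
  "shift h n n' x =
     (case x of ((r, j), t) \<Rightarrow> ((if r < h then r else r - n + n', j), t))"

text \<open>
  The two projections agree on the exteriors: they have the same kernel there.  In a (0,2) move the
  exterior on the side of the parallel strands also contains the interior of the faces glued along
  these strands, so the comparison is made on the common part.
\<close>

definition ct_move ::
  "((nat \<Rightarrow> bool) \<Rightarrow> layer list \<Rightarrow> layer list \<Rightarrow> bool) \<Rightarrow> ctriang \<Rightarrow> ctriang \<Rightarrow> bool" where
  "ct_move P X X' \<longleftrightarrow> X \<in> CT \<and> X' \<in> CT \<and>
     (\<exists>h n n'. move_at P h n n' (fst X) (fst X') \<and>
        (\<forall>x \<in> exterior (fst X) h n. \<forall>y \<in> exterior (fst X) h n.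
           shift h n n' x \<in> exterior (fst X') h n' \<longrightarrow> shift h n n' y \<in> exterior (fst X') h n' \<longrightarrow>
           ((x, y) \<in> snd X \<longleftrightarrow> (shift h n n' x, shift h n n' y) \<in> snd X')))"

text \<open>The relations \<open>\<sim>\<^sub>c\<^sub>t\<close> and \<open>\<sim>'\<^sub>c\<^sub>t\<close>, the latter being the restricted one.\<close>

definition ct_equiv :: "ctriang \<Rightarrow> ctriang \<Rightarrow> bool" where
  "ct_equiv = equivclp (ct_move colored_pattern)"

definition ct_equiv' :: "ctriang \<Rightarrow> ctriang \<Rightarrow> bool" where
  "ct_equiv' = equivclp (ct_move basic_pattern)"

end

theory Submission
  imports Defs "HOL-Library.Multiset"
begin

text \<open>
  Up to antipodes and the order of multiplication, \<open>J'(Z)\<close> is a state sum in which each crossing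
  contributes the canonical element \<open>\<Sum> e\<^sub>a \<otimes> e\<^sup>a\<close>.  Since each tensorand is multilinear in the products of
  labels along the pieces of its component, and commutators vanish in the closed components, it is enough
  to compare the products of labels along the strands of the pattern of a move.  Reversing or thickening a
  strand applies the antipode, which is an anti-automorphism, to its labels and also reverses the order of
  the factors.  The \<open>(0,2)\<close> moves then become \<open>S S\<^sup>-\<^sup>1 = 1\<close>, and the \<open>(2,3)\<close> moves become the pentagon
  relation of the Heisenberg double, twisted by antipodes.  A slide turns a crossing into one of the other
  type and reverses the orientation of one strand at it; on the labels this is harmless, as
  \<open>\<gamma> \<otimes> (\<gamma>\<^sup>-\<^sup>1)\<^sup>*\<close> fixes the canonical element, except for the orientation from left to right,
  where \<open>\<gamma>\<^sup>2 = 1\<close> is needed.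
\<close>

section \<open>Sweedler calculus\<close>

text \<open>\<open>J'\<close> is computed from an unspecified traversal of each component, so a
  local change has to be turned into a comparison of whole traversals. The means is a list of
  matches, each a strand with a chain of arcs in either diagram: together they exhaust the arcs of
  both diagrams, and corresponding chains have corresponding ends. As no point is the source or the
  target of two arcs, every traversal runs, up to its starting point, through whole chains, in an
  order that serves for both diagrams.

  Tensors are functionals on bilinear forms, so identities in Sweedler notation are tested against
  forms, and each rearrangement is a rule for \<open>comul A x\<close> applied to a form. Linearity
  in every slot must be shown each time, because tensors vanish on other functions.

  A strand is handled through the number of antipodes on its labels: its parity decides which of the
  two pictures of a Pachner move is the pentagon, and a slide changes this number by one.\<close>

locale finite_hopf = hopf_algebra A for A :: "('k::field, 'a::ring_1) hopf" +
  fixes B :: "'a set"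
  assumes finite_dimensional: "finite_dimensional_vector_space (smult A) B"
    and bij_antipode: "bij (antipode A)"

sublocale finite_hopf \<subseteq> V: finite_dimensional_vector_space "smult A" B
  by (rule finite_dimensional)

context finite_hopf
begin

abbreviation "sm \<equiv> smult A"
abbreviation "D \<equiv> comul A"
abbreviation "eps \<equiv> counit A"
abbreviation "S \<equiv> antipode A"
abbreviation "T \<equiv> inv (antipode A)"
abbreviation "bil \<equiv> bilinear_form sm UNIV sm UNIV"

section \<open>Linear and bilinear forms on \<open>A\<close>\<close>

definition lform :: "('a \<Rightarrow> 'k) \<Rightarrow> bool" where
  "lform f \<longleftrightarrow> (\<forall>x y. f (x + y) = f x + f y) \<and> (\<forall>c x. f (sm c x) = c * f x)"

definition llin :: "('a \<Rightarrow> 'a) \<Rightarrow> bool" where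
  "llin f \<longleftrightarrow> (\<forall>x y. f (x + y) = f x + f y) \<and> (\<forall>c x. f (sm c x) = sm c (f x))"

lemma dual_space_iff: "f \<in> dual_space A \<longleftrightarrow> lform f"
proof -
  have "vector_space ((*) :: 'k \<Rightarrow> 'k \<Rightarrow> 'k)"
    by unfold_locales (auto simp: algebra_simps)
  then show ?thesis
    using vector_space
    by (auto simp: dual_space_def lform_def Vector_Spaces.linear_def module_hom_def
        module_hom_axioms_def vector_space_def module_def)
qed

lemma lform_add: "lform f \<Longrightarrow> f (x + y) = f x + f y"
  and lform_smult: "lform f \<Longrightarrow> f (sm c x) = c * f x"
  by (auto simp: lform_def)

lemma lform_zero: "lform f \<Longrightarrow> f 0 = 0"
  using lform_smult[of f 0 0] by simp

lemma lform_sum: "lform f \<Longrightarrow> f (sum g X) = (\<Sum>x\<in>X. f (g x))"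
  by (induction X rule: infinite_finite_induct) (auto simp: lform_zero lform_add)

lemma lform_sum_list: "lform f \<Longrightarrow> f (sum_list xs) = sum_list (map f xs)"
  by (induction xs) (auto simp: lform_zero lform_add)

lemma bil_iff: "bil \<beta> \<longleftrightarrow> (\<forall>v. lform (\<beta> v)) \<and> (\<forall>w. lform (\<lambda>v. \<beta> v w))"
  by (auto simp: bilinear_form_def lform_def)

lemma bilI: "(\<And>v. lform (\<beta> v)) \<Longrightarrow> (\<And>w. lform (\<lambda>v. \<beta> v w)) \<Longrightarrow> bil \<beta>"
  by (auto simp: bil_iff)

lemma bil_1: "bil \<beta> \<Longrightarrow> lform (\<lambda>v. \<beta> v w)"
  and bil_2: "bil \<beta> \<Longrightarrow> lform (\<beta> v)"
  by (auto simp: bil_iff)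

lemma llin_S: "llin S"
  using antipode_linear
  by (auto simp: llin_def Vector_Spaces.linear_def module_hom_def module_hom_axioms_def)

lemma S_T [simp]: "S (T x) = x"
  using bij_antipode by (simp add: bij_is_surj surj_f_inv_f)

lemma T_S [simp]: "T (S x) = x"
  using bij_antipode by (simp add: bij_is_inj)

lemma llin_T: "llin T"
  unfolding llin_def
  by (metis S_T T_S llin_S llin_def)

lemma lform_eps: "lform eps"
  using counit_linear dual_space_iff by (simp add: dual_space_def)

text \<open>Multilinear expressions are written as lambda terms built from products, antipodes, the
  counit and Sweedler sums; with these rules \<open>intro\<close> proves linearity in any single
  slot.\<close>

named_theorems lin

lemma llin_id [lin]: "llin (\<lambda>x. x)"
  and llin_mult_left [lin]: "llin f \<Longrightarrow> llin (\<lambda>x. f x * y)"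
  and llin_mult_right [lin]: "llin f \<Longrightarrow> llin (\<lambda>x. y * f x)"
  and llin_S_comp [lin]: "llin f \<Longrightarrow> llin (\<lambda>x. S (f x))"
  and llin_T_comp [lin]: "llin f \<Longrightarrow> llin (\<lambda>x. T (f x))"
  using llin_S llin_T by (auto simp: llin_def smult_mult_left smult_mult_right algebra_simps)

lemma lform_comp: "lform l \<Longrightarrow> llin f \<Longrightarrow> lform (\<lambda>x. l (f x))"
  by (auto simp: llin_def lform_def)

lemma lform_scale_left [lin]: "lform f \<Longrightarrow> lform (\<lambda>x. f x * c)"
  and lform_scale_right [lin]: "lform f \<Longrightarrow> lform (\<lambda>x. c * f x)"
  and lform_eps_comp [lin]: "llin g \<Longrightarrow> lform (\<lambda>x. eps (g x))"
  using lform_eps by (auto simp: lform_def llin_def algebra_simps)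

section \<open>The coproduct tested against bilinear forms\<close>

lemma D_list: obtains ps where "D x = tens2 A ps"
  using comul_in[of x] by (auto simp: tensor_space_def)

lemma tens2_bil: "bil \<beta> \<Longrightarrow> tens2 A ps \<beta> = (\<Sum>(u, v)\<leftarrow>ps. \<beta> u v)"
  by (simp add: tens_def)

lemma D_add: "D (x + y) \<beta> = D x \<beta> + D y \<beta>"
  by (simp add: comul_add)

lemma D_smult: "D (sm c x) \<beta> = c * D x \<beta>"
  by (simp add: comul_smult fscale_def)

lemma lform_D [lin]: "llin g \<Longrightarrow> lform (\<lambda>x. D (g x) \<beta>)"
  by (auto simp: lform_def llin_def D_add D_smult)

lemma D_add_form: "bil \<beta> \<Longrightarrow> bil \<beta>' \<Longrightarrow> D x (\<lambda>u v. \<beta> u v + \<beta>' u v) = D x \<beta> + D x \<beta>'"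
  and D_scale_form: "bil \<beta> \<Longrightarrow> D x (\<lambda>u v. c * \<beta> u v) = c * D x \<beta>"
proof -
  obtain ps where ps: "D x = tens2 A ps" by (rule D_list)
  have *: "bil (\<lambda>u v. \<beta> u v + \<beta>' u v)" if "bil \<beta>" "bil \<beta>'"
    using that by (auto simp: bil_iff lform_def algebra_simps)
  show "D x (\<lambda>u v. \<beta> u v + \<beta>' u v) = D x \<beta> + D x \<beta>'" if "bil \<beta>" "bil \<beta>'"
    using that * by (simp add: ps tens2_bil sum_list_addf case_prod_unfold)
  have *: "bil (\<lambda>u v. c * \<beta> u v)" if "bil \<beta>"
    using that by (auto simp: bil_iff lform_def algebra_simps)
  show "D x (\<lambda>u v. c * \<beta> u v) = c * D x \<beta>" if "bil \<beta>"
    using that * by (simp add: ps tens2_bil sum_list_const_mult case_prod_unfold)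
qed

lemma D_scale_form': "bil \<beta> \<Longrightarrow> D x (\<lambda>u v. \<beta> u v * c) = D x \<beta> * c"
  using D_scale_form[of \<beta> x c] by (simp add: mult.commute)

text \<open>Linearity in a parameter of the form, as opposed to the argument of \<open>D\<close>.
  This is what allows Sweedler sums to be nested.\<close>

lemma lform_D_form [lin]:
  assumes "\<And>x. bil (\<beta> x)" "\<And>u v. lform (\<lambda>x. \<beta> x u v)"
  shows "lform (\<lambda>x. D w (\<lambda>u v. \<beta> x u v))"
proof -
  have "\<beta> (x + y) = (\<lambda>u v. \<beta> x u v + \<beta> y u v)" "\<beta> (sm c x) = (\<lambda>u v. c * \<beta> x u v)" for x y c
    using assms(2) by (auto simp: lform_def fun_eq_iff)
  then show ?thesis
    using assms(1) D_add_form D_scale_form by (auto simp: lform_def)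
qed

text \<open>Fubini for independent Sweedler sums: both sides are finite double sums. The nested
  forms must first be shown to be bilinear, as only then does a tensor evaluate to its sum.\<close>

lemma D_swap:
  assumes "\<And>u v. bil (\<tau> u v)" "\<And>p q. bil (\<lambda>u v. \<tau> u v p q)"
  shows "D x (\<lambda>u v. D y (\<lambda>p q. \<tau> u v p q)) = D y (\<lambda>p q. D x (\<lambda>u v. \<tau> u v p q))"
proof -
  obtain ps where ps: "D x = tens2 A ps" by (rule D_list)
  obtain qs where qs: "D y = tens2 A qs" by (rule D_list)
  have 1: "bil (\<lambda>u v. D y (\<lambda>p q. \<tau> u v p q))"
    using assms by (intro bilI lform_D_form) (auto intro: bil_1 bil_2)
  have 2: "bil (\<lambda>p q. D x (\<lambda>u v. \<tau> u v p q))"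
    using assms by (intro bilI lform_D_form) (auto intro: bil_1 bil_2)
  have "D x (\<lambda>u v. D y (\<lambda>p q. \<tau> u v p q)) = (\<Sum>(u, v)\<leftarrow>ps. \<Sum>(p, q)\<leftarrow>qs. \<tau> u v p q)"
    using 1 assms by (simp add: ps tens2_bil) (simp add: qs tens2_bil)
  also have "\<dots> = (\<Sum>(p, q)\<leftarrow>qs. \<Sum>(u, v)\<leftarrow>ps. \<tau> u v p q)"
    by (induction ps) (auto simp: sum_list_addf case_prod_unfold)
  also have "\<dots> = D y (\<lambda>p q. D x (\<lambda>u v. \<tau> u v p q))"
    using 2 assms by (simp add: qs tens2_bil) (simp add: ps tens2_bil)
  finally show ?thesis .
qed

lemma D_coassoc:
  assumes "\<And>v w. lform (\<lambda>u. \<tau> u v w)" "\<And>u w. lform (\<lambda>v. \<tau> u v w)" "\<And>u v. lform (\<tau> u v)"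
  shows "D x (\<lambda>u v. D u (\<lambda>p q. \<tau> p q v)) = D x (\<lambda>u v. D v (\<lambda>p q. \<tau> u p q))"
proof -
  obtain ps where ps: "D x = tens2 A ps" by (rule D_list)
  have tri: "trilinear_form A \<tau>"
    using assms by (auto simp: trilinear_form_def bil_iff)
  have 1: "bil (\<lambda>u v. D u (\<lambda>p q. \<tau> p q v))"
    using assms by (intro bilI lform_D_form lform_D llin_id) auto
  have 2: "bil (\<lambda>u v. D v (\<lambda>p q. \<tau> u p q))"
    using assms by (intro bilI lform_D_form lform_D llin_id) auto
  show ?thesis
    using coassoc[OF ps tri] 1 2 by (simp only: ps tens2_bil)
qed

text \<open>Counit and antipode axioms are identities in \<open>A\<close>. Applying a linear form to
  them gives versions that can be used inside a nested Sweedler sum.\<close>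

lemma
  assumes l: "lform l"
  shows D_counit_left: "D x (\<lambda>u v. eps u * l v) = l x"
    and D_counit_right: "D x (\<lambda>u v. l u * eps v) = l x"
    and D_antipode_left: "D x (\<lambda>u v. l (S u * v)) = eps x * l 1"
    and D_antipode_right: "D x (\<lambda>u v. l (u * S v)) = eps x * l 1"
proof -
  obtain ps where ps: "D x = tens2 A ps" by (rule D_list)
  have b: "bil (\<lambda>u v. eps u * l v)" "bil (\<lambda>u v. l u * eps v)"
    "bil (\<lambda>u v. l (S u * v))" "bil (\<lambda>u v. l (u * S v))"
    using l lform_eps by (auto intro!: bilI lin lform_comp[OF l])
  have *: "l (\<Sum>(u, v)\<leftarrow>ps. f u v) = (\<Sum>(u, v)\<leftarrow>ps. l (f u v))" for f
    by (simp add: lform_sum_list[OF l] o_def case_prod_unfold)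
  show "D x (\<lambda>u v. eps u * l v) = l x"
    using *[of "\<lambda>u v. sm (eps u) v"]
    by (simp add: ps tens2_bil b counit_left[OF ps] lform_smult[OF l])
  show "D x (\<lambda>u v. l u * eps v) = l x"
    using *[of "\<lambda>u v. sm (eps v) u"] b(2)
    by (simp add: ps tens2_bil counit_right[OF ps] lform_smult[OF l] mult.commute[of "eps _"])
  show "D x (\<lambda>u v. l (S u * v)) = eps x * l 1" "D x (\<lambda>u v. l (u * S v)) = eps x * l 1"
    using *[of "\<lambda>u v. S u * v"] *[of "\<lambda>u v. u * S v"]
    by (simp_all add: ps tens2_bil b antipode_left[OF ps] antipode_right[OF ps] lform_smult[OF l])
qed

lemma D_mult:
  assumes "bil \<beta>"
  shows "D (x * y) \<beta> = D x (\<lambda>u v. D y (\<lambda>p q. \<beta> (u * p) (v * q)))"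
proof -
  obtain ps where ps: "D x = tens2 A ps" by (rule D_list)
  obtain qs where qs: "D y = tens2 A qs" by (rule D_list)
  have l: "lform (\<lambda>u. \<beta> u v)" "lform (\<beta> v)" for v
    using assms by (auto simp: bil_iff)
  have 1: "bil (\<lambda>p q. \<beta> (u * p) (v * q))" for u v
    by (intro bilI) (auto intro!: lin lform_comp[OF l(1)] lform_comp[OF l(2)])
  have 2: "bil (\<lambda>u v. D y (\<lambda>p q. \<beta> (u * p) (v * q)))"
    by (intro bilI lform_D_form 1) (auto intro!: lin lform_comp[OF l(1)] lform_comp[OF l(2)])
  have "D (x * y) \<beta> = (\<Sum>(u, v)\<leftarrow>ps. \<Sum>(p, q)\<leftarrow>qs. \<beta> (u * p) (v * q))"
    using assms
    by (simp add: comul_mult[OF ps qs] tens2_bil case_prod_unfold)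
       (induction ps, auto simp: o_def case_prod_unfold)
  also have "\<dots> = D x (\<lambda>u v. D y (\<lambda>p q. \<beta> (u * p) (v * q)))"
    using 2 by (simp add: ps tens2_bil) (simp add: qs tens2_bil 1)
  finally show ?thesis .
qed

lemma D_one: "bil \<beta> \<Longrightarrow> D 1 \<beta> = \<beta> 1 1"
  by (simp add: comul_one tens2_bil)

section \<open>Coordinates with respect to the basis\<close>

lemma dual_basis_lform: "lform (dual_basis A B e)"
  unfolding lform_def dual_basis_def
  by (simp add: V.representation_add V.representation_scale V.independent_Basis V.span_Basis)

lemma expand_basis: "(\<Sum>e\<in>B. sm (dual_basis A B e x) e) = x"
  unfolding dual_basis_def
  by (rule V.sum_representation_eq)
    (auto simp: V.independent_Basis V.span_Basis V.finite_Basis)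

lemma expand_dual: "lform f \<Longrightarrow> (\<Sum>e\<in>B. f e * dual_basis A B e x) = f x"
  using lform_sum[of f "\<lambda>e. sm (dual_basis A B e x) e" B] expand_basis[of x]
  by (simp add: lform_smult mult.commute)

text \<open>Coordinates are linear forms, so linear forms separate the points of
  \<open>A\<close>.\<close>

lemma eq_by_forms: "(\<And>l. lform l \<Longrightarrow> l x = l y) \<Longrightarrow> x = y"
  by (metis (no_types, lifting) dual_basis_lform expand_basis sum.cong)

section \<open>The antipode\<close>

lemma S_one [simp]: "S 1 = 1"
proof (rule eq_by_forms)
  fix l assume l: "lform l"
  have "bil (\<lambda>u v. l (S u * v))"
    using l by (auto intro!: bilI lin lform_comp[OF l])
  then show "l (S 1) = l 1"
    using D_antipode_left[OF l, of 1] by (simp add: D_one counit_one)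
qed

text \<open>The counit is applied to the antipode axiom; being multiplicative, it turns the second
  Sweedler factor into a counit, which the counit axiom removes.\<close>

lemma eps_S [simp]: "eps (S x) = eps x"
proof -
  have "eps x = D x (\<lambda>u v. eps (S u * v))"
    using D_antipode_left[OF lform_eps, of x] by (simp add: counit_one)
  also have "\<dots> = eps (S x)"
    using D_counit_right[of "\<lambda>x. eps (S x)" x] by (simp add: counit_mult lin)
  finally show ?thesis by simp
qed

lemma eps_T [simp]: "eps (T x) = eps x"
  by (metis S_T eps_S)

text \<open>
  Both composites below are the convolution product of \<open>S \<circ> m\<close>, \<open>m\<close> and \<open>m \<circ> (S \<otimes> S) \<circ> flip\<close> on
  \<open>A \<otimes> A\<close>, evaluated in two ways; the next lemma uses \<open>\<Delta> \<circ> S\<close>, \<open>\<Delta>\<close> and \<open>(S \<otimes> S) \<circ> \<Delta>\<^sup>o\<^sup>p\<close> likewise.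
\<close>

lemma S_mult: "S (x * y) = S y * S x"
proof (rule eq_by_forms)
  fix l assume l: "lform l"
  note li = lin bilI lform_D_form lform_comp[OF l]
  define \<tau> where "\<tau> x1 x2 x3 y1 y2 y3 = l (S (x1 * y1) * (x2 * y2) * (S y3 * S x3))"
    for x1 x2 x3 y1 y2 y3
  have \<tau>: "lform (\<lambda>x1. \<tau> x1 x2 x3 y1 y2 y3)" "lform (\<lambda>x2. \<tau> x1 x2 x3 y1 y2 y3)"
    "lform (\<lambda>x3. \<tau> x1 x2 x3 y1 y2 y3)" "lform (\<lambda>y1. \<tau> x1 x2 x3 y1 y2 y3)"
    "lform (\<lambda>y2. \<tau> x1 x2 x3 y1 y2 y3)" "lform (\<lambda>y3. \<tau> x1 x2 x3 y1 y2 y3)"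
    for x1 x2 x3 y1 y2 y3
    unfolding \<tau>_def by (intro li)+
  \<comment> \<open>In \<open>x2 * y2 * S y3 * S x3\<close> the factors coming from \<open>y\<close>
    are innermost, so they must be collapsed before those coming from \<open>x\<close>.\<close>
  have "D y' (\<lambda>y2 y3. \<tau> x1 x2 x3 y1 y2 y3) = eps y' * l (S (x1 * y1) * x2 * S x3)"
    for x1 x2 x3 y1 y'
    using D_antipode_right[of "\<lambda>w. l (S (x1 * y1) * x2 * w * S x3)" y']
    by (simp add: \<tau>_def mult.assoc li)
  moreover have "D x' (\<lambda>x2 x3. c * l (S (x1 * y1) * x2 * S x3)) = c * (eps x' * l (S (x1 * y1)))"
    for c x1 x' y1
    using D_antipode_right[of "\<lambda>w. l (S (x1 * y1) * w)" x']
    by (subst D_scale_form) (simp_all add: mult.assoc li)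
  moreover have "D y (\<lambda>y1 y'. eps y' * (eps x' * l (S (x1 * y1)))) = eps x' * l (S (x1 * y))"
    for x1 x'
    using D_counit_right[of "\<lambda>y1. eps x' * l (S (x1 * y1))" y] by (simp add: li mult.commute)
  moreover have "D x (\<lambda>x1 x'. eps x' * l (S (x1 * y))) = l (S (x * y))"
    using D_counit_right[of "\<lambda>x1. l (S (x1 * y))" x] by (simp add: li mult.commute)
  ultimately have 1: "D x (\<lambda>x1 x'. D y (\<lambda>y1 y'. D x' (\<lambda>x2 x3. D y' (\<lambda>y2 y3. \<tau> x1 x2 x3 y1 y2 y3))))
      = l (S (x * y))"
    by simp
  \<comment> \<open>The other bracketing: the two sums form one sum over the coproduct of the
    product \<open>u * v\<close>, to which the antipode axiom applies as a whole.\<close>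
  have "D (u * v) (\<lambda>p q. l (S p * q * (S y3 * S x3))) = eps u * (eps v * l (S y3 * S x3))"
    for u v x3 y3
    using D_antipode_left[of "\<lambda>w. l (w * (S y3 * S x3))" "u * v"]
    by (simp add: li counit_mult mult.assoc)
  moreover have "D (u * v) (\<lambda>p q. l (S p * q * (S y3 * S x3)))
      = D u (\<lambda>x1 x2. D v (\<lambda>y1 y2. \<tau> x1 x2 x3 y1 y2 y3))" for u v x3 y3
    unfolding \<tau>_def by (rule D_mult) (intro li)
  ultimately have "D u (\<lambda>x1 x2. D v (\<lambda>y1 y2. \<tau> x1 x2 x3 y1 y2 y3))
      = eps u * (eps v * l (S y3 * S x3))" for u v x3 y3
    by metis
  moreover have "D y (\<lambda>v y3. eps u * (eps v * l (S y3 * S x3))) = eps u * l (S y * S x3)" for u x3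
    by (subst D_scale_form) (simp_all add: li D_counit_left)
  moreover have "D x (\<lambda>u x3. eps u * l (S y * S x3)) = l (S y * S x)"
    by (rule D_counit_left) (intro li)
  ultimately have 2: "D x (\<lambda>u x3. D y (\<lambda>v y3. D u (\<lambda>x1 x2. D v (\<lambda>y1 y2. \<tau> x1 x2 x3 y1 y2 y3))))
      = l (S y * S x)"
    by simp
  \<comment> \<open>Both nestings are threefold coproducts of \<open>x\<close> and of
    \<open>y\<close>; coassociativity and interchange of sums lead from one to the other.\<close>
  have "D y (\<lambda>y1 y'. D x' (\<lambda>x2 x3. D y' (\<lambda>y2 y3. \<tau> x1 x2 x3 y1 y2 y3)))
      = D x' (\<lambda>x2 x3. D y (\<lambda>y1 y'. D y' (\<lambda>y2 y3. \<tau> x1 x2 x3 y1 y2 y3)))" for x1 x'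
    by (rule D_swap) (intro li \<tau>)+
  moreover have "D y (\<lambda>y1 y'. D y' (\<lambda>y2 y3. \<tau> x1 x2 x3 y1 y2 y3))
      = D y (\<lambda>v y3. D v (\<lambda>y1 y2. \<tau> x1 x2 x3 y1 y2 y3))" for x1 x2 x3
    by (rule D_coassoc[symmetric]) (intro \<tau>)+
  moreover have "D x (\<lambda>x1 x'. D x' (\<lambda>x2 x3. D y (\<lambda>v y3. D v (\<lambda>y1 y2. \<tau> x1 x2 x3 y1 y2 y3))))
      = D x (\<lambda>u x3. D u (\<lambda>x1 x2. D y (\<lambda>v y3. D v (\<lambda>y1 y2. \<tau> x1 x2 x3 y1 y2 y3))))"
    by (rule D_coassoc[symmetric]) (intro li \<tau>)+
  moreover have "D u (\<lambda>x1 x2. D y (\<lambda>v y3. D v (\<lambda>y1 y2. \<tau> x1 x2 x3 y1 y2 y3)))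
      = D y (\<lambda>v y3. D u (\<lambda>x1 x2. D v (\<lambda>y1 y2. \<tau> x1 x2 x3 y1 y2 y3)))" for u x3
    by (rule D_swap) (intro li \<tau>)+
  ultimately show "l (S (x * y)) = l (S y * S x)"
    using 1 2 by simp
qed

lemma T_mult: "T (x * y) = T y * T x"
  by (metis S_T T_S S_mult)

lemma D_S:
  assumes \<beta>: "bil \<beta>"
  shows "D (S x) \<beta> = D x (\<lambda>u v. \<beta> (S v) (S u))"
proof -
  note li = lin bilI lform_D_form lform_comp[OF bil_1[OF \<beta>]] lform_comp[OF bil_2[OF \<beta>]]
  \<comment> \<open>\<open>x1\<close> belongs to the first convolution factor, \<open>r\<close> and
    \<open>s\<close> are the two legs of the second, \<open>x3\<close> and \<open>x4\<close> those
    of the third, where they appear exchanged.\<close>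
  define \<tau> where "\<tau> x1 r s x3 x4 = D (S x1) (\<lambda>p q. \<beta> (p * (r * S x4)) (q * (s * S x3)))"
    for x1 r s x3 x4
  have \<tau>: "lform (\<lambda>x1. \<tau> x1 r s x3 x4)" "lform (\<lambda>r. \<tau> x1 r s x3 x4)"
    "lform (\<lambda>s. \<tau> x1 r s x3 x4)" "lform (\<lambda>x3. \<tau> x1 r s x3 x4)" "lform (\<lambda>x4. \<tau> x1 r s x3 x4)"
    for x1 r s x3 x4
    unfolding \<tau>_def by (intro li)+
  have "D w (\<lambda>s x3. \<tau> x1 r s x3 x4) = eps w * D (S x1) (\<lambda>p q. \<beta> (p * (r * S x4)) q)" for w x1 r x4
  proof -
    have "D w (\<lambda>s x3. \<tau> x1 r s x3 x4)
      = D (S x1) (\<lambda>p q. D w (\<lambda>s x3. \<beta> (p * (r * S x4)) (q * (s * S x3))))"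
      unfolding \<tau>_def by (rule D_swap) (intro li)+
    also have "\<dots> = D (S x1) (\<lambda>p q. eps w * \<beta> (p * (r * S x4)) q)"
      using D_antipode_right[of "\<lambda>z. \<beta> (p * (r * S x4)) (q * z)" w for p q] by (simp add: li)
    also have "\<dots> = eps w * D (S x1) (\<lambda>p q. \<beta> (p * (r * S x4)) q)"
      by (rule D_scale_form) (intro li)
    finally show ?thesis .
  qed
  moreover have "D z (\<lambda>w x4. eps w * D (S x1) (\<lambda>p q. \<beta> (p * (r * S x4)) q))
      = D (S x1) (\<lambda>p q. \<beta> (p * (r * S z)) q)" for z x1 r
    by (rule D_counit_left) (intro li)
  moreover have "D y (\<lambda>r z. D (S x1) (\<lambda>p q. \<beta> (p * (r * S z)) q)) = eps y * D (S x1) \<beta>" for y x1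
  proof -
    have "D y (\<lambda>r z. D (S x1) (\<lambda>p q. \<beta> (p * (r * S z)) q))
      = D (S x1) (\<lambda>p q. D y (\<lambda>r z. \<beta> (p * (r * S z)) q))"
      by (rule D_swap) (intro li)+
    also have "\<dots> = D (S x1) (\<lambda>p q. eps y * \<beta> p q)"
      using D_antipode_right[of "\<lambda>z. \<beta> (p * z) q" y for p q] by (simp add: li)
    also have "\<dots> = eps y * D (S x1) \<beta>"
      by (rule D_scale_form) (rule \<beta>)
    finally show ?thesis .
  qed
  moreover have "D x (\<lambda>x1 y. eps y * D (S x1) \<beta>) = D (S x) \<beta>"
    using D_counit_right[of "\<lambda>x1. D (S x1) \<beta>" x] by (simp add: li mult.commute)
  ultimately have 1: "D x (\<lambda>x1 y. D y (\<lambda>r z. D z (\<lambda>w x4. D w (\<lambda>s x3. \<tau> x1 r s x3 x4)))) = D (S x) \<beta>"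
    by simp
  \<comment> \<open>Here the first two convolution factors meet. The coproduct of
    \<open>S x1\<close> times that of \<open>t\<close> is the coproduct of \<open>S x1 * t\<close>,
    so the antipode axiom applies inside the coproduct.\<close>
  have "D u (\<lambda>x1 t. D t (\<lambda>r s. \<tau> x1 r s x3 x4)) = eps u * \<beta> (S x4) (S x3)" for u x3 x4
  proof -
    define \<beta>' where "\<beta>' p q = \<beta> (p * S x4) (q * S x3)" for p q
    have \<beta>': "bil \<beta>'"
      unfolding \<beta>'_def by (intro li)
    have "D t (\<lambda>r s. \<tau> x1 r s x3 x4) = D (S x1 * t) \<beta>'" for t x1
      unfolding \<tau>_def D_mult[OF \<beta>']
      by (subst D_swap) (simp_all add: \<beta>'_def mult.assoc li)
    then show ?thesis
      using D_antipode_left[of "\<lambda>w. D w \<beta>'" u] \<beta>' by (simp add: lin D_one) (simp add: \<beta>'_def)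
  qed
  moreover have "D x (\<lambda>u y. D y (\<lambda>x3 x4. eps u * \<beta> (S x4) (S x3)))
      = D x (\<lambda>u y. eps u * D y (\<lambda>x3 x4. \<beta> (S x4) (S x3)))"
    by (subst D_scale_form) (intro li refl)+
  moreover have "\<dots> = D x (\<lambda>u v. \<beta> (S v) (S u))"
    by (rule D_counit_left) (intro li)
  ultimately have 2: "D x (\<lambda>u y. D y (\<lambda>x3 x4. D u (\<lambda>x1 t. D t (\<lambda>r s. \<tau> x1 r s x3 x4))))
      = D x (\<lambda>u v. \<beta> (S v) (S u))"
    by simp
  have "D z (\<lambda>w x4. D w (\<lambda>s x3. \<tau> x1 r s x3 x4)) = D z (\<lambda>s w. D w (\<lambda>x3 x4. \<tau> x1 r s x3 x4))" for z x1 r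
    by (rule D_coassoc) (intro \<tau>)+
  moreover have "D y (\<lambda>r z. D z (\<lambda>s w. D w (\<lambda>x3 x4. \<tau> x1 r s x3 x4)))
      = D y (\<lambda>t w. D t (\<lambda>r s. D w (\<lambda>x3 x4. \<tau> x1 r s x3 x4)))" for y x1
    by (rule D_coassoc[symmetric]) (intro li \<tau>)+
  moreover have "D x (\<lambda>x1 y. D y (\<lambda>t w. D t (\<lambda>r s. D w (\<lambda>x3 x4. \<tau> x1 r s x3 x4))))
      = D x (\<lambda>u w. D u (\<lambda>x1 t. D t (\<lambda>r s. D w (\<lambda>x3 x4. \<tau> x1 r s x3 x4))))"
    by (rule D_coassoc[symmetric]) (intro li \<tau>)+
  moreover have "D t (\<lambda>r s. D w (\<lambda>x3 x4. \<tau> x1 r s x3 x4))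
      = D w (\<lambda>x3 x4. D t (\<lambda>r s. \<tau> x1 r s x3 x4))" for t w x1
    by (rule D_swap) (intro li \<tau>)+
  moreover have "D u (\<lambda>x1 t. D w (\<lambda>x3 x4. D t (\<lambda>r s. \<tau> x1 r s x3 x4)))
      = D w (\<lambda>x3 x4. D u (\<lambda>x1 t. D t (\<lambda>r s. \<tau> x1 r s x3 x4)))" for u w
    by (rule D_swap) (intro li \<tau>)+
  ultimately show ?thesis
    using 1 2 by simp
qed

lemma D_T:
  assumes "bil \<beta>"
  shows "D (T x) \<beta> = D x (\<lambda>u v. \<beta> (T v) (T u))"
proof -
  have "bil (\<lambda>u v. \<beta> (T v) (T u))"
    by (intro bilI lin lform_comp[OF bil_1[OF assms]] lform_comp[OF bil_2[OF assms]])
  from D_S[OF this, of "T x"] show ?thesis by simp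
qed

end

section \<open>The Heisenberg double\<close>

context finite_hopf
begin

section \<open>The dual algebra and its right translations\<close>

abbreviation "hb \<equiv> bilinear_form fscale (dual_space A) sm UNIV"
abbreviation "dm \<equiv> dual_mult A"
abbreviation "hm \<equiv> heis_mult A"
abbreviation "H \<equiv> heis A"

definition right_translate :: "('a \<Rightarrow> 'k) \<Rightarrow> 'a \<Rightarrow> 'a \<Rightarrow> 'k" where
  "right_translate g u = (\<lambda>x. g (x * u))"

abbreviation "rt \<equiv> right_translate"

text \<open>Linearity is demanded on linear forms only: a bilinear form on the dual of
  \<open>A\<close> times \<open>A\<close> is arbitrary at functions outside the dual, so each use
  has to supply \<open>lform\<close>.\<close>

definition dlin :: "(('a \<Rightarrow> 'k) \<Rightarrow> 'k) \<Rightarrow> bool" where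
  "dlin \<theta> \<longleftrightarrow> (\<forall>f g. lform f \<longrightarrow> lform g \<longrightarrow> \<theta> (f + g) = \<theta> f + \<theta> g) \<and>
     (\<forall>c f. lform f \<longrightarrow> \<theta> (fscale c f) = c * \<theta> f)"

lemma hb_iff: "hb \<beta> \<longleftrightarrow> (\<forall>f. lform f \<longrightarrow> lform (\<beta> f)) \<and> (\<forall>a. dlin (\<lambda>f. \<beta> f a))"
proof -
  have "hb \<beta> \<longleftrightarrow>
     (\<forall>f. lform f \<longrightarrow> (\<forall>x y. \<beta> f (x + y) = \<beta> f x + \<beta> f y) \<and> (\<forall>c x. \<beta> f (sm c x) = c * \<beta> f x)) \<and>
     (\<forall>a. dlin (\<lambda>f. \<beta> f a))"
    unfolding bilinear_form_def dlin_def dual_space_iff Ball_def by blast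
  then show ?thesis
    unfolding lform_def[of "\<beta> _"] .
qed

lemma hbI: "(\<And>f. lform f \<Longrightarrow> lform (\<beta> f)) \<Longrightarrow> (\<And>a. dlin (\<lambda>f. \<beta> f a)) \<Longrightarrow> hb \<beta>"
  by (simp add: hb_iff)

lemma hb_1: "hb \<beta> \<Longrightarrow> dlin (\<lambda>f. \<beta> f a)"
  and hb_2: "hb \<beta> \<Longrightarrow> lform f \<Longrightarrow> lform (\<beta> f)"
  by (simp_all add: hb_iff)

lemma lform_plus: "lform f \<Longrightarrow> lform g \<Longrightarrow> lform (f + g)"
  and lform_fscale: "lform f \<Longrightarrow> lform (fscale c f)"
  and lform_zero_fun: "lform (\<lambda>x. 0)"
  by (auto simp: lform_def fscale_def algebra_simps)

lemma bil_prod: "lform f \<Longrightarrow> lform g \<Longrightarrow> bil (\<lambda>u v. f u * g v)"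
  by (intro bilI lin)

lemma lform_dm: "lform (dm f g)"
  unfolding dual_mult_def by (intro lin)

lemma lform_rt: "lform g \<Longrightarrow> lform (rt g u)"
  unfolding right_translate_def by (erule lform_comp) (intro lin)

lemma dm_add_left: "lform f \<Longrightarrow> lform f' \<Longrightarrow> lform g \<Longrightarrow> dm (f + f') g = dm f g + dm f' g"
  and dm_add_right: "lform f \<Longrightarrow> lform g \<Longrightarrow> lform g' \<Longrightarrow> dm f (g + g') = dm f g + dm f g'"
  and dm_scale_left: "lform f \<Longrightarrow> lform g \<Longrightarrow> dm (fscale c f) g = fscale c (dm f g)"
  and dm_scale_right: "lform f \<Longrightarrow> lform g \<Longrightarrow> dm f (fscale c g) = fscale c (dm f g)"
proof -
  assume f: "lform f" and g: "lform g"
  show "dm (f + f') g = dm f g + dm f' g" if "lform f'"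
    using D_add_form[OF bil_prod[OF f g] bil_prod[OF that g]]
    by (simp add: dual_mult_def fun_eq_iff distrib_right)
  show "dm f (g + g') = dm f g + dm f g'" if "lform g'"
    using D_add_form[OF bil_prod[OF f g] bil_prod[OF f that]]
    by (simp add: dual_mult_def fun_eq_iff distrib_left)
  show "dm (fscale c f) g = fscale c (dm f g)" "dm f (fscale c g) = fscale c (dm f g)"
    using D_scale_form[OF bil_prod[OF f g], of _ c]
    by (simp_all add: dual_mult_def fun_eq_iff fscale_def mult.assoc mult.left_commute[of _ c])
qed

lemma dm_eps_left: "lform f \<Longrightarrow> dm eps f = f"
  and dm_eps_right: "lform f \<Longrightarrow> dm f eps = f"
  by (auto simp: dual_mult_def D_counit_left D_counit_right)

lemma rt_add: "rt (f + g) u = rt f u + rt g u" "lform f \<Longrightarrow> rt f (u + v) = rt f u + rt f v"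
  and rt_scale: "rt (fscale c f) u = fscale c (rt f u)" "lform f \<Longrightarrow> rt f (sm c u) = fscale c (rt f u)"
  by (auto simp: right_translate_def fun_eq_iff fscale_def distrib_left lform_add
      smult_mult_right lform_smult)

lemma rt_one [simp]: "rt f 1 = f"
  and rt_eps: "rt eps u = fscale (eps u) eps"
  by (auto simp: right_translate_def fscale_def counit_mult mult.commute)

lemma dlin_dm_left: "dlin \<theta> \<Longrightarrow> lform g \<Longrightarrow> dlin (\<lambda>f. \<theta> (dm f g))"
  and dlin_dm_right: "dlin \<theta> \<Longrightarrow> lform f \<Longrightarrow> dlin (\<lambda>g. \<theta> (dm f g))"
  and dlin_rt: "dlin \<theta> \<Longrightarrow> dlin (\<lambda>f. \<theta> (rt f u))"
  and lform_rt_arg: "dlin \<theta> \<Longrightarrow> lform f \<Longrightarrow> lform (\<lambda>u. \<theta> (rt f u))"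
proof -
  assume \<theta>: "dlin \<theta>"
  show "dlin (\<lambda>f. \<theta> (dm f g))" if "lform g"
    using \<theta> that unfolding dlin_def by (simp add: dm_add_left dm_scale_left lform_dm)
  show "dlin (\<lambda>g. \<theta> (dm f g))" if "lform f"
    using \<theta> that unfolding dlin_def by (simp add: dm_add_right dm_scale_right lform_dm)
  show "dlin (\<lambda>f. \<theta> (rt f u))"
    using \<theta> unfolding dlin_def by (simp add: rt_add(1) rt_scale(1) lform_rt)
  show "lform (\<lambda>u. \<theta> (rt f u))" if f: "lform f"
    using \<theta> lform_rt[OF f] unfolding dlin_def lform_def[of "\<lambda>u. \<theta> (rt f u)"]
    by (simp add: rt_add(2)[OF f] rt_scale(2)[OF f])
qed

lemma dlin_D:
  assumes "\<And>f. lform f \<Longrightarrow> bil (K f)" "\<And>u v. dlin (\<lambda>f. K f u v)"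
  shows "dlin (\<lambda>f. D a (K f))"
proof -
  have "K (f + g) = (\<lambda>u v. K f u v + K g u v)" "K (fscale c f) = (\<lambda>u v. c * K f u v)"
    if "lform f" "lform g" for f g c
    using assms(2) that by (auto simp: dlin_def fun_eq_iff)
  then show ?thesis
    by (auto simp: dlin_def D_add_form D_scale_form assms(1))
qed

lemma dlin_sum_list:
  assumes "dlin \<theta>" "\<And>z. z \<in> set zs \<Longrightarrow> lform (K z)"
  shows "\<theta> (\<lambda>x. \<Sum>z\<leftarrow>zs. K z x) = (\<Sum>z\<leftarrow>zs. \<theta> (K z)) \<and> lform (\<lambda>x. \<Sum>z\<leftarrow>zs. K z x)"
  using assms(2)
proof (induction zs)
  case Nil
  have "fscale 0 (\<lambda>x :: 'a. 0) = (\<lambda>x. 0 :: 'k)"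
    by (simp add: fscale_def)
  moreover have "\<theta> (fscale 0 (\<lambda>x. 0)) = 0 * \<theta> (\<lambda>x. 0)"
    using assms(1) lform_zero_fun unfolding dlin_def by blast
  ultimately have "\<theta> (\<lambda>x. 0) = 0"
    by (simp only: mult_zero_left)
  then show ?case
    by (simp add: lform_zero_fun)
next
  case (Cons z zs)
  then have "\<theta> (K z + (\<lambda>x. \<Sum>z\<leftarrow>zs. K z x)) = \<theta> (K z) + \<theta> (\<lambda>x. \<Sum>z\<leftarrow>zs. K z x)"
    "lform (K z + (\<lambda>x. \<Sum>z\<leftarrow>zs. K z x))"
    using assms(1) unfolding dlin_def by (simp_all add: lform_plus)
  then show ?case
    using Cons by (simp add: plus_fun_def)
qed

text \<open>A Sweedler sum taken inside the argument of a linear functional on the dual passes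
  through it, because it is a finite sum of linear forms.\<close>

lemma dlin_D_inside:
  assumes \<theta>: "dlin \<theta>" and K: "\<And>p q. lform (K p q)" and b: "\<And>x. bil (\<lambda>p q. K p q x)"
  shows "\<theta> (\<lambda>x. D a (\<lambda>p q. K p q x)) = D a (\<lambda>p q. \<theta> (K p q))"
proof -
  obtain ps where ps: "D a = tens2 A ps" by (rule D_list)
  have "K (p + p') q = K p q + K p' q" "K p (q + q') = K p q + K p q'"
    "K (sm c p) q = fscale c (K p q)" "K p (sm c q) = fscale c (K p q)" for p p' q q' c
    using b by (auto simp: bil_iff lform_def fun_eq_iff fscale_def)
  then have "bil (\<lambda>p q. \<theta> (K p q))"
    using \<theta> K unfolding bilinear_form_def by (simp add: dlin_def)
  then show ?thesis
    using dlin_sum_list[OF \<theta>, of ps "\<lambda>(p, q). K p q"] K b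
    by (simp add: ps tens2_bil case_prod_unfold)
qed

lemma dm_assoc:
  assumes "lform f" "lform g" "lform h"
  shows "dm f (dm g h) = dm (dm f g) h"
proof
  fix x
  have "f u * D v (\<lambda>p q. g p * h q) = D v (\<lambda>p q. f u * (g p * h q))"
    "D u (\<lambda>p q. f p * g q) * h v = D u (\<lambda>p q. f p * (g q * h v))" for u v
    using D_scale_form[OF bil_prod[OF assms(2,3)], of v "f u"]
      D_scale_form'[OF bil_prod[OF assms(1,2)], of u "h v"]
    by (simp_all add: mult.assoc)
  moreover have "D x (\<lambda>u v. D u (\<lambda>p q. f p * (g q * h v)))
      = D x (\<lambda>u v. D v (\<lambda>p q. f u * (g p * h q)))"
    by (rule D_coassoc) (intro lin assms)+
  ultimately show "dm f (dm g h) x = dm (dm f g) h x"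
    by (simp add: dual_mult_def)
qed

section \<open>Elements of \<open>H(A)\<close> as finite sums of pure tensors\<close>

lemma hpure_eval: "lform f \<Longrightarrow> hpure A f a \<beta> = (if hb \<beta> then \<beta> f a else 0)"
  by (simp add: hpure_def tens_def)

lemma heis_add: "s \<in> H \<Longrightarrow> t \<in> H \<Longrightarrow> s + t \<in> H"
proof -
  assume "s \<in> H" "t \<in> H"
  then obtain ps qs where "s = tens fscale (dual_space A) sm UNIV ps" "set ps \<subseteq> dual_space A \<times> UNIV"
    "t = tens fscale (dual_space A) sm UNIV qs" "set qs \<subseteq> dual_space A \<times> UNIV"
    by (auto simp: heis_def tensor_space_def)
  then have "s + t = tens fscale (dual_space A) sm UNIV (ps @ qs)" "set (ps @ qs) \<subseteq> dual_space A \<times> UNIV"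
    by (auto simp: tens_def fun_eq_iff)
  then show ?thesis
    unfolding heis_def tensor_space_def by blast
qed

lemma heis_zero: "0 \<in> H"
proof -
  have "0 = tens fscale (dual_space A) sm UNIV []"
    by (auto simp: tens_def fun_eq_iff)
  then show ?thesis
    unfolding heis_def tensor_space_def by force
qed

lemma heis_hpure: "lform f \<Longrightarrow> hpure A f a \<in> H"
  unfolding heis_def tensor_space_def hpure_def by (auto simp: dual_space_iff intro!: exI[of _ "[(f, a)]"])

lemma heis_induct [consumes 1, case_names zero add]:
  assumes "s \<in> H" "P 0"
    and step: "\<And>f a t. lform f \<Longrightarrow> t \<in> H \<Longrightarrow> P t \<Longrightarrow> P (hpure A f a + t)"
  shows "P s"
proof -
  obtain ps where s: "s = tens fscale (dual_space A) sm UNIV ps"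
    and ps: "set ps \<subseteq> dual_space A \<times> UNIV"
    using assms by (auto simp: heis_def tensor_space_def)
  have "P (tens fscale (dual_space A) sm UNIV ps) \<and> tens fscale (dual_space A) sm UNIV ps \<in> H"
    using ps
  proof (induction ps)
    case Nil
    have "0 = tens fscale (dual_space A) sm UNIV []"
      by (auto simp: tens_def fun_eq_iff)
    then show ?case using \<open>P 0\<close> heis_zero by metis
  next
    case (Cons p ps)
    obtain f a where p: "p = (f, a)" "lform f"
      using Cons.prems by (cases p) (auto simp: dual_space_iff)
    then have "tens fscale (dual_space A) sm UNIV (p # ps)
      = hpure A f a + tens fscale (dual_space A) sm UNIV ps"
      by (auto simp: tens_def fun_eq_iff hpure_def)
    moreover have "set ps \<subseteq> dual_space A \<times> UNIV"
      using Cons.prems by simp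
    ultimately show ?case
      using Cons.IH step[OF p(2)] heis_add heis_hpure[OF p(2)] by metis
  qed
  then show ?thesis by (simp add: s)
qed

lemma heis_fscale: "s \<in> H \<Longrightarrow> fscale c s \<in> H"
proof (induction rule: heis_induct)
  case zero
  have "fscale c 0 = (0 :: ('k, 'a) heis)" by (auto simp: fscale_def)
  then show ?case using heis_zero by metis
next
  case (add f a t)
  have "fscale c (hpure A f a + t) = hpure A f (sm c a) + fscale c t"
    using add(1) by (auto simp: fun_eq_iff fscale_def hpure_eval lform_smult hb_2 distrib_left)
  then show ?case
    using heis_add[OF heis_hpure[OF add(1)] add(3)] by (simp only:)
qed

lemma heis_normal: "s \<in> H \<Longrightarrow> \<not> hb \<beta> \<Longrightarrow> s \<beta> = 0"
  by (auto simp: heis_def tensor_space_def tens_def)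

text \<open>Elements of \<open>H(A)\<close> are functions; with these rules the simplifier would eta-expand their sums.\<close>

declare plus_fun_apply [simp del] zero_fun_apply [simp del]

section \<open>Bilinearity and associativity of the Heisenberg product\<close>

lemma hb_add: "hb \<beta> \<Longrightarrow> hb \<beta>' \<Longrightarrow> hb (\<lambda>f a. \<beta> f a + \<beta>' f a)"
  and hb_scale: "hb \<beta> \<Longrightarrow> hb (\<lambda>f a. c * \<beta> f a)"
  unfolding bilinear_form_def by (simp_all add: algebra_simps)

lemma heis_form_add: "s \<in> H \<Longrightarrow> hb \<beta> \<Longrightarrow> hb \<beta>' \<Longrightarrow> s (\<lambda>f a. \<beta> f a + \<beta>' f a) = s \<beta> + s \<beta>'"
  by (induction rule: heis_induct) (auto simp: hb_add hpure_eval plus_fun_apply zero_fun_apply)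

lemma heis_form_scale: "s \<in> H \<Longrightarrow> hb \<beta> \<Longrightarrow> s (\<lambda>f a. c * \<beta> f a) = c * s \<beta>"
  by (induction rule: heis_induct) (auto simp: hb_scale hpure_eval algebra_simps plus_fun_apply zero_fun_apply)

lemma hb_cong: "hb \<beta> \<Longrightarrow> (\<And>f a. lform f \<Longrightarrow> \<beta>' f a = \<beta> f a) \<Longrightarrow> hb \<beta>'"
  unfolding bilinear_form_def by (simp add: dual_space_iff lform_plus lform_fscale)

text \<open>The value of \<open>\<beta>\<close> on the product of the pure tensors
  \<open>(f, a)\<close> and \<open>(g, b)\<close>. Its linearity in each of the four variables keeps
  the nested applications of tensors from being normalised to 0.\<close>

definition hkernel :: "(('a \<Rightarrow> 'k) \<Rightarrow> 'a \<Rightarrow> 'k) \<Rightarrow> ('a \<Rightarrow> 'k) \<Rightarrow> 'a \<Rightarrow> ('a \<Rightarrow> 'k) \<Rightarrow> 'a \<Rightarrow> 'k" where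
  "hkernel \<beta> f a g b = D a (\<lambda>u v. \<beta> (dm f (rt g u)) (v * b))"

lemma heis_mult_eval: "heis_mult A s t \<beta> = (if hb \<beta> then s (\<lambda>f a. t (hkernel \<beta> f a)) else 0)"
  unfolding heis_mult_def hkernel_def right_translate_def by simp

context
  fixes \<beta> assumes \<beta>: "hb \<beta>"
begin

lemma hkernel_bil: "lform f \<Longrightarrow> lform g \<Longrightarrow> bil (\<lambda>u v. \<beta> (dm f (rt g u)) (v * b))"
  by (intro bilI lform_comp[OF hb_2[OF \<beta>]] lin lform_dm lform_rt)
    (rule lform_rt_arg[of "\<lambda>g. \<beta> (dm f g) w" for w], rule dlin_dm_right[OF hb_1[OF \<beta>]])

lemma hkernel_lin:
  shows "lform f \<Longrightarrow> lform g \<Longrightarrow> lform (hkernel \<beta> f a g)"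
    and "lform f \<Longrightarrow> dlin (\<lambda>g. hkernel \<beta> f a g b)"
    and "lform g \<Longrightarrow> dlin (\<lambda>f. hkernel \<beta> f a g b)"
    and "lform (\<lambda>a. hkernel \<beta> f a g b)"
proof -
  show "lform f \<Longrightarrow> lform g \<Longrightarrow> lform (hkernel \<beta> f a g)"
    unfolding hkernel_def
    by (intro lform_D_form hkernel_bil lform_comp[OF hb_2[OF \<beta>]] lin lform_dm)
  show "lform f \<Longrightarrow> dlin (\<lambda>g. hkernel \<beta> f a g b)"
    unfolding hkernel_def
    by (intro dlin_D hkernel_bil) (auto intro!: dlin_rt[of "\<lambda>g. \<beta> (dm f g) w" for w]
      dlin_dm_right[OF hb_1[OF \<beta>]])
  show "lform g \<Longrightarrow> dlin (\<lambda>f. hkernel \<beta> f a g b)"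
    unfolding hkernel_def
    by (intro dlin_D hkernel_bil dlin_dm_left[OF hb_1[OF \<beta>]] lform_rt)
  show "lform (\<lambda>a. hkernel \<beta> f a g b)"
    unfolding hkernel_def by (intro lin)
qed

lemma hb_hkernel: "lform f \<Longrightarrow> hb (hkernel \<beta> f a)"
  by (intro hbI hkernel_lin)

text \<open>The outer tensor may be expanded only on a bilinear form; bilinearity is inherited from
  the pure tensors which sum up to \<open>t\<close>.\<close>

lemma hb_outer: "t \<in> H \<Longrightarrow> hb (\<lambda>f a. t (hkernel \<beta> f a))"
proof (induction rule: heis_induct)
  case zero
  then show ?case by (simp add: bilinear_form_def zero_fun_apply)
next
  case (add g b t)
  have "hpure A g b (hkernel \<beta> f a) = (if hb (hkernel \<beta> f a) then hkernel \<beta> f a g b else 0)" for f a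
    using add(1) by (rule hpure_eval)
  then have "lform f \<Longrightarrow> hpure A g b (hkernel \<beta> f a) = hkernel \<beta> f a g b" for f a
    by (simp add: hb_hkernel)
  moreover have "hb (\<lambda>f a. hkernel \<beta> f a g b)"
    using add(1) by (intro hbI hkernel_lin)
  ultimately have "hb (\<lambda>f a. hpure A g b (hkernel \<beta> f a))"
    by (rule hb_cong[rotated])
  from hb_add[OF this add.IH] show ?case by (simp only: plus_fun_apply)
qed

lemma hpure_mult_eval:
  "lform f \<Longrightarrow> lform g \<Longrightarrow> hm (hpure A f a) (hpure A g b) \<beta> = hkernel \<beta> f a g b"
proof -
  assume f: "lform f" and g: "lform g"
  have "hm (hpure A f a) (hpure A g b) \<beta> = hpure A f a (\<lambda>f a. hpure A g b (hkernel \<beta> f a))"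
    using \<beta> by (simp add: heis_mult_eval)
  also have "\<dots> = hpure A g b (hkernel \<beta> f a)"
    using hpure_eval[OF f, of a "\<lambda>f a. hpure A g b (hkernel \<beta> f a)"]
      hb_outer[OF heis_hpure[OF g, of b]] by presburger
  also have "\<dots> = hkernel \<beta> f a g b"
    using hpure_eval[OF g, of b "hkernel \<beta> f a"] hb_hkernel[OF f, of a] by presburger
  finally show ?thesis .
qed

end

lemma hm_add_left: "hm (s + t) r = hm s r + hm t r"
  and hm_scale_left: "hm (fscale c s) r = fscale c (hm s r)"
  by (auto simp: fun_eq_iff heis_mult_eval fscale_def plus_fun_apply)

lemma hm_add_right:
  assumes "s \<in> H" "t \<in> H" "r \<in> H"
  shows "hm s (t + r) = hm s t + hm s r"
  using heis_form_add[OF assms(1) hb_outer[OF _ assms(2)] hb_outer[OF _ assms(3)]]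
  by (auto simp: fun_eq_iff heis_mult_eval plus_fun_apply)

lemma heis_eqI: "s \<in> H \<Longrightarrow> t \<in> H \<Longrightarrow> (\<And>\<beta>. hb \<beta> \<Longrightarrow> s \<beta> = t \<beta>) \<Longrightarrow> s = t"
  by (metis ext heis_normal)

lemma hm_scale_right:
  assumes "s \<in> H" "t \<in> H"
  shows "hm s (fscale c t) = fscale c (hm s t)"
  using heis_form_scale[OF assms(1) hb_outer[OF _ assms(2)], of _ c]
  by (auto simp: fun_eq_iff heis_mult_eval fscale_def)

lemma hm_zero_left [simp]: "hm 0 r = 0"
  by (auto simp: fun_eq_iff heis_mult_eval zero_fun_apply)

lemma hm_zero_right: "s \<in> H \<Longrightarrow> hm s 0 = 0"
  using hm_scale_right[of s 0 0] heis_zero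
  by (simp add: fscale_def fun_eq_iff zero_fun_def)

text \<open>Membership asks for a finite list of pure tensors; it is obtained from a list for the
  coproduct of \<open>a\<close>.\<close>

lemma hm_pure_in:
  assumes f: "lform f" and g: "lform g"
  shows "hm (hpure A f a) (hpure A g b) \<in> H"
proof -
  obtain ps where ps: "D a = tens2 A ps" by (rule D_list)
  let ?qs = "map (\<lambda>(u, v). (dm f (rt g u), v * b)) ps"
  have "hm (hpure A f a) (hpure A g b) = tens fscale (dual_space A) sm UNIV ?qs"
  proof
    fix \<beta>
    show "hm (hpure A f a) (hpure A g b) \<beta> = tens fscale (dual_space A) sm UNIV ?qs \<beta>"
    proof (cases "hb \<beta>")
      case True
      then show ?thesis
        using hkernel_bil[OF True f g] f g
        by (simp add: hpure_mult_eval hkernel_def ps tens2_bil tens_def case_prod_unfold o_def)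
    qed (simp add: heis_mult_eval tens_def)
  qed
  moreover have "set ?qs \<subseteq> dual_space A \<times> UNIV"
    by (auto simp: dual_space_iff lform_dm)
  ultimately show ?thesis
    unfolding heis_def tensor_space_def by blast
qed

lemma hm_in: "s \<in> H \<Longrightarrow> t \<in> H \<Longrightarrow> hm s t \<in> H"
proof (induction rule: heis_induct)
  case (add f a s)
  from add(4) have "hm (hpure A f a) t \<in> H"
  proof (induction rule: heis_induct)
    case zero
    then show ?case using add(1) by (simp add: hm_zero_right heis_hpure heis_zero)
  next
    case (add g b t)
    then show ?case
      using \<open>lform f\<close> by (simp add: hm_add_right heis_hpure heis_add hm_pure_in)
  qed
  then show ?case
    using add by (simp add: hm_add_left heis_add)
qed (simp add: heis_zero)

text \<open>The dual is a module algebra under right translation by \<open>A\<close>, because the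
  coproduct is multiplicative. This compatibility makes the Heisenberg product associative.\<close>

lemma dm_rt:
  assumes "lform g" "lform h"
  shows "rt (dm g h) a = (\<lambda>x. D a (\<lambda>p q. dm (rt g p) (rt h q) x))"
proof
  fix x
  have "rt (dm g h) a x = D x (\<lambda>u v. D a (\<lambda>p q. g (u * p) * h (v * q)))"
    unfolding right_translate_def dual_mult_def by (rule D_mult) (intro bil_prod assms)
  also have "\<dots> = D a (\<lambda>p q. D x (\<lambda>u v. g (u * p) * h (v * q)))"
    by (intro D_swap bilI lin lform_comp[OF assms(1)] lform_comp[OF assms(2)])
  finally show "rt (dm g h) a x = D a (\<lambda>p q. dm (rt g p) (rt h q) x)"
    by (simp add: right_translate_def dual_mult_def)
qed

text \<open>Both bracketings give one sum over the threefold coproduct of \<open>a\<close> and the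
  coproduct of \<open>b\<close>: the left one by multiplicativity of the coproduct, applied to the
  second leg of \<open>a\<close> times \<open>b\<close>, the right one by \<open>dm_rt\<close>.
  Coassociativity and interchange of sums compare them.\<close>

lemma hm_pure_assoc:
  assumes f: "lform f" and g: "lform g" and h: "lform h"
  shows "hm (hm (hpure A f a) (hpure A g b)) (hpure A h c)
    = hm (hpure A f a) (hm (hpure A g b) (hpure A h c))"
proof (rule heis_eqI)
  fix \<beta> assume \<beta>: "hb \<beta>"
  note h1 = hb_1[OF \<beta>] and h2 = hb_2[OF \<beta>]
  have b3: "hb (\<lambda>f' a'. hkernel \<beta> f' a' h c)"
    using h by (intro hbI hkernel_lin \<beta>)
  have e: "hpure A h c (hkernel \<beta> f' a') = hkernel \<beta> f' a' h c" if "lform f'" for f' a'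
    using h that by (simp add: hpure_eval hb_hkernel \<beta>)
  have "hm (hm (hpure A f a) (hpure A g b)) (hpure A h c) \<beta>
      = hm (hpure A f a) (hpure A g b) (\<lambda>f' a'. hpure A h c (hkernel \<beta> f' a'))"
    using \<beta> by (simp add: heis_mult_eval)
  also have "\<dots> = hkernel (\<lambda>f' a'. hpure A h c (hkernel \<beta> f' a')) f a g b"
    by (intro hpure_mult_eval hb_outer \<beta> heis_hpure assms)
  also have "\<dots> = D a (\<lambda>u v. D (v * b) (\<lambda>p q. \<beta> (dm (dm f (rt g u)) (rt h p)) (q * c)))"
    unfolding hkernel_def[of "\<lambda>f' a'. hpure A h c (hkernel \<beta> f' a')"]
    by (simp add: e lform_dm) (simp add: hkernel_def)
  also have "\<dots> = D a (\<lambda>u v. D v (\<lambda>p q. D b (\<lambda>p' q'.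
      \<beta> (dm (dm f (rt g u)) (rt h (p * p'))) (q * q' * c))))"
    by (subst D_mult) (auto intro!: hkernel_bil \<beta> lform_dm h)
  finally have 1: "hm (hm (hpure A f a) (hpure A g b)) (hpure A h c) \<beta> = D a (\<lambda>u v. D v (\<lambda>p q. D b (\<lambda>p' q'.
      \<beta> (dm (dm f (rt g u)) (rt h (p * p'))) (q * q' * c))))" .
  have rr: "rt (rt h p') q = rt h (q * p')" for p' q
    by (simp add: right_translate_def mult.assoc)
  have t1: "lform (\<lambda>p. \<beta> (dm f (dm (rt g p) (rt h (q * p')))) w)"
    "lform (\<lambda>q. \<beta> (dm f (dm (rt g p) (rt h (q * p')))) w)"
    "lform (\<lambda>p'. \<beta> (dm f (dm (rt g p) (rt h (q * p')))) w)"
    "lform (\<lambda>w. \<beta> (dm f (dm (rt g p) (rt h (q * p')))) w)" for p q p' w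
  proof -
    show "lform (\<lambda>p. \<beta> (dm f (dm (rt g p) (rt h (q * p')))) w)"
      by (rule lform_rt_arg[of "\<lambda>k. \<beta> (dm f (dm k (rt h (q * p')))) w"],
          rule dlin_dm_left[of "\<lambda>k. \<beta> (dm f k) w"]) (intro dlin_dm_right[OF h1] f g h lform_rt)+
    have *: "dlin (\<lambda>k. \<beta> (dm f (dm (rt g p) k)) w)"
      by (rule dlin_dm_right[of "\<lambda>k. \<beta> (dm f k) w"]) (intro dlin_dm_right[OF h1] f g h lform_rt)+
    note ** = lform_comp[OF lform_rt_arg[OF * h]]
    show "lform (\<lambda>q. \<beta> (dm f (dm (rt g p) (rt h (q * p')))) w)"
      "lform (\<lambda>p'. \<beta> (dm f (dm (rt g p) (rt h (q * p')))) w)"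
      by (rule **, intro lin)+
    show "lform (\<lambda>w. \<beta> (dm f (dm (rt g p) (rt h (q * p')))) w)"
      by (intro h2 lform_dm)
  qed
  have "hm (hpure A f a) (hm (hpure A g b) (hpure A h c)) \<beta>
      = hm (hpure A g b) (hpure A h c) (hkernel \<beta> f a)"
    using \<beta> f by (simp add: heis_mult_eval[of "hpure A f a"] hpure_eval hb_outer hm_pure_in g h)
  also have "\<dots> = hkernel (hkernel \<beta> f a) g b h c"
    by (intro hpure_mult_eval hb_hkernel \<beta> f g h)
  also have "\<dots> = D b (\<lambda>p' q'. D a (\<lambda>u v. \<beta> (dm f (rt (dm g (rt h p')) u)) (v * (q' * c))))"
    by (simp add: hkernel_def)
  also have "\<dots> = D b (\<lambda>p' q'. D a (\<lambda>u v. D u (\<lambda>p q.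
      \<beta> (dm f (dm (rt g p) (rt h (q * p')))) (v * (q' * c)))))"
  proof -
    have "\<beta> (dm f (rt (dm g (rt h p')) u)) w
        = D u (\<lambda>p q. \<beta> (dm f (dm (rt g p) (rt h (q * p')))) w)" for p' u w
    proof -
      have l: "lform (\<lambda>a. dm k (rt h (a * p')) x)" "lform (\<lambda>a. dm (rt g a) k x)" if "lform k" for x k
      proof -
        \<comment> \<open>Evaluation at a point is a linear functional on the dual, so the linearity
          rules for products of forms also apply to their values.\<close>
        have d: "dlin (\<lambda>k. k x)" by (simp add: dlin_def fscale_def plus_fun_apply)
        show "lform (\<lambda>a. dm k (rt h (a * p')) x)"
          by (rule lform_comp[OF lform_rt_arg[OF dlin_dm_right[OF d that] h]]) (intro lin)
        show "lform (\<lambda>a. dm (rt g a) k x)"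
          by (rule lform_rt_arg[OF dlin_dm_left[OF d that] g])
      qed
      show ?thesis
        unfolding dm_rt[OF g lform_rt[OF h]] rr
        by (rule dlin_D_inside[of "\<lambda>k. \<beta> (dm f k) w"])
          (auto intro!: dlin_dm_right[OF h1] f lform_dm bilI l lform_rt g h)
    qed
    then show ?thesis by simp
  qed
  also have "\<dots> = D b (\<lambda>p' q'. D a (\<lambda>u v. D v (\<lambda>p q.
      \<beta> (dm f (dm (rt g u) (rt h (p * p')))) (q * (q' * c)))))"
    by (subst D_coassoc) (auto intro!: t1 lform_comp[OF t1(4)] lin)
  also have "\<dots> = D a (\<lambda>u v. D b (\<lambda>p' q'. D v (\<lambda>p q.
      \<beta> (dm f (dm (rt g u) (rt h (p * p')))) (q * (q' * c)))))"
    by (rule D_swap) (intro bilI lform_D_form lin t1 lform_comp[OF t1(4)])+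
  also have "\<dots> = D a (\<lambda>u v. D v (\<lambda>p q. D b (\<lambda>p' q'.
      \<beta> (dm f (dm (rt g u) (rt h (p * p')))) (q * (q' * c)))))"
    by (subst D_swap) (intro bilI lform_D_form lin t1 lform_comp[OF t1(4)] refl)+
  finally show "hm (hm (hpure A f a) (hpure A g b)) (hpure A h c) \<beta>
    = hm (hpure A f a) (hm (hpure A g b) (hpure A h c)) \<beta>"
    unfolding 1 by (simp add: dm_assoc f g h lform_rt mult.assoc)
qed (intro hm_in hm_pure_in heis_hpure f g h)+

lemma hm_assoc:
  assumes "s \<in> H" "t \<in> H" "r \<in> H"
  shows "hm (hm s t) r = hm s (hm t r)"
  using assms
proof (induction arbitrary: t r rule: heis_induct)
  case (add f a s)
  have "hm (hm (hpure A f a) t) r = hm (hpure A f a) (hm t r)"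
    using \<open>t \<in> H\<close> \<open>r \<in> H\<close>
  proof (induction arbitrary: r rule: heis_induct)
    case zero
    then show ?case using add(1) by (simp add: hm_zero_right heis_hpure)
  next
    case (add g b t)
    have "hm (hm (hpure A f a) (hpure A g b)) r = hm (hpure A f a) (hm (hpure A g b) r)"
      using \<open>r \<in> H\<close>
    proof (induction rule: heis_induct)
      case zero
      then show ?case
        using add(1) \<open>lform f\<close> by (simp add: hm_zero_right heis_hpure hm_pure_in)
    next
      case (add h c r)
      then show ?case
        using \<open>lform f\<close> \<open>lform g\<close> by (simp add: hm_add_right heis_hpure hm_in hm_pure_assoc)
    qed
    then show ?case
      using add \<open>lform f\<close> by (simp add: hm_add_left hm_add_right heis_hpure hm_in)
  qed
  then show ?case
    using add by (simp add: hm_add_left)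
qed simp

section \<open>The unit, and \<open>A\<close> and its dual as subalgebras of
  \<open>H(A)\<close>\<close>

abbreviation "h1 \<equiv> heis_one A"

lemma one_in: "h1 \<in> H"
  unfolding heis_one_def by (intro heis_hpure lform_eps)

lemma hm_one_left: "s \<in> H \<Longrightarrow> hm h1 s = s"
proof (induction rule: heis_induct)
  case zero
  then show ?case by (simp add: hm_zero_right one_in)
next
  case (add f a s)
  have "hm h1 (hpure A f a) = hpure A f a"
  proof (rule heis_eqI)
    fix \<beta> assume \<beta>: "hb \<beta>"
    show "hm h1 (hpure A f a) \<beta> = hpure A f a \<beta>"
      using add(1) \<beta> hkernel_bil[OF \<beta> lform_eps add(1)] unfolding heis_one_def
      by (simp add: hpure_mult_eval lform_eps hkernel_def D_one dm_eps_left hpure_eval)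
  qed (intro hm_in one_in heis_hpure add)+
  then show ?case
    using add by (simp add: hm_add_right one_in heis_hpure)
qed

text \<open>Right translation by \<open>u\<close> multiplies the counit by \<open>eps u\<close>, so
  the coproduct of \<open>a\<close> collapses by the counit axiom.\<close>

lemma hm_pure_alg:
  assumes f: "lform f"
  shows "hm (hpure A f a) (of_alg A b) = hpure A f (a * b)"
proof (rule heis_eqI)
  fix \<beta> assume \<beta>: "hb \<beta>"
  have "\<beta> (dm f (rt eps u)) w = eps u * \<beta> f w" for u w
    using hb_1[OF \<beta>, of w] f
    by (simp add: rt_eps dm_scale_right lform_eps dm_eps_right dlin_def)
  then show "hm (hpure A f a) (of_alg A b) \<beta> = hpure A f (a * b) \<beta>"
    using \<beta> f hb_2[OF \<beta> f] D_counit_left[of "\<lambda>v. \<beta> f (v * b)" a]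
    by (simp add: of_alg_def hpure_mult_eval lform_eps hkernel_def hpure_eval
        lform_comp[OF hb_2[OF \<beta> f]] lin)
qed (auto intro!: hm_in heis_hpure f lform_eps simp: of_alg_def)

lemma hm_one_right: "s \<in> H \<Longrightarrow> hm s h1 = s"
proof (induction rule: heis_induct)
  case (add f a s)
  then show ?case
    using hm_pure_alg[OF add(1), of a 1] by (simp add: hm_add_left heis_one_def of_alg_def)
qed simp

lemma of_alg_in: "of_alg A x \<in> H"
  and of_dual_in: "lform f \<Longrightarrow> of_dual A f \<in> H"
  by (auto simp: of_alg_def of_dual_def intro: heis_hpure lform_eps)

lemma of_alg_mult: "hm (of_alg A x) (of_alg A y) = of_alg A (x * y)"
  using hm_pure_alg[OF lform_eps] by (simp add: of_alg_def)

lemma of_alg_one: "of_alg A 1 = h1" and of_dual_eps: "of_dual A eps = h1"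
  by (simp_all add: of_alg_def of_dual_def heis_one_def)

lemma of_dual_mult:
  assumes f: "lform f" and g: "lform g"
  shows "hm (of_dual A f) (of_dual A g) = of_dual A (dm f g)"
proof (rule heis_eqI)
  fix \<beta> assume \<beta>: "hb \<beta>"
  show "hm (of_dual A f) (of_dual A g) \<beta> = of_dual A (dm f g) \<beta>"
    using \<beta> f g hkernel_bil[OF \<beta> f g, of 1]
    by (simp add: of_dual_def hpure_mult_eval hkernel_def D_one hpure_eval lform_dm)
qed (intro hm_in of_dual_in f g lform_dm)+

lemma of_dual_alg: "lform f \<Longrightarrow> hm (of_dual A f) (of_alg A x) = hpure A f x"
  using hm_pure_alg[of f 1 x] by (simp add: of_dual_def)

text \<open>The commutation relation of the Heisenberg double, and the source of the pentagon: an
  element of \<open>A\<close> moves to the right of a linear form at the cost of a right translation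
  by its first Sweedler factor.\<close>

lemma of_alg_dual_eval:
  assumes "lform f" "hb \<beta>"
  shows "hm (of_alg A x) (of_dual A f) \<beta> = D x (\<lambda>u v. \<beta> (rt f u) v)"
  using assms
  by (simp add: of_alg_def of_dual_def hpure_mult_eval lform_eps hkernel_def dm_eps_left lform_rt)

end

section \<open>Local identities\<close>

context finite_hopf
begin

abbreviation "ds \<equiv> dual_basis A B"

section \<open>The canonical element tested against forms\<close>

lemma expand_lform: "lform l \<Longrightarrow> l a = (\<Sum>x\<in>B. ds x a * l x)"
  using expand_dual[of l a] by (simp add: mult.commute)

lemma dlin_zero: "dlin \<theta> \<Longrightarrow> \<theta> 0 = 0"
  using dlin_sum_list[of \<theta> "[]" "\<lambda>_. 0"] by (simp add: zero_fun_def)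

lemma dlin_sum: "dlin \<theta> \<Longrightarrow> (\<And>x. x \<in> X \<Longrightarrow> lform (F x)) \<Longrightarrow> \<theta> (sum F X) = (\<Sum>x\<in>X. \<theta> (F x)) \<and> lform (sum F X)"
proof (induction X rule: infinite_finite_induct)
  case (insert x X)
  then have "\<theta> (F x + sum F X) = \<theta> (F x) + \<theta> (sum F X)"
    unfolding dlin_def by blast
  then show ?case using insert by (simp add: lform_plus)
qed (use lform_zero_fun in \<open>simp_all add: dlin_zero flip: zero_fun_def\<close>)

lemma sum_fun_apply: "sum F X x = (\<Sum>y\<in>X. F y x)"
  by (induction X rule: infinite_finite_induct) (auto simp: plus_fun_apply zero_fun_apply)

lemma expand_dlin:
  assumes "dlin \<theta>" "lform f"
  shows "\<theta> f = (\<Sum>x\<in>B. f x * \<theta> (ds x))"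
proof -
  have "f = (\<Sum>x\<in>B. fscale (f x) (ds x))"
    using expand_dual[OF assms(2)] by (simp add: fun_eq_iff sum_fun_apply fscale_def)
  then have "\<theta> f = \<theta> (\<Sum>x\<in>B. fscale (f x) (ds x))"
    by (rule arg_cong)
  also have "\<dots> = (\<Sum>x\<in>B. \<theta> (fscale (f x) (ds x)))"
    by (rule dlin_sum[OF assms(1), THEN conjunct1]) (intro lform_fscale dual_basis_lform)
  also have "\<dots> = (\<Sum>x\<in>B. f x * \<theta> (ds x))"
    using assms(1) dual_basis_lform unfolding dlin_def by simp
  finally show ?thesis .
qed

lemma D_sum_form:
  assumes "\<And>x. x \<in> X \<Longrightarrow> bil (\<beta> x)"
  shows "D a (\<lambda>u v. \<Sum>x\<in>X. \<beta> x u v) = (\<Sum>x\<in>X. D a (\<beta> x)) \<and> bil (\<lambda>u v. \<Sum>x\<in>X. \<beta> x u v)"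
  using assms
proof (induction X rule: infinite_finite_induct)
  case (insert x X)
  have "bil (\<lambda>u v. \<beta> x u v + (\<Sum>x\<in>X. \<beta> x u v))"
    using insert unfolding bilinear_form_def by (simp add: algebra_simps)
  then show ?case
    using insert D_add_form[of "\<beta> x" "\<lambda>u v. \<Sum>x\<in>X. \<beta> x u v" a] by simp
qed (use D_scale_form[of "\<lambda>u v. 0" a 0] in \<open>auto simp: bilinear_form_def\<close>)

text \<open>A linear map on the first leg of the canonical element is its transpose on the second
  leg: expand \<open>g x\<close> in the basis and sum over \<open>x\<close> first.\<close>

lemma basis_transpose:
  assumes 1: "\<And>f. lform f \<Longrightarrow> lform (\<lambda>x. \<Phi> x f)" and 2: "\<And>x. dlin (\<Phi> x)" and g: "llin g"
  shows "(\<Sum>x\<in>B. \<Phi> (g x) (ds x)) = (\<Sum>x\<in>B. \<Phi> x (ds x \<circ> g))"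
proof -
  have "(\<Sum>x\<in>B. \<Phi> (g x) (ds x)) = (\<Sum>x\<in>B. \<Sum>y\<in>B. ds y (g x) * \<Phi> y (ds x))"
    by (intro sum.cong refl expand_lform 1 dual_basis_lform)
  also have "\<dots> = (\<Sum>y\<in>B. \<Sum>x\<in>B. ds y (g x) * \<Phi> y (ds x))"
    by (rule sum.swap)
  also have "\<dots> = (\<Sum>y\<in>B. \<Phi> y (ds y \<circ> g))"
    using expand_dlin[OF 2, of "ds y \<circ> g" y for y] lform_comp[OF dual_basis_lform g]
    by (simp add: o_def)
  finally show ?thesis .
qed

text \<open>The coproduct on the first leg of the canonical element is a product of two canonical
  elements multiplied in the second leg, because the structure constants of the dual are those of
  the coproduct.\<close>

lemma basis_coproduct:
  assumes 1: "\<And>v f. lform f \<Longrightarrow> lform (\<lambda>u. \<Psi> u v f)" and 2: "\<And>u f. lform f \<Longrightarrow> lform (\<lambda>v. \<Psi> u v f)"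
    and 3: "\<And>u v. dlin (\<Psi> u v)"
  shows "(\<Sum>x\<in>B. \<Sum>y\<in>B. \<Psi> x y (dm (ds x) (ds y))) = (\<Sum>t\<in>B. D t (\<lambda>u v. \<Psi> u v (ds t)))"
proof -
  let ?b = "\<lambda>x y u v. ds x u * ds y v"
  have b: "bil (\<lambda>u v. c * ?b x y u v)" for x y c
    using bil_prod[OF dual_basis_lform dual_basis_lform, of x y]
    unfolding bilinear_form_def by (simp add: algebra_simps)
  have "D t (\<lambda>u v. \<Psi> u v (ds t)) = (\<Sum>x\<in>B. \<Sum>y\<in>B. \<Psi> x y (ds t) * dm (ds x) (ds y) t)" for t
  proof -
    have "\<Psi> u v (ds t) = (\<Sum>x\<in>B. \<Sum>y\<in>B. \<Psi> x y (ds t) * ?b x y u v)" for u v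
    proof -
      have "\<Psi> u v (ds t) = (\<Sum>x\<in>B. ds x u * \<Psi> x v (ds t))"
        by (intro expand_lform 1 dual_basis_lform)
      also have "\<dots> = (\<Sum>x\<in>B. ds x u * (\<Sum>y\<in>B. ds y v * \<Psi> x y (ds t)))"
        by (intro sum.cong refl arg_cong2[of _ _ _ _ "(*)"] expand_lform 2 dual_basis_lform)
      finally show ?thesis by (simp add: sum_distrib_left mult_ac)
    qed
    then have "(\<lambda>u v. \<Psi> u v (ds t)) = (\<lambda>u v. \<Sum>x\<in>B. \<Sum>y\<in>B. \<Psi> x y (ds t) * ?b x y u v)"
      by (intro ext)
    then have "D t (\<lambda>u v. \<Psi> u v (ds t)) = D t (\<lambda>u v. \<Sum>x\<in>B. \<Sum>y\<in>B. \<Psi> x y (ds t) * ?b x y u v)"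
      by (rule arg_cong)
    also have "\<dots> = (\<Sum>x\<in>B. \<Sum>y\<in>B. D t (\<lambda>u v. \<Psi> x y (ds t) * ?b x y u v))"
    proof -
      have i: "D t (\<lambda>u v. \<Sum>y\<in>B. \<Psi> x y (ds t) * ?b x y u v)
          = (\<Sum>y\<in>B. D t (\<lambda>u v. \<Psi> x y (ds t) * ?b x y u v)) \<and>
        bil (\<lambda>u v. \<Sum>y\<in>B. \<Psi> x y (ds t) * ?b x y u v)" for x
        by (rule D_sum_form) (rule b)
      show ?thesis
        using D_sum_form[OF conjunct2[OF i], where X = B and a = t] i by (simp only:)
    qed
    also have "\<dots> = (\<Sum>x\<in>B. \<Sum>y\<in>B. \<Psi> x y (ds t) * dm (ds x) (ds y) t)"
      by (simp add: D_scale_form[OF bil_prod[OF dual_basis_lform dual_basis_lform]] dual_mult_def)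
    finally show ?thesis .
  qed
  then have "(\<Sum>t\<in>B. D t (\<lambda>u v. \<Psi> u v (ds t)))
      = (\<Sum>t\<in>B. \<Sum>x\<in>B. \<Sum>y\<in>B. \<Psi> x y (ds t) * dm (ds x) (ds y) t)"
    by simp
  also have "\<dots> = (\<Sum>x\<in>B. \<Sum>t\<in>B. \<Sum>y\<in>B. \<Psi> x y (ds t) * dm (ds x) (ds y) t)"
    by (rule sum.swap)
  also have "\<dots> = (\<Sum>x\<in>B. \<Sum>y\<in>B. \<Sum>t\<in>B. \<Psi> x y (ds t) * dm (ds x) (ds y) t)"
    by (intro sum.cong refl sum.swap)
  also have "\<dots> = (\<Sum>x\<in>B. \<Sum>y\<in>B. \<Psi> x y (dm (ds x) (ds y)))"
    using expand_dlin[OF 3 lform_dm] by (simp add: mult.commute)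
  finally show ?thesis by simp
qed

text \<open>Once the two sums are merged by \<open>basis_coproduct\<close>, only the coproduct of
  one basis element is left, which the antipode axiom collapses; the remaining counit is expanded in
  the dual basis.\<close>

lemma zero_two_identity:
  assumes 1: "\<And>f. lform f \<Longrightarrow> lform (\<lambda>x. \<Phi> x f)" and 2: "\<And>x. dlin (\<Phi> x)"
  shows "(\<Sum>x\<in>B. \<Sum>y\<in>B. \<Phi> (S x * y) (dm (ds x) (ds y))) = \<Phi> 1 eps"
    and "(\<Sum>x\<in>B. \<Sum>y\<in>B. \<Phi> (x * S y) (dm (ds x) (ds y))) = \<Phi> 1 eps"
proof -
  have *: "\<Phi> 1 eps = (\<Sum>t\<in>B. eps t * \<Phi> 1 (ds t))"
    by (rule expand_dlin[OF 2 lform_eps])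
  show "(\<Sum>x\<in>B. \<Sum>y\<in>B. \<Phi> (S x * y) (dm (ds x) (ds y))) = \<Phi> 1 eps"
    unfolding *
    by (rule trans[OF basis_coproduct[of "\<lambda>u v f. \<Phi> (S u * v) f"]])
      (intro lform_comp[OF 1] lin 2 sum.cong refl D_antipode_left 1 dual_basis_lform; assumption)+
  show "(\<Sum>x\<in>B. \<Sum>y\<in>B. \<Phi> (x * S y) (dm (ds x) (ds y))) = \<Phi> 1 eps"
    unfolding *
    by (rule trans[OF basis_coproduct[of "\<lambda>u v f. \<Phi> (u * S v) f"]])
      (intro lform_comp[OF 1] lin 2 sum.cong refl D_antipode_right 1 dual_basis_lform; assumption)+
qed

section \<open>Linear functionals on \<open>H(A)\<close> and the pentagon\<close>

definition hlin :: "(('k, 'a) heis \<Rightarrow> 'k) \<Rightarrow> bool" where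
  "hlin \<Lambda> \<longleftrightarrow> (\<forall>s\<in>H. \<forall>t\<in>H. \<Lambda> (s + t) = \<Lambda> s + \<Lambda> t) \<and> (\<forall>c. \<forall>s\<in>H. \<Lambda> (fscale c s) = c * \<Lambda> s)"

lemma hpure_add: "lform f \<Longrightarrow> lform g \<Longrightarrow> hpure A (f + g) x = hpure A f x + hpure A g x"
  "lform f \<Longrightarrow> hpure A f (x + y) = hpure A f x + hpure A f y"
  and hpure_scale: "lform f \<Longrightarrow> hpure A (fscale c f) x = fscale c (hpure A f x)"
  "lform f \<Longrightarrow> hpure A f (sm c x) = fscale c (hpure A f x)"
proof -
  show "hpure A (f + g) x = hpure A f x + hpure A g x" if "lform f" "lform g"
    using that hb_1 lform_plus unfolding dlin_def
    by (auto simp: fun_eq_iff hpure_eval plus_fun_apply)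
  show "hpure A (fscale c f) x = fscale c (hpure A f x)" if "lform f"
    using that hb_1 lform_fscale unfolding dlin_def
    by (auto simp: fun_eq_iff hpure_eval fscale_def[of c "hpure A f x"])
  show "hpure A f (x + y) = hpure A f x + hpure A f y"
    "hpure A f (sm c x) = fscale c (hpure A f x)" if "lform f"
    using that hb_2[OF _ that] lform_add lform_smult
    by (auto simp: fun_eq_iff hpure_eval plus_fun_apply fscale_def)
qed

lemma hlin_hpure:
  assumes "hlin \<Lambda>"
  shows "dlin (\<lambda>f. \<Lambda> (hpure A f x))" "lform f \<Longrightarrow> lform (\<lambda>x. \<Lambda> (hpure A f x))"
  using assms heis_hpure
  unfolding hlin_def dlin_def lform_def[of "\<lambda>x. \<Lambda> (hpure A f x)"]
  by (simp_all add: hpure_add hpure_scale)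

lemma hlin_of:
  assumes "hlin \<Lambda>"
  shows "dlin (\<lambda>f. \<Lambda> (of_dual A f))" "lform (\<lambda>x. \<Lambda> (of_alg A x))"
  using hlin_hpure[OF assms] lform_eps by (simp_all add: of_dual_def of_alg_def)

lemma hlin_zero: "hlin \<Lambda> \<Longrightarrow> \<Lambda> 0 = 0"
proof -
  assume "hlin \<Lambda>"
  then have "\<Lambda> (fscale 0 0) = 0 * \<Lambda> 0"
    unfolding hlin_def using heis_zero by blast
  moreover have "fscale 0 0 = (0 :: ('k, 'a) heis)"
    by (simp add: fscale_def zero_fun_def)
  ultimately show ?thesis by simp
qed

lemma hlin_sum_list:
  assumes "hlin \<Lambda>" "\<And>z. z \<in> set zs \<Longrightarrow> K z \<in> H"
  shows "\<Lambda> (\<Sum>z\<leftarrow>zs. K z) = (\<Sum>z\<leftarrow>zs. \<Lambda> (K z)) \<and> (\<Sum>z\<leftarrow>zs. K z) \<in> H"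
  using assms(2)
proof (induction zs)
  case (Cons z zs)
  then show ?case
    using assms(1) by (simp add: heis_add hlin_def)
qed (simp add: hlin_zero[OF assms(1)] heis_zero)

text \<open>The functional is given as a map on \<open>H(A)\<close>, not through a bilinear form, so
  the commutation relation is first rewritten as an equality with an explicit finite sum of pure
  tensors.\<close>

lemma hlin_alg_dual:
  assumes \<Lambda>: "hlin \<Lambda>" and f: "lform f"
  shows "\<Lambda> (hm (of_alg A x) (of_dual A f)) = D x (\<lambda>u v. \<Lambda> (hpure A (rt f u) v))"
proof -
  obtain ps where ps: "D x = tens2 A ps" by (rule D_list)
  have b: "bil (\<lambda>u v. \<beta> (rt f u) v)" if "hb \<beta>" for \<beta>
    by (intro bilI lform_rt_arg[OF hb_1[OF that] f] hb_2[OF that] lform_rt f)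
  have "hm (of_alg A x) (of_dual A f) = (\<Sum>(u, v)\<leftarrow>ps. hpure A (rt f u) v)"
  proof (rule heis_eqI)
    fix \<beta> assume \<beta>: "hb \<beta>"
    have "(\<Sum>(u, v)\<leftarrow>ps. hpure A (rt f u) v) \<beta> = (\<Sum>(u, v)\<leftarrow>ps. \<beta> (rt f u) v)"
      using \<beta> f by (induction ps) (auto simp: zero_fun_apply plus_fun_apply hpure_eval lform_rt)
    then show "hm (of_alg A x) (of_dual A f) \<beta> = (\<Sum>(u, v)\<leftarrow>ps. hpure A (rt f u) v) \<beta>"
      using of_alg_dual_eval[OF f \<beta>] b[OF \<beta>] by (simp add: ps tens2_bil)
  qed (use hlin_sum_list[OF \<Lambda>, of ps "\<lambda>(u, v). hpure A (rt f u) v"] f in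
      \<open>auto intro!: hm_in of_alg_in of_dual_in heis_hpure lform_rt\<close>)
  moreover have "bil (\<lambda>u v. \<Lambda> (hpure A (rt f u) v))"
    by (intro bilI lform_rt_arg hlin_hpure \<Lambda> f lform_rt)
  ultimately show ?thesis
    using hlin_sum_list[OF \<Lambda>, of ps "\<lambda>(u, v). hpure A (rt f u) v"] f
    by (simp add: ps tens2_bil heis_hpure lform_rt case_prod_unfold)
qed

text \<open>In a Pachner move one strand passes only under, with label in \<open>A\<close>, one
  passes only over, with label in the dual, and the middle strand does both, with label in
  \<open>H(A)\<close>. These are the three slots.\<close>

definition trilin :: "('a \<Rightarrow> ('k, 'a) heis \<Rightarrow> ('a \<Rightarrow> 'k) \<Rightarrow> 'k) \<Rightarrow> bool" where
  "trilin \<tau> \<longleftrightarrow> (\<forall>s\<in>H. \<forall>f. lform f \<longrightarrow> lform (\<lambda>x. \<tau> x s f)) \<and>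
     (\<forall>x f. lform f \<longrightarrow> hlin (\<lambda>s. \<tau> x s f)) \<and> (\<forall>x. \<forall>s\<in>H. dlin (\<tau> x s))"

text \<open>Merging \<open>y\<close> and \<open>z\<close> into one index \<open>t\<close> multiplies
  \<open>x\<close> on the right by the first Sweedler factor \<open>u\<close> of \<open>t\<close>
  and puts the second one behind \<open>ds x\<close>. Multiplication by \<open>u\<close> is then
  transposed into a right translation of \<open>ds x\<close>, and the middle slot has become the
  expansion of the product of \<open>t\<close> and \<open>ds x\<close> in the other order.\<close>

lemma pentagon:
  assumes \<tau>: "trilin \<tau>"
  shows "(\<Sum>x\<in>B. \<Sum>y\<in>B. \<Sum>z\<in>B.
      \<tau> (x * y) (hm (of_dual A (ds x)) (of_alg A z)) (dm (ds y) (ds z)))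
    = (\<Sum>x\<in>B. \<Sum>z\<in>B. \<tau> x (hm (of_alg A z) (of_dual A (ds x))) (ds z))"
proof -
  have 1: "lform f \<Longrightarrow> lform g \<Longrightarrow> lform (\<lambda>x. \<tau> x (hpure A f z) g)"
    and 2: "lform g \<Longrightarrow> hlin (\<lambda>s. \<tau> x s g)" and 3: "lform f \<Longrightarrow> dlin (\<tau> x (hpure A f z))" for x f g z
    using \<tau> heis_hpure unfolding trilin_def by blast+
  note d = dual_basis_lform
  have "(\<Sum>x\<in>B. \<Sum>y\<in>B. \<Sum>z\<in>B.
      \<tau> (x * y) (hm (of_dual A (ds x)) (of_alg A z)) (dm (ds y) (ds z)))
    = (\<Sum>x\<in>B. \<Sum>y\<in>B. \<Sum>z\<in>B. \<tau> (x * y) (hpure A (ds x) z) (dm (ds y) (ds z)))"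
    by (simp add: of_dual_alg d)
  also have "\<dots> = (\<Sum>x\<in>B. \<Sum>t\<in>B. D t (\<lambda>u v. \<tau> (x * u) (hpure A (ds x) v) (ds t)))"
    by (intro sum.cong refl basis_coproduct lform_comp[OF 1] lin d 3 hlin_hpure(2)[OF 2])
  also have "\<dots> = (\<Sum>t\<in>B. \<Sum>x\<in>B. D t (\<lambda>u v. \<tau> (x * u) (hpure A (ds x) v) (ds t)))"
    by (rule sum.swap)
  also have "\<dots> = (\<Sum>t\<in>B. D t (\<lambda>u v. \<Sum>x\<in>B. \<tau> (x * u) (hpure A (ds x) v) (ds t)))"
    by (intro sum.cong refl D_sum_form[THEN conjunct1, symmetric] bilI lform_comp[OF 1] lin d
        hlin_hpure(2)[OF 2])
  also have "\<dots> = (\<Sum>t\<in>B. D t (\<lambda>u v. \<Sum>x\<in>B. \<tau> x (hpure A (rt (ds x) u) v) (ds t)))"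
  proof -
    have "(\<Sum>x\<in>B. \<tau> (x * u) (hpure A (ds x) v) (ds t))
        = (\<Sum>x\<in>B. \<tau> x (hpure A (ds x \<circ> (\<lambda>x. x * u)) v) (ds t))" for u v t
      by (rule basis_transpose[of "\<lambda>x f. \<tau> x (hpure A f v) (ds t)"])
        (auto intro: 1 d hlin_hpure(1)[OF 2] lin)
    then show ?thesis
      by (simp add: o_def right_translate_def)
  qed
  also have "\<dots> = (\<Sum>t\<in>B. \<Sum>x\<in>B. D t (\<lambda>u v. \<tau> x (hpure A (rt (ds x) u) v) (ds t)))"
    by (intro sum.cong refl D_sum_form[THEN conjunct1] bilI 1 d lform_rt_arg[OF hlin_hpure(1)[OF 2]]
        hlin_hpure(2)[OF 2] lform_rt)
  also have "\<dots> = (\<Sum>t\<in>B. \<Sum>x\<in>B. \<tau> x (hm (of_alg A t) (of_dual A (ds x))) (ds t))"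
    using hlin_alg_dual[OF 2[OF d] d] by simp
  also have "\<dots> = (\<Sum>x\<in>B. \<Sum>t\<in>B. \<tau> x (hm (of_alg A t) (of_dual A (ds x))) (ds t))"
    by (rule sum.swap)
  finally show ?thesis .
qed

section \<open>Labels carrying several antipodes\<close>

lemma dm_S:
  assumes "lform f" "lform g"
  shows "dm f g \<circ> S = dm (g \<circ> S) (f \<circ> S)" "dm f g \<circ> T = dm (g \<circ> T) (f \<circ> T)"
  using bil_prod[OF assms] by (auto simp: dual_mult_def fun_eq_iff D_S D_T mult.commute)

lemma lform_o: "lform f \<Longrightarrow> llin g \<Longrightarrow> lform (f \<circ> g)"
  unfolding o_def by (rule lform_comp)

lemma dlin_o: "dlin \<theta> \<Longrightarrow> llin g \<Longrightarrow> dlin (\<lambda>f. \<theta> (f \<circ> g))"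
proof -
  assume a: "dlin \<theta>" "llin g"
  have "(f + f') \<circ> g = (f \<circ> g) + (f' \<circ> g)" "fscale c f \<circ> g = fscale c (f \<circ> g)"
    for f f' :: "'a \<Rightarrow> 'k" and c
    by (auto simp: plus_fun_apply fscale_def)
  then show ?thesis
    using a lform_o[OF _ a(2)] unfolding dlin_def by simp
qed

lemma hlin_hm: "hlin \<Lambda> \<Longrightarrow> s \<in> H \<Longrightarrow> hlin (\<lambda>t. \<Lambda> (hm s t))"
  "hlin \<Lambda> \<Longrightarrow> s \<in> H \<Longrightarrow> hlin (\<lambda>t. \<Lambda> (hm t s))"
  unfolding hlin_def by (simp_all add: hm_add_right hm_scale_right hm_add_left hm_scale_left hm_in)

lemma lform_sums: "(\<And>y. y \<in> X \<Longrightarrow> lform (F y)) \<Longrightarrow> lform (\<lambda>x. \<Sum>y\<in>X. F y x)"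
  unfolding lform_def by (simp add: sum.distrib sum_distrib_left)

lemma dlin_sums: "(\<And>y. y \<in> X \<Longrightarrow> dlin (F y)) \<Longrightarrow> dlin (\<lambda>x. \<Sum>y\<in>X. F y x)"
  unfolding dlin_def by (simp add: sum.distrib sum_distrib_left)

definition sp :: "nat \<Rightarrow> 'a \<Rightarrow> 'a" where
  "sp n = S ^^ n"

definition tp :: "nat \<Rightarrow> ('a \<Rightarrow> 'k) \<Rightarrow> 'a \<Rightarrow> 'k" where
  "tp n f = f \<circ> T ^^ n"

lemma sp_simps: "sp 0 x = x" "sp (Suc n) x = sp n (S x)"
  by (simp_all add: sp_def funpow_swap1)

lemma tp_simps: "tp 0 f = f" "tp (Suc n) f = tp n (f \<circ> T)"
  by (simp_all add: tp_def o_assoc)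

lemma llin_sp: "llin (sp n)"
proof (induction n)
  case (Suc n)
  then show ?case
    using llin_S by (simp add: llin_def sp_simps)
qed (simp add: llin_def sp_simps)

lemma lform_tp: "lform f \<Longrightarrow> lform (tp n f)"
  by (induction n arbitrary: f) (simp_all add: tp_simps lform_o llin_T)

lemma dlin_tp: "dlin \<theta> \<Longrightarrow> dlin (\<lambda>f. \<theta> (tp n f))"
proof (induction n)
  case (Suc n)
  show ?case
    unfolding tp_simps by (rule dlin_o[OF Suc.IH[OF Suc.prems] llin_T])
qed (simp add: tp_simps)

lemma sp_one: "sp n 1 = 1"
  by (induction n) (simp_all add: sp_simps)

lemma tp_eps: "tp n eps = eps"
  by (induction n) (simp_all add: tp_simps o_def)

lemma sp_mult: "sp n (x * y) = (if even n then sp n x * sp n y else sp n y * sp n x)"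
  by (induction n arbitrary: x y) (simp_all add: sp_simps S_mult)

lemma tp_dm: "lform f \<Longrightarrow> lform g \<Longrightarrow>
    tp n (dm f g) = (if even n then dm (tp n f) (tp n g) else dm (tp n g) (tp n f))"
  by (induction n arbitrary: f g) (simp_all add: tp_simps dm_S lform_o llin_T)

text \<open>
  \<open>vprod n\<close> multiplies labels met from top to bottom.  The number \<open>n\<close> counts the applications of the
  antipode in the labels, one for a thick strand and one for an upward strand; each of them reverses
  the order of the factors.
\<close>

definition vprod :: "nat \<Rightarrow> ('k, 'a) heis list \<Rightarrow> ('k, 'a) heis" where
  "vprod n ls = foldr hm (if even n then rev ls else ls) h1"

lemma vprod_simps: "vprod n [] = h1" "s \<in> H \<Longrightarrow> vprod n [s] = s"
  "s \<in> H \<Longrightarrow> t \<in> H \<Longrightarrow> vprod n [s, t] = (if even n then hm t s else hm s t)"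
  by (simp_all add: vprod_def hm_one_right)

text \<open>For odd \<open>n\<close> the order is reversed twice, by \<open>vprod\<close> and by the
  antimultiplicative power of the antipode. These reversals cancel, so all strands give a power
  applied to the same product.\<close>

lemma vprod_alg: "vprod n [of_alg A (sp n x), of_alg A (sp n y)] = of_alg A (sp n (y * x))"
  by (simp add: vprod_simps of_alg_in of_alg_mult sp_mult)

lemma vprod_dual: "lform f \<Longrightarrow> lform g \<Longrightarrow>
    vprod n [of_dual A (tp n f), of_dual A (tp n g)] = of_dual A (tp n (dm g f))"
  by (simp add: vprod_simps of_dual_in of_dual_mult tp_dm lform_tp)

lemma basis_twist:
  assumes 1: "\<And>f. lform f \<Longrightarrow> lform (\<lambda>x. \<Phi> x f)" and 2: "\<And>x. dlin (\<Phi> x)"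
  shows "(\<Sum>x\<in>B. \<Phi> x (ds x)) = (\<Sum>x\<in>B. \<Phi> (T x) (ds x \<circ> S))"
    "(\<Sum>x\<in>B. \<Phi> (S x) (ds x \<circ> T)) = (\<Sum>x\<in>B. \<Phi> x (ds x))"
proof -
  have [simp]: "f \<circ> T \<circ> S = f" "f \<circ> S \<circ> T = f" for f :: "'a \<Rightarrow> 'k"
    by (simp_all add: fun_eq_iff)
  show "(\<Sum>x\<in>B. \<Phi> x (ds x)) = (\<Sum>x\<in>B. \<Phi> (T x) (ds x \<circ> S))"
    using basis_transpose[of "\<lambda>x f. \<Phi> x (f \<circ> S)" T] 1 dlin_o[OF 2 llin_S] lform_o[OF _ llin_S] llin_T
    by simp
  show "(\<Sum>x\<in>B. \<Phi> (S x) (ds x \<circ> T)) = (\<Sum>x\<in>B. \<Phi> x (ds x))"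
    using basis_transpose[of "\<lambda>x f. \<Phi> x (f \<circ> T)" S] 1 dlin_o[OF 2 llin_T] lform_o[OF _ llin_T] llin_S
    by simp
qed

text \<open>
  Moving one antipode from the labels of the middle strand to those of the two other strands reverses
  the order of the factors on the latter; this reduces all Pachner moves to the pentagon.
\<close>

lemma twisted_pentagon:
  assumes "trilin \<tau>"
  shows "(\<Sum>x\<in>B. \<Sum>y\<in>B. \<Sum>z\<in>B.
      \<tau> (if even n then x * y else y * x) (hm (of_dual A (tp n (ds x))) (of_alg A (sp n z)))
        (if even n then dm (ds y) (ds z) else dm (ds z) (ds y)))
    = (\<Sum>x\<in>B. \<Sum>z\<in>B. \<tau> x (hm (of_alg A (sp n z)) (of_dual A (tp n (ds x)))) (ds z))"
  using assms
proof (induction n arbitrary: \<tau>)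
  case 0
  then show ?case by (simp add: sp_simps tp_simps pentagon)
next
  case (Suc n)
  note d = dual_basis_lform
  \<comment> \<open>The antipode taken off the middle strand reappears on the first strand as
    \<open>T\<close> and on the third as composition with \<open>S\<close>.\<close>
  define \<tau>' where "\<tau>' x s f = \<tau> (T x) s (f \<circ> S)" for x s f
  have 1: "s \<in> H \<Longrightarrow> lform f \<Longrightarrow> lform (\<lambda>x. \<tau> x s f)" and 2: "lform f \<Longrightarrow> hlin (\<lambda>s. \<tau> x s f)"
    and 3: "s \<in> H \<Longrightarrow> dlin (\<tau> x s)" for x s f
    using Suc.prems unfolding trilin_def by blast+
  have \<tau>': "trilin \<tau>'"
    unfolding trilin_def \<tau>'_def
    using lform_comp[OF 1 llin_T] 2 dlin_o[OF 3 llin_S] lform_o[OF _ llin_S] by blast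
  let ?m = "\<lambda>f z. hm (of_dual A (tp n f)) (of_alg A (sp n z))"
  let ?m' = "\<lambda>f z. hm (of_alg A (sp n z)) (of_dual A (tp n f))"
  let ?p = "\<lambda>x y. if even n then y * x else x * y"
  let ?q = "\<lambda>f g. if even n then dm g f else dm f g"
  have m: "lform f \<Longrightarrow> ?m f z \<in> H" "lform f \<Longrightarrow> ?m' f z \<in> H" for f z
    by (intro hm_in of_alg_in of_dual_in lform_tp; assumption)+
  have q: "lform (?q f g)" for f g
    by (simp add: lform_dm)
  have p_lin: "llin (\<lambda>x. ?p x y)" "llin (\<lambda>y. ?p x y)" for x y
    by (cases "even n"; simp add: lin)+
  have q_lin: "dlin (\<lambda>g. \<theta> (?q f g))" "dlin (\<lambda>g. \<theta> (?q g f))" if "dlin \<theta>" "lform f" for \<theta> f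
    using dlin_dm_left[OF that] dlin_dm_right[OF that] by (cases "even n"; simp)+
  have m_lin: "lform f \<Longrightarrow> lform (\<lambda>z. \<Lambda> (?m f z))" "lform f \<Longrightarrow> lform (\<lambda>z. \<Lambda> (?m' f z))"
    "dlin (\<lambda>f. \<Lambda> (?m f z))" "dlin (\<lambda>f. \<Lambda> (?m' f z))" if "hlin \<Lambda>" for \<Lambda> f z
    by (intro lform_comp[OF hlin_of(2)[OF hlin_hm(1)[OF that]] llin_sp] of_dual_in lform_tp
          lform_comp[OF hlin_of(2)[OF hlin_hm(2)[OF that]] llin_sp]; assumption)+
      (intro dlin_tp hlin_of(1) hlin_hm that of_alg_in)+
  have "(\<Sum>x\<in>B. \<Sum>y\<in>B. \<Sum>z\<in>B. \<tau> (?p x y) (?m (ds x \<circ> T) (S z)) (?q (ds y) (ds z)))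
      = (\<Sum>x\<in>B. \<Sum>y\<in>B. \<Sum>z\<in>B. \<tau> (?p (T x) y) (?m (ds x) (S z)) (?q (ds y) (ds z)))"
    by (rule basis_transpose[of "\<lambda>x f. \<Sum>y\<in>B. \<Sum>z\<in>B. \<tau> (?p x y) (?m f (S z)) (?q (ds y) (ds z))",
            symmetric])
      (intro lform_sums dlin_sums lform_comp[OF 1] m_lin m q 2 p_lin llin_T; assumption)+
  \<comment> \<open>\<open>y\<close> belongs to the crossing of the two outer strands, so there is
    no label of the middle strand from which a map could be transposed. Instead the mutually
    cancelling pair \<open>T\<close>, \<open>S\<close> is inserted on its two legs.\<close>
  also have "\<dots> = (\<Sum>x\<in>B. \<Sum>y\<in>B. \<Sum>z\<in>B. \<tau> (?p (T x) (T y)) (?m (ds x) (S z)) (?q (ds y \<circ> S) (ds z)))"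
  proof (rule sum.cong[OF refl])
    fix x
    show "(\<Sum>y\<in>B. \<Sum>z\<in>B. \<tau> (?p (T x) y) (?m (ds x) (S z)) (?q (ds y) (ds z)))
      = (\<Sum>y\<in>B. \<Sum>z\<in>B. \<tau> (?p (T x) (T y)) (?m (ds x) (S z)) (?q (ds y \<circ> S) (ds z)))"
      by (rule basis_twist(1)[of "\<lambda>y f. \<Sum>z\<in>B. \<tau> (?p (T x) y) (?m (ds x) (S z)) (?q f (ds z))"])
        (intro lform_sums dlin_sums lform_comp[OF 1] q_lin 3 m q d p_lin)+
  qed
  also have "\<dots> = (\<Sum>x\<in>B. \<Sum>y\<in>B. \<Sum>z\<in>B. \<tau> (?p (T x) (T y)) (?m (ds x) z) (?q (ds y \<circ> S) (ds z \<circ> S)))"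
  proof (rule sum.cong[OF refl], rule sum.cong[OF refl])
    fix x y
    show "(\<Sum>z\<in>B. \<tau> (?p (T x) (T y)) (?m (ds x) (S z)) (?q (ds y \<circ> S) (ds z)))
      = (\<Sum>z\<in>B. \<tau> (?p (T x) (T y)) (?m (ds x) z) (?q (ds y \<circ> S) (ds z \<circ> S)))"
      by (rule basis_transpose[of "\<lambda>z f. \<tau> (?p (T x) (T y)) (?m (ds x) z) (?q (ds y \<circ> S) f)"])
        (intro q_lin 3 m q d m_lin 2 llin_S lform_o)+
  qed
  \<comment> \<open>\<open>T\<close> and composition with \<open>S\<close> reverse products on the
    outer strands; this exchanges the orders for even and odd \<open>n\<close>.\<close>
  also have "\<dots> = (\<Sum>x\<in>B. \<Sum>y\<in>B. \<Sum>z\<in>B. \<tau>' (if even n then x * y else y * x) (?m (ds x) z)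
      (if even n then dm (ds y) (ds z) else dm (ds z) (ds y)))"
    by (cases "even n") (simp_all add: \<tau>'_def T_mult dm_S d)
  also have "\<dots> = (\<Sum>x\<in>B. \<Sum>z\<in>B. \<tau>' x (?m' (ds x) z) (ds z))"
    by (rule Suc.IH[OF \<tau>'])
  also have "\<dots> = (\<Sum>x\<in>B. \<Sum>z\<in>B. \<tau> (T x) (?m' (ds x) (S z)) (ds z))"
  proof (rule sum.cong[OF refl])
    fix x
    show "(\<Sum>z\<in>B. \<tau>' x (?m' (ds x) z) (ds z)) = (\<Sum>z\<in>B. \<tau> (T x) (?m' (ds x) (S z)) (ds z))"
      unfolding \<tau>'_def
      by (rule basis_transpose[of "\<lambda>z f. \<tau> (T x) (?m' (ds x) z) f", symmetric])
        (intro m m_lin 2 3 d llin_S | assumption)+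
  qed
  also have "\<dots> = (\<Sum>x\<in>B. \<Sum>z\<in>B. \<tau> x (?m' (ds x \<circ> T) (S z)) (ds z))"
    by (rule basis_transpose[of "\<lambda>x f. \<Sum>z\<in>B. \<tau> x (?m' f (S z)) (ds z)"])
      (intro lform_sums dlin_sums 1 m_lin 2 m d llin_T; assumption)+
  finally show ?case
    by (cases "even n") (simp_all add: sp_simps tp_simps)
qed

end

section \<open>Traversals and chains of arcs\<close>

text \<open>The end maps are parameters because the notion is applied to arcs, to steps, to reversed
  lists and to lists of chains, whose ends are those of their first and last members.\<close>

definition linked :: "('x \<Rightarrow> 'p) \<Rightarrow> ('x \<Rightarrow> 'p) \<Rightarrow> 'x list \<Rightarrow> bool" where
  "linked src tgt xs \<longleftrightarrow> (\<forall>k. Suc k < length xs \<longrightarrow> tgt (xs ! k) = src (xs ! Suc k))"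

lemma linked_simps [simp]: "linked src tgt []" "linked src tgt [x]"
  "linked src tgt (x # y # xs) \<longleftrightarrow> tgt x = src y \<and> linked src tgt (y # xs)"
proof -
  show "linked src tgt (x # y # xs) \<longleftrightarrow> tgt x = src y \<and> linked src tgt (y # xs)"
  proof -
    have "(\<forall>k. P k) \<longleftrightarrow> P 0 \<and> (\<forall>k. P (Suc k))" for P :: "nat \<Rightarrow> bool"
      by (metis not0_implies_Suc)
    from this[of "\<lambda>k. Suc k < length (x # y # xs) \<longrightarrow> tgt ((x # y # xs) ! k) = src ((x # y # xs) ! Suc k)"]
    show ?thesis
      unfolding linked_def by simp
  qed
qed (auto simp: linked_def)

lemma linked_append: "xs \<noteq> [] \<Longrightarrow> ys \<noteq> [] \<Longrightarrow>
    linked src tgt (xs @ ys) \<longleftrightarrow> linked src tgt xs \<and> linked src tgt ys \<and> tgt (last xs) = src (hd ys)"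
proof (induction xs)
  case (Cons x xs)
  then show ?case by (cases xs; cases ys) auto
qed simp

lemma linked_rev: "linked src tgt (rev xs) \<longleftrightarrow> linked tgt src xs"
proof (induction xs)
  case (Cons x xs)
  then show ?case
    using linked_append[of "rev xs" "[x]" src tgt] by (cases xs) (auto simp: last_rev)
qed simp

lemma linked_rotate:
  assumes "linked src tgt xs" "tgt (last xs) = src (hd xs)"
  shows "linked src tgt (rotate n xs) \<and> tgt (last (rotate n xs)) = src (hd (rotate n xs))"
proof (induction n)
  case (Suc n)
  show ?case
  proof (cases "rotate n xs")
    case (Cons y ys)
    with Suc show ?thesis
      using linked_append[of ys "[y]" src tgt] by (cases ys) auto
  qed (use assms in simp)
qed (use assms in simp)

text \<open>Injectivity of \<open>src\<close> and \<open>tgt\<close> makes every element of a linked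
  list determine its neighbours. A list that enters a chain at its head therefore runs through it,
  and the element after the chain is a head again: otherwise its predecessor in its own chain would
  have the same target as the last element of the chain just left.\<close>

lemma chain_parse_at:
  assumes inj: "inj_on src X" "inj_on tgt X"
    and as: "set as = X" "distinct as" "linked src tgt as"
    and C: "\<And>q. q \<in> Q \<Longrightarrow> C q \<noteq> [] \<and> linked src tgt (C q) \<and> distinct (C q)"
    and cover: "(\<Union>q\<in>Q. set (C q)) = X"
    and disj: "\<And>q q' x. q \<in> Q \<Longrightarrow> q' \<in> Q \<Longrightarrow> x \<in> set (C q) \<Longrightarrow> x \<in> set (C q') \<Longrightarrow> q = q'"
    and start: "q0 \<in> Q" "as \<noteq> []" "hd as = hd (C q0)"
    and n: "n \<le> length as" "n < length as \<Longrightarrow> \<exists>q\<in>Q. as ! n = hd (C q)"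
  shows "\<exists>qs. set qs \<subseteq> Q \<and> drop n as = concat (map C qs)"
  using n
proof (induction "length as - n" arbitrary: n rule: less_induct)
  case less
  show ?case
  proof (cases "n < length as")
    case False
    then show ?thesis using less.prems by (intro exI[of _ "[]"]) simp
  next
    case True
    then obtain q where q: "q \<in> Q" "as ! n = hd (C q)" using less.prems by blast
    note Cq = C[OF q(1)]
    have sub: "set (C p) \<subseteq> X" if "p \<in> Q" for p using cover that by blast
    have start_nth: "as ! 0 = C q0 ! 0"
      using start C[of q0] by (simp add: hd_conv_nth)
    have run: "n + k < length as \<and> as ! (n + k) = C q ! k" if "k < length (C q)" for k
      using that
    proof (induction k)
      case 0
      then show ?case using True q Cq by (simp add: hd_conv_nth)
    next
      case (Suc k)
      let ?y = "C q ! Suc k"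
      have kk: "n + k < length as" "as ! (n + k) = C q ! k" using Suc by auto
      have y: "src ?y = tgt (as ! (n + k))"
        using Suc Cq by (simp add: linked_def)
      have "?y \<in> set as"
        using sub[OF q(1)] Suc.prems as(1) by auto
      then obtain j where j: "j < length as" "as ! j = ?y" by (metis in_set_conv_nth)
      show ?case
      proof (cases j)
        \<comment> \<open>The successor cannot be the first element of the list, for this is the
          head of the chain of \<open>q0\<close>, while \<open>?y\<close> is not the head of its
          chain.\<close>
        case 0
        have "C q0 ! 0 \<in> set (C q0)" "C q ! Suc k \<in> set (C q)"
          using C[OF start(1)] Suc.prems by auto
        then have "q = q0"
          using disj[OF q(1) start(1), of "?y"] j 0 start_nth by simp
        then have "C q ! 0 = C q ! Suc k" using 0 j start_nth by simp
        then show ?thesis using Cq Suc.prems nth_eq_iff_index_eq[of "C q" 0 "Suc k"] by simp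
      next
        case (Suc j')
        then have "tgt (as ! j') = tgt (as ! (n + k))"
          using as(3) j y unfolding linked_def by metis
        then have "as ! j' = as ! (n + k)"
          using inj_onD[OF inj(2), of "as ! j'" "as ! (n + k)"] as(1) j Suc kk nth_mem[OF kk(1)] by auto
        then have "j' = n + k"
          using nth_eq_iff_index_eq[OF as(2), of j' "n + k"] j kk Suc by simp
        then show ?thesis using j Suc by simp
      qed
    qed
    let ?m = "length (C q)"
    have len: "?m > 0" "n + ?m \<le> length as"
      using Cq run[of "?m - 1"] by auto
    have pre: "take ?m (drop n as) = C q"
      using len run by (intro nth_equalityI) auto
    have "\<exists>q'\<in>Q. as ! (n + ?m) = hd (C q')" if lt: "n + ?m < length as"
    proof -
      let ?y = "as ! (n + ?m)"
      have "?y \<in> X" using lt as(1) by auto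
      then obtain q' where q': "q' \<in> Q" "?y \<in> set (C q')" using cover by blast
      then obtain k where k: "k < length (C q')" "C q' ! k = ?y" by (metis in_set_conv_nth)
      show ?thesis
      proof (cases k)
        case 0
        then show ?thesis using k C[OF q'(1)] by (intro bexI[OF _ q'(1)]) (simp add: hd_conv_nth)
      next
        case (Suc k')
        have "tgt (as ! (n + ?m - 1)) = src ?y"
          using as(3) lt len unfolding linked_def
          by (metis One_nat_def Suc_pred add_gr_0)
        moreover have "as ! (n + ?m - 1) = C q ! (?m - 1)"
          using run[of "?m - 1"] len by simp
        moreover have "tgt (C q' ! k') = src ?y"
          using C[OF q'(1)] k Suc unfolding linked_def by metis
        ultimately have "C q' ! k' = C q ! (?m - 1)"
          using inj_onD[OF inj(2), of "C q' ! k'" "C q ! (?m - 1)"] sub[OF q(1)] sub[OF q'(1)] k Suc len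
          by (auto simp: subset_iff)
        moreover have "C q' ! k' \<in> set (C q')" "C q ! (?m - 1) \<in> set (C q)"
          using k Suc len by auto
        ultimately have "q' = q" using disj[OF q'(1) q(1)] by metis
        then have "k' = ?m - 1"
          using \<open>C q' ! k' = C q ! (?m - 1)\<close> Cq k Suc len by (simp add: nth_eq_iff_index_eq)
        then show ?thesis using k Suc \<open>q' = q\<close> by simp
      qed
    qed
    moreover have "length as - (n + ?m) < length as - n"
      using len(1) True by arith
    ultimately obtain qs where qs: "set qs \<subseteq> Q" "drop (n + ?m) as = concat (map C qs)"
      using less.hyps[of "n + ?m"] len(2) by blast
    have "drop n as = C q @ drop (n + ?m) as"
      using pre append_take_drop_id[of ?m "drop n as"] by (simp add: add.commute)
    then show ?thesis
      using qs q by (intro exI[of _ "q # qs"]) simp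
  qed
qed

text \<open>If the list starts in the middle of a chain, the element preceding its head in that
  chain must be the last one of the list. So the list closes up and may be rotated to start at a
  head; a nonzero rotation is reported only in this case.\<close>

lemma chain_parse:
  assumes inj: "inj_on src X" "inj_on tgt X"
    and as: "set as = X" "distinct as" "linked src tgt as" "as \<noteq> []"
    and C: "\<And>q. q \<in> Q \<Longrightarrow> C q \<noteq> [] \<and> linked src tgt (C q) \<and> distinct (C q)"
    and cover: "(\<Union>q\<in>Q. set (C q)) = X"
    and disj: "\<And>q q' x. q \<in> Q \<Longrightarrow> q' \<in> Q \<Longrightarrow> x \<in> set (C q) \<Longrightarrow> x \<in> set (C q') \<Longrightarrow> q = q'"
  shows "\<exists>qs n. distinct qs \<and> set qs = Q \<and> concat (map C qs) = rotate n as \<and>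
    (n = 0 \<or> tgt (last as) = src (hd as))"
proof -
  have "hd as \<in> X" using as by auto
  then obtain q where q: "q \<in> Q" "hd as \<in> set (C q)" using cover by blast
  have "\<exists>n. n < length as \<and> (\<exists>q0\<in>Q. as ! n = hd (C q0)) \<and> (n = 0 \<or> tgt (last as) = src (hd as))"
  proof (cases "hd as = hd (C q)")
    case True
    then show ?thesis using q as by (intro exI[of _ 0]) (auto simp: hd_conv_nth)
  next
    case False
    obtain k where k: "k < length (C q)" "C q ! k = hd as" using q by (metis in_set_conv_nth)
    with False C[OF q(1)] obtain k' where k': "k = Suc k'"
      by (cases k) (auto simp: hd_conv_nth)
    then have t: "tgt (C q ! k') = src (hd as)"
      using C[OF q(1)] k unfolding linked_def by metis
    have "C q ! k' \<in> X" using cover q k k' by auto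
    then obtain j where j: "j < length as" "as ! j = C q ! k'" using as(1) by (metis in_set_conv_nth)
    \<comment> \<open>An element following \<open>as ! j\<close> would have the source of
      \<open>hd as\<close>, hence would be \<open>hd as\<close> itself, against
      distinctness.\<close>
    have "Suc j = length as"
    proof (rule ccontr)
      assume "Suc j \<noteq> length as"
      then have "Suc j < length as" using j by simp
      then have "src (as ! Suc j) = src (as ! 0)"
        using as(3,4) t j unfolding linked_def by (metis hd_conv_nth)
      then have "as ! Suc j = as ! 0"
        using inj_onD[OF inj(1)] as(1,4) \<open>Suc j < length as\<close> by (metis length_greater_0_conv nth_mem)
      then show False
        using as(2) \<open>Suc j < length as\<close> nth_eq_iff_index_eq[of as "Suc j" 0] by force
    qed
    then have "last as = C q ! k'" using j as(4) by (metis diff_Suc_1 last_conv_nth)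
    moreover have "hd (C q) \<in> X" using cover q C[OF q(1)] by auto
    then obtain n where "n < length as" "as ! n = hd (C q)" using as(1) by (metis in_set_conv_nth)
    ultimately show ?thesis using t q(1) by auto
  qed
  then obtain n q0 where n: "n < length as" "q0 \<in> Q" "as ! n = hd (C q0)"
    "n = 0 \<or> tgt (last as) = src (hd as)" by blast
  let ?as = "rotate n as"
  have "linked src tgt ?as"
    using n(4) linked_rotate[of src tgt as n] as by auto
  moreover have "hd ?as = hd (C q0)"
    using n as by (simp add: hd_rotate_conv_nth)
  moreover have "?as ! 0 = hd ?as"
    using as by (intro hd_conv_nth[symmetric]) simp
  ultimately obtain qs where qs: "set qs \<subseteq> Q" "?as = concat (map C qs)"
    using chain_parse_at[OF inj, of ?as Q C q0 0] as C cover disj n(2) by auto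
  have d: "distinct (concat (map C qs))"
    using as qs(2) by (metis distinct_rotate)
  have "distinct qs"
    using d qs(1)
  proof (induction qs)
    case (Cons p qs)
    have "p \<notin> set qs"
    proof
      assume "p \<in> set qs"
      then have "set (C p) \<subseteq> set (concat (map C qs))" by auto
      then show False using Cons.prems C[of p] by (cases "C p") auto
    qed
    then show ?case using Cons by auto
  qed simp
  moreover have "Q \<subseteq> set qs"
  proof
    fix p assume p: "p \<in> Q"
    then have "hd (C p) \<in> set ?as" using C[OF p] cover as(1) by auto
    then obtain p' where "p' \<in> set qs" "hd (C p) \<in> set (C p')" using qs(2) by auto
    then show "p \<in> set qs" using disj[OF p, of p' "hd (C p)"] C[OF p] qs(1) by auto
  qed
  ultimately show ?thesis
    using qs n(4) by (intro exI[of _ qs] exI[of _ n]) auto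
qed

section \<open>The arcs of a diagram\<close>

text \<open>
  A step \<open>(p, q, x)\<close> taken by a strand \<open>a\<close> runs from \<open>p\<close> to \<open>q\<close> if \<open>a\<close> is oriented downwards, and from
  \<open>q\<close> to \<open>p\<close> otherwise; so orientations need not be distinguished when arcs are enumerated.
\<close>

type_synonym step = "point \<times> point \<times> (crossing \<times> role) option"

definition orient :: "strand \<Rightarrow> 'p \<times> 'p \<times> 'x \<Rightarrow> nat \<times> 'p \<times> 'p \<times> 'x" where
  "orient a s = (case s of (p, q, x) \<Rightarrow> if snd a = Down then (fst a, p, q, x) else (fst a, q, p, x))"

lemma opposite_simps [simp]: "opposite (opposite d) = d" "opposite d = Up \<longleftrightarrow> d = Down"
  "opposite d = Down \<longleftrightarrow> d = Up"
  by (cases d; simp)+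

lemma not_Up [simp]: "d \<noteq> Up \<longleftrightarrow> d = Down" and not_Down [simp]: "d \<noteq> Down \<longleftrightarrow> d = Up"
  by (cases d; simp)+

lemma orient_reverse [simp]: "orient (reverse a) (p, q, x) = orient a (q, p, x)"
  by (cases "snd a") (simp_all add: orient_def)

lemma comp_orient [simp]: "fst (orient a s) = fst a"
  by (cases s) (simp add: orient_def)

lemma passage_orient [simp]: "snd (snd (snd (orient a s))) = snd (snd s)"
  by (cases s) (simp add: orient_def)

text \<open>A maximum is passed from its left to its right end when the left leg points up, that is,
  when \<open>reverse a\<close> points down; this is why \<open>Cap\<close> reverses the strand and
  \<open>Cup\<close> does not.\<close>

fun piece_steps :: "piece \<Rightarrow> (strand \<times> point \<times> point \<times> role option) list" where
  "piece_steps (Vert a) = [(a, (0, 0), (1, 0), None)]"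
| "piece_steps (Crossing x a b) =
     [(a, (0, 0), (1, 1), role_left x), (b, (0, 1), (1, 0), role_right x)]"
| "piece_steps (Cap a) = [(reverse a, (1, 0), (1, 1), None)]"
| "piece_steps (Cup a) = [(a, (0, 0), (0, 1), None)]"

lemma piece_arcs_eq: "piece_arcs p = (\<lambda>(a, s). orient a s) ` set (piece_steps p)"
  by (cases p) (auto simp: orient_def through_def)

fun lift_step :: "nat \<Rightarrow> nat \<Rightarrow> nat \<Rightarrow> nat \<Rightarrow> point \<times> point \<times> role option \<Rightarrow> step" where
  "lift_step r j u d ((s, k), (t, m), x) =
     ((r + s, (if s = 0 then u else d) + k), (r + t, (if t = 0 then u else d) + m),
      map_option (Pair (r, j)) x)"

text \<open>\<open>j\<close>, \<open>u\<close> and \<open>d\<close> count the pieces, upper ends and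
  lower ends to the left; pieces differ in the numbers of their ends, so the counters
  diverge.\<close>

fun layer_steps :: "nat \<Rightarrow> nat \<Rightarrow> nat \<Rightarrow> nat \<Rightarrow> layer \<Rightarrow> (strand \<times> step) list" where
  "layer_steps r j u d [] = []"
| "layer_steps r j u d (p # l) = map (\<lambda>(a, s). (a, lift_step r j u d s)) (piece_steps p) @
     layer_steps r (Suc j) (u + length (upper p)) (d + length (lower p)) l"

text \<open>One offset \<open>k\<close> suffices for pieces, upper ends and lower ends, since only
  vertical strands are ever put to the left of a block, and each counts once in all three
  ways.\<close>

fun stack_steps :: "nat \<Rightarrow> nat \<Rightarrow> layer list \<Rightarrow> (strand \<times> step) list" where
  "stack_steps r k [] = []"
| "stack_steps r k (l # ls) = layer_steps r k k k l @ stack_steps (Suc r) k ls"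

abbreviation oriented :: "(strand \<times> 'p \<times> 'p \<times> 'x) list \<Rightarrow> (nat \<times> 'p \<times> 'p \<times> 'x) list" where
  "oriented \<equiv> map (\<lambda>(a, s). orient a s)"

text \<open>Unlike the set \<open>arcs\<close>, a list can be cut into blocks and compared as a
  multiset, which also keeps track of distinctness.\<close>

definition arc_list :: "diagram \<Rightarrow> arc list" where
  "arc_list Z = oriented (stack_steps 0 0 (layers Z))"

lemma uppers_simps [simp]: "uppers [] = []" "uppers (p # l) = upper p @ uppers l"
  "uppers (l @ l') = uppers l @ uppers l'" "uppers (verts as) = as"
  by (induction as) (simp_all add: uppers_def)

lemma lowers_simps [simp]: "lowers [] = []" "lowers (p # l) = lower p @ lowers l"
  "lowers (l @ l') = lowers l @ lowers l'" "lowers (verts as) = as"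
  by (induction as) (simp_all add: lowers_def)

lemma layer_steps_append: "layer_steps r j u d (l @ l') = layer_steps r j u d l @
    layer_steps r (j + length l) (u + length (uppers l)) (d + length (lowers l)) l'"
  by (induction l arbitrary: j u d) (simp_all add: add.assoc)

lemma stack_steps_append: "stack_steps r k (ls @ ls') = stack_steps r k ls @ stack_steps (r + length ls) k ls'"
  by (induction ls arbitrary: r) simp_all

lemma set_layer_steps: "set (layer_steps r j u d l) =
    (\<Union>i<length l. (\<lambda>(a, s). (a, lift_step r (j + i) (u + length (uppers (take i l)))
       (d + length (lowers (take i l))) s)) ` set (piece_steps (l ! i)))"
proof (induction l arbitrary: j u d)
  case (Cons p l)
  show ?case
    by (simp add: lessThan_Suc_eq_insert_0 Cons image_image add.assoc)
qed simp

lemma set_stack_steps: "set (stack_steps r k ls) = (\<Union>i<length ls. set (layer_steps (r + i) k k k (ls ! i)))"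
proof (induction ls arbitrary: r)
  case (Cons l ls)
  show ?case
    by (simp add: lessThan_Suc_eq_insert_0 Cons image_image)
qed simp

lemma set_arc_list: "set (arc_list Z) = arcs Z"
proof -
  have *: "orient a (lift_step r j u d (p, q, x)) =
      (i, (r + fst p', (if fst p' = 0 then u else d) + snd p'),
       (r + fst q', (if fst q' = 0 then u else d) + snd q'), map_option (Pair (r, j)) x')"
    if "orient a (p, q, x) = (i, p', q', x')" for a r j u d p q x i p' q' x'
    using that by (cases p; cases q) (auto simp: orient_def split: if_splits)
  have "arcs Z = (\<Union>r<length (layers Z). \<Union>j<length (layers Z ! r).
      (\<lambda>(a, s). orient a (lift_step r j (length (uppers (take j (layers Z ! r))))
        (length (lowers (take j (layers Z ! r)))) s)) ` set (piece_steps (layers Z ! r ! j)))"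
    (is "_ = ?R")
  proof (intro set_eqI iffI)
    fix y assume "y \<in> arcs Z"
    then obtain i p q x r j where rj: "r < length (layers Z)" "j < length (layers Z ! r)"
      and m: "(i, p, q, x) \<in> piece_arcs (layers Z ! r ! j)"
      and y: "y = (i, place (layers Z ! r) r j p, place (layers Z ! r) r j q, map_option (Pair (r, j)) x)"
      by (auto simp: arcs_def)
    from m obtain a s where s: "(a, s) \<in> set (piece_steps (layers Z ! r ! j))" "orient a s = (i, p, q, x)"
      by (auto simp: piece_arcs_eq)
    obtain s1 s2 s3 where s': "s = (s1, s2, s3)" by (cases s)
    have "y = orient a (lift_step r j (length (uppers (take j (layers Z ! r))))
        (length (lowers (take j (layers Z ! r)))) s)"
      using *[OF s(2)[unfolded s']] by (simp add: y s' place_def)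
    then show "y \<in> ?R" using rj s(1) by force
  next
    fix y assume "y \<in> ?R"
    then obtain r j a s where rj: "r < length (layers Z)" "j < length (layers Z ! r)"
      and s: "(a, s) \<in> set (piece_steps (layers Z ! r ! j))"
      and y: "y = orient a (lift_step r j (length (uppers (take j (layers Z ! r))))
        (length (lowers (take j (layers Z ! r)))) s)"
      by auto
    obtain s1 s2 s3 where s': "s = (s1, s2, s3)" by (cases s)
    obtain i p q x where o: "orient a s = (i, p, q, x)" by (cases "orient a s")
    then have "(i, p, q, x) \<in> piece_arcs (layers Z ! r ! j)"
      using s by (force simp: piece_arcs_eq)
    moreover have "y = (i, place (layers Z ! r) r j p, place (layers Z ! r) r j q, map_option (Pair (r, j)) x)"
      using *[OF o[unfolded s']] by (simp add: y s' place_def)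
    ultimately show "y \<in> arcs Z" using rj unfolding arcs_def by blast
  qed
  then show ?thesis
    by (simp add: arc_list_def set_stack_steps set_layer_steps image_UN image_image case_prod_unfold)
qed

section \<open>Sources and targets of arcs on the horizontal lines\<close>

fun ends :: "nat \<Rightarrow> nat \<Rightarrow> dir \<Rightarrow> strand list \<Rightarrow> (nat \<times> point) list" where
  "ends c u d [] = []"
| "ends c u d (a # as) = (if snd a = d then [(fst a, (c, u))] else []) @ ends c (Suc u) d as"

lemma ends_append: "ends c u d (as @ bs) = ends c u d as @ ends c (u + length as) d bs"
  by (induction as arbitrary: u) simp_all

lemma ends_iff: "(i, q) \<in> set (ends c u d as) \<longleftrightarrow> (\<exists>k<length as. as ! k = (i, d) \<and> q = (c, u + k))"
proof (induction as arbitrary: u)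
  case (Cons a as)
  show ?case
    by (cases a) (auto simp: Ex_less_Suc2 Cons)
qed simp

lemma distinct_ends: "distinct (map snd (ends c u d as))"
proof (induction as arbitrary: u)
  case (Cons a as)
  have "(c, u) \<notin> snd ` set (ends c (Suc u) d as)"
    by (auto simp: ends_iff)
  then show ?case using Cons by simp
qed simp

lemma ends_opposite: "(i, q) \<in> set (ends c u Up as) \<Longrightarrow> (i', q) \<in> set (ends c u Down as) \<Longrightarrow> False"
  by (auto simp: ends_iff)

abbreviation comp_source :: "arc \<Rightarrow> nat \<times> point" where "comp_source a \<equiv> (arc_comp a, arc_source a)"
abbreviation comp_target :: "arc \<Rightarrow> nat \<times> point" where "comp_target a \<equiv> (arc_comp a, arc_target a)"

text \<open>Within a layer arcs start at upper ends of downward strands and at lower ends of upward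
  strands. Multisets are compared because arcs are listed by pieces, not by ends.\<close>

lemma layer_ends:
  "mset (map comp_source (oriented (layer_steps r j u d l)))
    = mset (ends r u Down (uppers l)) + mset (ends (Suc r) d Up (lowers l)) \<and>
  mset (map comp_target (oriented (layer_steps r j u d l)))
    = mset (ends r u Up (uppers l)) + mset (ends (Suc r) d Down (lowers l))"
proof (induction l arbitrary: j u d)
  case (Cons p l)
  have "mset (map comp_source (oriented (map (\<lambda>(a, s). (a, lift_step r j u d s)) (piece_steps p))))
      = mset (ends r u Down (upper p)) + mset (ends (Suc r) d Up (lower p))"
    "mset (map comp_target (oriented (map (\<lambda>(a, s). (a, lift_step r j u d s)) (piece_steps p))))
      = mset (ends r u Up (upper p)) + mset (ends (Suc r) d Down (lower p))"
    by (cases p; auto simp: orient_def)+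
  then show ?case
    using Cons[of "Suc j" "u + length (upper p)" "d + length (lower p)"]
    by (simp only: layer_steps.simps uppers_simps lowers_simps ends_append map_append mset_append ac_simps)
qed simp

fun stack_sources :: "nat \<Rightarrow> layer list \<Rightarrow> (nat \<times> point) list" where
  "stack_sources r [] = []"
| "stack_sources r (l # ls) = ends r 0 Down (uppers l) @ ends (Suc r) 0 Up (lowers l) @ stack_sources (Suc r) ls"

fun stack_targets :: "nat \<Rightarrow> layer list \<Rightarrow> (nat \<times> point) list" where
  "stack_targets r [] = []"
| "stack_targets r (l # ls) = ends r 0 Up (uppers l) @ ends (Suc r) 0 Down (lowers l) @ stack_targets (Suc r) ls"

lemma mset_stack:
  "mset (map comp_source (oriented (stack_steps r 0 ls))) = mset (stack_sources r ls)"
  "mset (map comp_target (oriented (stack_steps r 0 ls))) = mset (stack_targets r ls)"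
  using layer_ends
  by (induction ls arbitrary: r) (simp_all only: stack_steps.simps stack_sources.simps stack_targets.simps
      map_append mset_append list.map mset.simps add.assoc)

lemma composable_Cons [simp]: "composable []" "composable [l]"
  "composable (l # l' # ls) \<longleftrightarrow> lowers l = uppers l' \<and> composable (l' # ls)"
proof -
  have "(\<forall>k. P k) \<longleftrightarrow> P 0 \<and> (\<forall>k. P (Suc k))" for P :: "nat \<Rightarrow> bool"
    by (metis not0_implies_Suc)
  from this[of "\<lambda>r. Suc r < length (l # l' # ls) \<longrightarrow> lowers ((l # l' # ls) ! r) = uppers ((l # l' # ls) ! Suc r)"]
  show "composable (l # l' # ls) \<longleftrightarrow> lowers l = uppers l' \<and> composable (l' # ls)"
    unfolding composable_def by simp
qed (simp_all add: composable_def)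

lemma ends_level: "(i, q) \<in> set (ends c u d as) \<Longrightarrow> fst q = c"
  by (auto simp: ends_iff)

lemma stack_level:
  assumes "composable ls"
  shows "(i, q) \<in> set (stack_sources r ls) \<Longrightarrow> ls \<noteq> [] \<and> fst q \<ge> r \<and>
      (fst q = r \<longrightarrow> (i, q) \<in> set (ends r 0 Down (uppers (hd ls))))"
    "(i, q) \<in> set (stack_targets r ls) \<Longrightarrow> ls \<noteq> [] \<and> fst q \<ge> r \<and>
      (fst q = r \<longrightarrow> (i, q) \<in> set (ends r 0 Up (uppers (hd ls))))"
proof -
  have "((i, q) \<in> set (stack_sources r ls) \<longrightarrow> ls \<noteq> [] \<and> fst q \<ge> r \<and>
      (fst q = r \<longrightarrow> (i, q) \<in> set (ends r 0 Down (uppers (hd ls))))) \<and>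
    ((i, q) \<in> set (stack_targets r ls) \<longrightarrow> ls \<noteq> [] \<and> fst q \<ge> r \<and>
      (fst q = r \<longrightarrow> (i, q) \<in> set (ends r 0 Up (uppers (hd ls)))))"
    using assms
  proof (induction ls arbitrary: r)
    case (Cons l ls)
    have "composable ls"
      using Cons.prems by (cases ls) auto
    from Cons.IH[OF this, of "Suc r"] show ?case
      by (auto dest: ends_level)
  qed simp
  then show "(i, q) \<in> set (stack_sources r ls) \<Longrightarrow> ls \<noteq> [] \<and> fst q \<ge> r \<and>
      (fst q = r \<longrightarrow> (i, q) \<in> set (ends r 0 Down (uppers (hd ls))))"
    "(i, q) \<in> set (stack_targets r ls) \<Longrightarrow> ls \<noteq> [] \<and> fst q \<ge> r \<and>
      (fst q = r \<longrightarrow> (i, q) \<in> set (ends r 0 Up (uppers (hd ls))))"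
    by auto
qed

text \<open>A line between two layers is seen from both, but a downward end on it is a source only
  for the layer below and an upward end only for the layer above. Composability guarantees that both
  layers see the same ends.\<close>

lemma distinct_stack:
  assumes "composable ls"
  shows "distinct (map snd (stack_sources r ls)) \<and> distinct (map snd (stack_targets r ls))"
  using assms
proof (induction ls arbitrary: r)
  case (Cons l ls)
  have c: "composable ls"
    using Cons.prems by (cases ls) auto
  have h: "ls \<noteq> [] \<Longrightarrow> uppers (hd ls) = lowers l"
    using Cons.prems by (cases ls) auto
  have a: "q \<notin> snd ` set (ends (Suc r) 0 Up (lowers l))" if m: "q \<in> snd ` set (stack_sources (Suc r) ls)" for q
  proof
    assume "q \<in> snd ` set (ends (Suc r) 0 Up (lowers l))"
    then obtain i where i: "(i, q) \<in> set (ends (Suc r) 0 Up (lowers l))" by auto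
    obtain i' where "(i', q) \<in> set (stack_sources (Suc r) ls)" using m by auto
    from stack_level(1)[OF c this] ends_level[OF i] h show False
      using ends_opposite[OF i] by metis
  qed
  have b: "q \<notin> snd ` set (ends (Suc r) 0 Down (lowers l))" if m: "q \<in> snd ` set (stack_targets (Suc r) ls)" for q
  proof
    assume "q \<in> snd ` set (ends (Suc r) 0 Down (lowers l))"
    then obtain i where i: "(i, q) \<in> set (ends (Suc r) 0 Down (lowers l))" by auto
    obtain i' where "(i', q) \<in> set (stack_targets (Suc r) ls)" using m by auto
    from stack_level(2)[OF c this] ends_level[OF i] h show False
      using ends_opposite[OF _ i] by metis
  qed
  have e: "snd ` set (ends r 0 d (uppers l)) \<inter> snd ` set (ends (Suc r) 0 d' (lowers l)) = {}" for d d'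
    by (auto simp: ends_iff)
  have f: "snd ` set (ends r 0 d (uppers l)) \<inter> snd ` set (stack_sources (Suc r) ls) = {}"
    "snd ` set (ends r 0 d (uppers l)) \<inter> snd ` set (stack_targets (Suc r) ls) = {}" for d
    using stack_level[OF c] ends_level by fastforce+
  show ?case
  proof -
    have "snd ` set (ends (Suc r) 0 Up (lowers l)) \<inter> snd ` set (stack_sources (Suc r) ls) = {}"
      "snd ` set (ends (Suc r) 0 Down (lowers l)) \<inter> snd ` set (stack_targets (Suc r) ls) = {}"
      using a b by blast+
    then show ?thesis
      using Cons.IH[OF c, of "Suc r"] e f by (simp add: distinct_ends image_Un Int_Un_distrib)
  qed
qed simp

lemma stack_bottom:
  assumes "composable ls" "ls \<noteq> []"
  shows "(i, (r + length ls, k)) \<in> set (stack_sources r ls) \<longleftrightarrow>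
      (i, (r + length ls, k)) \<in> set (ends (r + length ls) 0 Up (lowers (last ls)))"
    "(i, (r + length ls, k)) \<in> set (stack_targets r ls) \<longleftrightarrow>
      (i, (r + length ls, k)) \<in> set (ends (r + length ls) 0 Down (lowers (last ls)))"
proof -
  have "((i, (r + length ls, k)) \<in> set (stack_sources r ls) \<longleftrightarrow>
      (i, (r + length ls, k)) \<in> set (ends (r + length ls) 0 Up (lowers (last ls)))) \<and>
    ((i, (r + length ls, k)) \<in> set (stack_targets r ls) \<longleftrightarrow>
      (i, (r + length ls, k)) \<in> set (ends (r + length ls) 0 Down (lowers (last ls))))"
    using assms
  proof (induction ls arbitrary: r)
    case (Cons l ls)
    show ?case
    proof (cases ls)
      case Nil
      then show ?thesis by (auto dest: ends_level)
    next
      case (Cons l' ls')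
      then have "composable ls" "ls \<noteq> []" using Cons.prems by auto
      from Cons.IH[OF this, of "Suc r"] show ?thesis
        using Cons by (auto dest: ends_level)
    qed
  qed simp
  then show "(i, (r + length ls, k)) \<in> set (stack_sources r ls) \<longleftrightarrow>
      (i, (r + length ls, k)) \<in> set (ends (r + length ls) 0 Up (lowers (last ls)))"
    "(i, (r + length ls, k)) \<in> set (stack_targets r ls) \<longleftrightarrow>
      (i, (r + length ls, k)) \<in> set (ends (r + length ls) 0 Down (lowers (last ls)))"
    by auto
qed

lemma set_stack_ends:
  "set (stack_sources 0 (layers Z)) = comp_source ` arcs Z"
  "set (stack_targets 0 (layers Z)) = comp_target ` arcs Z"
  unfolding set_arc_list[symmetric] arc_list_def set_map[symmetric]
  by (intro mset_eq_setD mset_stack[symmetric])+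

lemma distinct_arc_list:
  assumes "composable (layers Z)"
  shows "distinct (map arc_source (arc_list Z))" "distinct (map arc_target (arc_list Z))"
proof -
  have "mset (map arc_source (arc_list Z)) = mset (map snd (stack_sources 0 (layers Z)))"
    "mset (map arc_target (arc_list Z)) = mset (map snd (stack_targets 0 (layers Z)))"
    using mset_stack[of 0 "layers Z", THEN arg_cong, of "image_mset snd"]
    by (simp_all add: arc_list_def multiset.map_comp o_def)
  then show "distinct (map arc_source (arc_list Z))" "distinct (map arc_target (arc_list Z))"
    using distinct_stack[OF assms] mset_eq_imp_distinct_iff by blast+
qed

text \<open>In a closed traversal the sources and the targets are the same points. A point on the
  top or bottom line meets one layer only, so its direction makes it a source or a target, but not
  both.\<close>

lemma closed_no_boundary:
  assumes Z: "colored_diagram Z" and t: "traversal Z i as" "arc_target (last as) = arc_source (hd as)"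
  shows "\<not> has_boundary Z i"
proof
  assume "has_boundary Z i"
  then obtain z where z: "z \<in> set (uppers (hd (layers Z))) \<union> set (lowers (last (layers Z)))" "i = fst z"
    unfolding has_boundary_def by blast
  obtain d where "z = (i, d)"
    using z(2) by (cases z) simp
  then have d: "(i, d) \<in> set (uppers (hd (layers Z))) \<or> (i, d) \<in> set (lowers (last (layers Z)))"
    using z(1) by simp
  have c: "composable (layers Z)" and ne: "layers Z \<noteq> []"
    using Z by (auto simp: colored_diagram_def)
  let ?X = "{a \<in> arcs Z. arc_comp a = i}"
  have as: "as \<noteq> []" "set as = ?X" "linked arc_source arc_target as"
    using t by (auto simp: traversal_def linked_def)
  have st: "arc_source ` ?X = arc_target ` ?X"
  proof -
    have "map arc_source (tl as) = map arc_target (butlast as)"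
      using as(3) by (intro nth_equalityI) (auto simp: linked_def nth_tl nth_butlast)
    then have "arc_source ` set (tl as) = arc_target ` set (butlast as)"
      by (metis set_map)
    moreover have "arc_source ` set as = insert (arc_source (hd as)) (arc_source ` set (tl as))"
      using as(1) by (cases as) auto
    moreover have "arc_target ` set as = insert (arc_target (last as)) (arc_target ` set (butlast as))"
      using as(1) by (cases as rule: rev_cases) auto
    ultimately show ?thesis
      using t(2) as(2) by simp
  qed
  have s1: "(i, q) \<in> set (stack_sources 0 (layers Z)) \<longleftrightarrow> (i, q) \<in> set (stack_targets 0 (layers Z))" for q
  proof -
    have "(i, q) \<in> set (stack_sources 0 (layers Z)) \<longleftrightarrow> q \<in> arc_source ` ?X"
      unfolding set_stack_ends by auto
    moreover have "(i, q) \<in> set (stack_targets 0 (layers Z)) \<longleftrightarrow> q \<in> arc_target ` ?X"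
      unfolding set_stack_ends by auto
    ultimately show ?thesis using st by simp
  qed
  show False
    using d
  proof
    assume "(i, d) \<in> set (uppers (hd (layers Z)))"
    then obtain k where k: "k < length (uppers (hd (layers Z)))" "uppers (hd (layers Z)) ! k = (i, d)"
      by (metis in_set_conv_nth)
    then have e: "(i, (0, k)) \<in> set (ends 0 0 d (uppers (hd (layers Z))))"
      by (auto simp: ends_iff)
    have "(i, (0, k)) \<in> set (stack_sources 0 (layers Z)) \<or> (i, (0, k)) \<in> set (stack_targets 0 (layers Z))"
      using e ne by (cases "layers Z"; cases d) auto
    then have "(i, (0, k)) \<in> set (ends 0 0 Down (uppers (hd (layers Z))))"
      "(i, (0, k)) \<in> set (ends 0 0 Up (uppers (hd (layers Z))))"
      using stack_level[OF c, of i "(0, k)" 0] s1 by auto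
    then show False using ends_opposite by blast
  next
    let ?n = "length (layers Z)"
    assume "(i, d) \<in> set (lowers (last (layers Z)))"
    then obtain k where k: "k < length (lowers (last (layers Z)))" "lowers (last (layers Z)) ! k = (i, d)"
      by (metis in_set_conv_nth)
    then have e: "(i, (?n, k)) \<in> set (ends ?n 0 d (lowers (last (layers Z))))"
      by (auto simp: ends_iff)
    then have "(i, (?n, k)) \<in> set (ends ?n 0 Down (lowers (last (layers Z))))"
      "(i, (?n, k)) \<in> set (ends ?n 0 Up (lowers (last (layers Z))))"
      using stack_bottom[OF c ne, of i 0 k] s1[of "(?n, k)"] by (cases d; simp)+
    then show False using ends_opposite by blast
  qed
qed

section \<open>State sums over chains\<close>

lemma linked_concat:
  assumes "\<And>xs. xs \<in> set xss \<Longrightarrow> xs \<noteq> []"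
  shows "linked src tgt (concat xss) \<longleftrightarrow>
    (\<forall>xs\<in>set xss. linked src tgt xs) \<and> linked (src \<circ> hd) (tgt \<circ> last) xss"
  using assms
proof (induction xss)
  case (Cons xs xss)
  show ?case
  proof (cases xss)
    case (Cons ys yss)
    then have "concat xss \<noteq> []" "hd (concat xss) = hd ys"
      using Cons.prems by auto
    then show ?thesis
      using Cons.prems Cons.IH Cons linked_append[of xs "concat xss" src tgt] by auto
  qed simp
qed simp

text \<open>Steps are listed as a downward strand would meet them; an upward strand meets them in
  the reverse order.\<close>

definition chain_arcs :: "strand \<Rightarrow> step list \<Rightarrow> arc list" where
  "chain_arcs a ss = (if snd a = Down then map (orient a) ss else rev (map (orient a) ss))"

abbreviation step_source :: "step \<Rightarrow> point" where "step_source \<equiv> fst"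
abbreviation step_target :: "step \<Rightarrow> point" where "step_target s \<equiv> fst (snd s)"

lemma orient_ends: "arc_source (orient a s) = (if snd a = Down then step_source s else step_target s)"
  "arc_target (orient a s) = (if snd a = Down then step_target s else step_source s)"
  by (cases s; simp add: orient_def)+

lemma set_chain_arcs: "set (chain_arcs a ss) = orient a ` set ss"
  by (simp add: chain_arcs_def)

lemma linked_chain_arcs: "linked arc_source arc_target (chain_arcs a ss) \<longleftrightarrow> linked step_source step_target ss"
proof -
  have "linked arc_target arc_source (map (orient a) ss) \<longleftrightarrow> linked step_source step_target ss" if "snd a = Up"
    using that by (simp add: linked_def orient_ends)
  moreover have "linked arc_source arc_target (map (orient a) ss) \<longleftrightarrow> linked step_source step_target ss" if "snd a = Down"
    using that by (simp add: linked_def orient_ends)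
  ultimately show ?thesis
    by (cases "snd a") (simp_all add: chain_arcs_def linked_rev)
qed

lemma chain_arcs_ends:
  assumes "ss \<noteq> []"
  shows "arc_source (hd (chain_arcs a ss)) =
      (if snd a = Down then step_source (hd ss) else step_target (last ss))"
    "arc_target (last (chain_arcs a ss)) =
      (if snd a = Down then step_target (last ss) else step_source (hd ss))"
  using assms
  by (cases "snd a"; simp add: chain_arcs_def hd_map last_map hd_rev last_rev orient_ends)+

text \<open>
  A match \<open>(a, ss, ss')\<close> consists of a strand and of the chains of steps which it follows in two
  diagrams.
\<close>

type_synonym match = "strand \<times> step list \<times> step list"

abbreviation mstrand :: "match \<Rightarrow> strand" where "mstrand k \<equiv> fst k"
abbreviation left_steps :: "match \<Rightarrow> step list" where "left_steps k \<equiv> fst (snd k)"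
abbreviation right_steps :: "match \<Rightarrow> step list" where "right_steps k \<equiv> snd (snd k)"

definition match_arcs :: "(match \<Rightarrow> step list) \<Rightarrow> match list \<Rightarrow> arc list" where
  "match_arcs f K = concat (map (\<lambda>k. map (orient (mstrand k)) (f k)) K)"

text \<open>\<open>\<rho>\<close> carries points of the first diagram to points of the second and is
  compared at the outer ends of the two chains; their interiors may be entirely different, as a move
  requires.\<close>

definition aligned :: "(point \<Rightarrow> point) \<Rightarrow> match \<Rightarrow> bool" where
  "aligned \<rho> k \<longleftrightarrow> left_steps k \<noteq> [] \<and> right_steps k \<noteq> [] \<and>
     linked step_source step_target (left_steps k) \<and> linked step_source step_target (right_steps k) \<and>
     step_source (hd (right_steps k)) = \<rho> (step_source (hd (left_steps k))) \<and>
     step_target (last (right_steps k)) = \<rho> (step_target (last (left_steps k)))"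

abbreviation chain :: "(match \<Rightarrow> step list) \<Rightarrow> match \<Rightarrow> arc list" where
  "chain f k \<equiv> chain_arcs (mstrand k) (f k)"

lemma set_match_arcs: "set (match_arcs f K) = (\<Union>k\<in>set K. set (chain f k))"
  by (auto simp: match_arcs_def set_chain_arcs)

lemma mset_chain: "mset (chain f k) = mset (map (orient (mstrand k)) (f k))"
  by (simp add: chain_arcs_def)

lemma mset_match_arcs: "mset (match_arcs f K) = mset (concat (map (chain f) K))"
  by (induction K) (simp_all add: match_arcs_def mset_chain)

lemma distinct_concat_mapD:
  assumes "distinct (concat (map C K))" "\<And>k. k \<in> set K \<Longrightarrow> C k \<noteq> []"
  shows "distinct K" "k \<in> set K \<Longrightarrow> distinct (C k)"
    "k \<in> set K \<Longrightarrow> k' \<in> set K \<Longrightarrow> x \<in> set (C k) \<Longrightarrow> x \<in> set (C k') \<Longrightarrow> k = k'"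
proof -
  have "distinct K \<and> (\<forall>k\<in>set K. distinct (C k)) \<and>
    (\<forall>k\<in>set K. \<forall>k'\<in>set K. \<forall>x. x \<in> set (C k) \<longrightarrow> x \<in> set (C k') \<longrightarrow> k = k')"
    using assms
  proof (induction K)
    case (Cons q K)
    have 1: "set (C q) \<inter> set (C k) = {}" if "k \<in> set K" for k
      using Cons.prems(1) that by auto
    then have "q \<notin> set K"
      using Cons.prems(2)[of q] by force
    then show ?case
      using Cons 1 by (auto simp: disjoint_iff)
  qed simp
  then show "distinct K" "k \<in> set K \<Longrightarrow> distinct (C k)"
    "k \<in> set K \<Longrightarrow> k' \<in> set K \<Longrightarrow> x \<in> set (C k) \<Longrightarrow> x \<in> set (C k') \<Longrightarrow> k = k'"
    by blast+
qed

text \<open>\<open>chain_parse\<close> cuts a traversal of the first diagram into chains. Where two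
  consecutive chains meet, the corresponding chains meet in the image of that point under
  \<open>\<rho>\<close>, so the same order of matches traverses the second diagram.\<close>

lemma traversal_transfer:
  assumes Z: "colored_diagram Z" and Z': "colored_diagram Z'"
    and K: "mset (match_arcs left_steps K) = mset (arc_list Z)"
    and K': "mset (match_arcs right_steps K) = mset (arc_list Z')"
    and al: "\<And>k. k \<in> set K \<Longrightarrow> aligned \<rho> k"
    and i: "i < length (thin Z)"
  shows "\<exists>qs. distinct qs \<and> set qs = {k \<in> set K. fst (mstrand k) = i} \<and>
    traversal Z i (concat (map (chain left_steps) qs)) \<and>
    traversal Z' i (concat (map (chain right_steps) qs))"
proof -
  obtain as where as: "traversal Z i as"
    using Z i by (auto simp: colored_diagram_def)
  let ?Q = "{k \<in> set K. fst (mstrand k) = i}"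
  have d: "distinct (map arc_source (arc_list Z))" "distinct (map arc_target (arc_list Z))"
    "distinct (map arc_source (arc_list Z'))"
    using distinct_arc_list Z Z' by (auto simp: colored_diagram_def)
  have dl: "distinct (concat (map (chain left_steps) K))" "distinct (concat (map (chain right_steps) K))"
    using d K K' mset_eq_imp_distinct_iff[OF trans[OF mset_match_arcs[symmetric] K]]
      mset_eq_imp_distinct_iff[OF trans[OF mset_match_arcs[symmetric] K']]
    by (simp_all add: distinct_map)
  have ne: "chain left_steps k \<noteq> []" "chain right_steps k \<noteq> []" if "k \<in> set K" for k
    using al[OF that] by (auto simp: aligned_def chain_arcs_def)
  note D = distinct_concat_mapD[OF dl(1) ne(1)] and D' = distinct_concat_mapD[OF dl(2) ne(2)]
  have set_arcs: "(\<Union>k\<in>set K. set (chain left_steps k)) = arcs Z"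
    "(\<Union>k\<in>set K. set (chain right_steps k)) = arcs Z'"
    using mset_eq_setD[OF K] mset_eq_setD[OF K'] by (simp_all add: set_match_arcs set_arc_list)
  have cov: "(\<Union>k\<in>?Q. set (chain f k)) = {a \<in> (\<Union>k\<in>set K. set (chain f k)). arc_comp a = i}" for f
    by (auto simp: set_chain_arcs)
  have cover: "(\<Union>k\<in>?Q. set (chain left_steps k)) = {a \<in> arcs Z. arc_comp a = i}"
    "(\<Union>k\<in>?Q. set (chain right_steps k)) = {a \<in> arcs Z'. arc_comp a = i}"
    using cov[of left_steps] cov[of right_steps] unfolding set_arcs by simp_all
  have inj: "inj_on arc_source {a \<in> arcs Z. arc_comp a = i}" "inj_on arc_target {a \<in> arcs Z. arc_comp a = i}"
    using d unfolding set_arc_list[symmetric] by (auto simp: distinct_map intro: inj_on_subset)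
  have "\<exists>qs n. distinct qs \<and> set qs = ?Q \<and> concat (map (chain left_steps) qs) = rotate n as \<and>
    (n = 0 \<or> arc_target (last as) = arc_source (hd as))"
  proof (rule chain_parse[OF inj])
    show "set as = {a \<in> arcs Z. arc_comp a = i}" "distinct as" "linked arc_source arc_target as" "as \<noteq> []"
      using as by (auto simp: traversal_def linked_def)
    show "chain left_steps k \<noteq> [] \<and> linked arc_source arc_target (chain left_steps k) \<and> distinct (chain left_steps k)"
      if "k \<in> ?Q" for k
      using that ne D(2) al[of k] by (auto simp: linked_chain_arcs aligned_def)
    show "k = k'" if "k \<in> ?Q" "k' \<in> ?Q" "x \<in> set (chain left_steps k)" "x \<in> set (chain left_steps k')" for k k' x
      using that D(3)[of k k' x] by simp
  qed (rule cover)
  then obtain qs n where qs: "distinct qs" "set qs = ?Q" "concat (map (chain left_steps) qs) = rotate n as"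
    "n = 0 \<or> arc_target (last as) = arc_source (hd as)" by blast
  have l: "linked arc_source arc_target (concat (map (chain left_steps) qs))"
    using qs(3,4) as linked_rotate[of arc_source arc_target as n] by (auto simp: traversal_def linked_def)
  have t: "traversal Z i (concat (map (chain left_steps) qs))"
    using l as unfolding qs(3) traversal_def linked_def set_rotate distinct_rotate rotate_is_Nil_conv
    by blast
  have qK: "k \<in> set K" if "k \<in> set qs" for k
    using that qs(2) by simp
  have c: "concat (map C qs) \<noteq> []" if "\<And>k. k \<in> set qs \<Longrightarrow> C k \<noteq> []" for C :: "match \<Rightarrow> arc list"
  proof -
    have "qs \<noteq> []" using t by (auto simp: traversal_def)
    then show ?thesis using that by (cases qs) auto
  qed
  have nel: "xs \<noteq> []" if "xs \<in> set (map (chain left_steps) qs)" for xs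
    using that ne(1)[OF qK] by (auto simp del: fst_conv snd_conv)
  have ner: "xs \<noteq> []" if "xs \<in> set (map (chain right_steps) qs)" for xs
    using that ne(2)[OF qK] by (auto simp del: fst_conv snd_conv)
  have "linked (arc_source \<circ> hd) (arc_target \<circ> last) (map (chain left_steps) qs)"
    by (rule iffD1[OF linked_concat[OF nel] l, THEN conjunct2])
  then have L: "arc_target (last (chain left_steps (qs ! n))) = arc_source (hd (chain left_steps (qs ! Suc n)))"
    if "Suc n < length qs" for n
    using that by (auto simp: linked_def)
  have R: "arc_source (hd (chain right_steps k)) = \<rho> (arc_source (hd (chain left_steps k)))"
    "arc_target (last (chain right_steps k)) = \<rho> (arc_target (last (chain left_steps k)))" if "k \<in> set K" for k
    using al[OF that] by (simp_all add: aligned_def chain_arcs_ends)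
  have "linked (arc_source \<circ> hd) (arc_target \<circ> last) (map (chain right_steps) qs)"
    unfolding linked_def
  proof (intro allI impI)
    fix n assume "Suc n < length (map (chain right_steps) qs)"
    then have n: "Suc n < length qs" by simp
    then have "qs ! n \<in> set K" "qs ! Suc n \<in> set K" by (intro qK nth_mem; simp)+
    from R(2)[OF this(1)] R(1)[OF this(2)] L[OF n] n
    show "(arc_target \<circ> last) (map (chain right_steps) qs ! n)
      = (arc_source \<circ> hd) (map (chain right_steps) qs ! Suc n)"
      by (simp only: o_apply nth_map length_map Suc_lessD)
  qed
  moreover have "\<forall>xs\<in>set (map (chain right_steps) qs). linked arc_source arc_target xs"
    using al qK by (simp add: linked_chain_arcs aligned_def)
  ultimately have l': "linked arc_source arc_target (concat (map (chain right_steps) qs))"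
    by (intro iffD2[OF linked_concat[OF ner]] conjI)
  have "distinct (concat (map (chain right_steps) qs))"
  proof -
    have "distinct ks \<Longrightarrow> set ks \<subseteq> set K \<Longrightarrow> distinct (concat (map (chain right_steps) ks))" for ks
    proof (induction ks)
      case (Cons k ks)
      have "x \<notin> set (concat (map (chain right_steps) ks))" if x: "x \<in> set (chain right_steps k)" for x
      proof
        assume "x \<in> set (concat (map (chain right_steps) ks))"
        then obtain k' where k': "k' \<in> set ks" "x \<in> set (chain right_steps k')"
          by (auto simp del: fst_conv snd_conv)
        moreover have "k \<in> set K" "k' \<in> set K" using k'(1) Cons.prems by auto
        ultimately have "k = k'" using D'(3)[of k k' x] x by simp
        then show False using k' Cons.prems by simp
      qed
      then show ?case using D'(2)[of k] Cons by (simp add: disjoint_iff)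
    qed simp
    then show ?thesis using qs(1) qK by blast
  qed
  moreover have "set (concat (map (chain right_steps) qs)) = {a \<in> arcs Z'. arc_comp a = i}"
    using cover(2) qs(2) by simp
  moreover have "concat (map (chain right_steps) qs) \<noteq> []"
    using c[of "chain right_steps"] ne(2) qK by blast
  ultimately have "traversal Z' i (concat (map (chain right_steps) qs))"
    using l' unfolding traversal_def linked_def by blast
  then show ?thesis using qs(1,2) t by blast
qed

text \<open>\<open>chain_parse\<close> is applied with the second traversal as the only
  chain.\<close>

lemma traversal_unique:
  assumes Z: "colored_diagram Z" and as: "traversal Z i as" and bs: "traversal Z i bs"
  shows "\<exists>n. bs = rotate n as \<and> (n = 0 \<or> arc_target (last as) = arc_source (hd as))"
proof -
  have d: "distinct (map arc_source (arc_list Z))" "distinct (map arc_target (arc_list Z))"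
    using distinct_arc_list Z by (auto simp: colored_diagram_def)
  then have inj: "inj_on arc_source {a \<in> arcs Z. arc_comp a = i}" "inj_on arc_target {a \<in> arcs Z. arc_comp a = i}"
    unfolding set_arc_list[symmetric] by (auto simp: distinct_map intro: inj_on_subset)
  have "\<exists>qs n. distinct qs \<and> set qs = {()} \<and> concat (map (\<lambda>_. bs) qs) = rotate n as \<and>
    (n = 0 \<or> arc_target (last as) = arc_source (hd as))"
    using as bs by (intro chain_parse[OF inj]) (auto simp: traversal_def linked_def)
  then obtain qs n where qs: "distinct qs" "set qs = {()}" "concat (map (\<lambda>_. bs) qs) = rotate n as"
    "n = 0 \<or> arc_target (last as) = arc_source (hd as)" by blast
  then have "qs = [()]"
    by (cases qs; cases "tl qs") auto
  then show ?thesis using qs by auto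
qed

context finite_hopf
begin

section \<open>Products of labels along a component\<close>

abbreviation "smul \<equiv> strand_mult A"

definition sprod :: "bool \<Rightarrow> ('k, 'a) heis list \<Rightarrow> ('k, 'a) heis" where
  "sprod th ls = foldr (smul th) ls h1"

lemma smul_in: "s \<in> H \<Longrightarrow> t \<in> H \<Longrightarrow> smul th s t \<in> H"
  by (simp add: strand_mult_def hm_in)

lemma smul_assoc: "s \<in> H \<Longrightarrow> t \<in> H \<Longrightarrow> r \<in> H \<Longrightarrow> smul th (smul th s t) r = smul th s (smul th t r)"
  by (simp add: strand_mult_def hm_assoc)

lemma smul_one: "s \<in> H \<Longrightarrow> smul th h1 s = s" "s \<in> H \<Longrightarrow> smul th s h1 = s"
  by (simp_all add: strand_mult_def hm_one_left hm_one_right)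

lemma smul_linear:
  assumes "s \<in> H" "t \<in> H" "r \<in> H"
  shows "smul th (s + t) r = smul th s r + smul th t r" "smul th r (s + t) = smul th r s + smul th r t"
    "smul th (fscale c s) r = fscale c (smul th s r)" "smul th r (fscale c s) = fscale c (smul th r s)"
  using assms by (simp_all add: strand_mult_def hm_add_left hm_add_right hm_scale_left hm_scale_right)

lemma sprod_Nil [simp]: "sprod th [] = h1" and sprod_Cons [simp]: "sprod th (s # ls) = smul th s (sprod th ls)"
  by (simp_all add: sprod_def)

lemma sprod_in: "set ls \<subseteq> H \<Longrightarrow> sprod th ls \<in> H"
  by (induction ls) (simp_all add: one_in smul_in)

lemma sprod_append: "set ls \<subseteq> H \<Longrightarrow> set ls' \<subseteq> H \<Longrightarrow> sprod th (ls @ ls') = smul th (sprod th ls) (sprod th ls')"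
  by (induction ls) (simp_all add: smul_one sprod_in smul_assoc)

lemma sprod_concat: "(\<And>ls. ls \<in> set lss \<Longrightarrow> set ls \<subseteq> H) \<Longrightarrow> sprod th (concat lss) = sprod th (map (sprod th) lss)"
proof (induction lss)
  case (Cons ls lss)
  have "set (concat lss) \<subseteq> H" using Cons.prems by auto
  then show ?case using Cons by (simp add: sprod_append)
qed simp

lemma fscale_module: "module (fscale :: 'k \<Rightarrow> ('x \<Rightarrow> 'k) \<Rightarrow> _)"
  by unfold_locales (auto simp: fscale_def fun_eq_iff algebra_simps plus_fun_apply)

lemma commutator_mem: "s \<in> H \<Longrightarrow> t \<in> H \<Longrightarrow> smul th s t - smul th t s \<in> commutator_span A th"
  unfolding commutator_span_def by (rule module.span_base[OF fscale_module]) blast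

lemma coset_eq:
  assumes N: "N = {0} \<or> N = commutator_span A th" and d: "s - t \<in> N"
  shows "coset N s = coset N t"
proof -
  have sub: "module.subspace fscale N"
    using N module.subspace_span[OF fscale_module] module.subspace_single_0[OF fscale_module]
    by (auto simp: commutator_span_def)
  have *: "coset N s \<subseteq> coset N t" if d: "s - t \<in> N" for s t
  proof
    fix x assume "x \<in> coset N s"
    then obtain n where n: "n \<in> N" "x = s + n" by (auto simp: coset_def)
    then have "x = t + ((s - t) + n)" by (simp add: algebra_simps)
    moreover have "(s - t) + n \<in> N"
      by (rule module.subspace_add[OF fscale_module sub d n(1)])
    ultimately show "x \<in> coset N t"
      unfolding coset_def by (rule image_eqI)
  qed
  have "t - s \<in> N"
    using module.subspace_neg[OF fscale_module sub d] by simp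
  then show ?thesis using * d by blast
qed

definition slot :: "diagram \<Rightarrow> nat \<Rightarrow> ('k, 'a) heis set" where
  "slot Z i = slot_kernel A (thin Z ! i) (has_boundary Z i)"

text \<open>The list is reversed because labels are read against the orientation.\<close>

definition passages :: "arc list \<Rightarrow> (crossing \<times> role) list" where
  "passages as = rev (List.map_filter arc_passage as)"

definition word_product :: "diagram \<Rightarrow> (crossing \<Rightarrow> 'a) \<Rightarrow> bool \<Rightarrow> arc list \<Rightarrow> ('k, 'a) heis" where
  "word_product Z \<sigma> th as = sprod th (map (passage_label A B Z \<sigma>) (passages as))"

lemma passages_append: "passages (as @ bs) = passages bs @ passages as"
  by (simp add: passages_def map_filter_def)

lemma passages_concat: "passages (concat ass) = concat (rev (map passages ass))"
  by (induction ass) (simp_all add: passages_append, simp add: passages_def map_filter_def)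

lemma over_label_lform: "lform (over_label A B Z c e)"
  unfolding over_label_def antipode_inv_dual_def Let_def
  using dual_basis_lform lform_o llin_T by auto

lemma passage_label_in: "passage_label A B Z \<sigma> p \<in> H"
  by (cases p; cases "snd p") (simp_all add: of_alg_in of_dual_in over_label_lform)

lemma labels_in: "set (map (passage_label A B Z \<sigma>) ps) \<subseteq> H"
  using passage_label_in by auto

lemma word_product_in: "word_product Z \<sigma> th as \<in> H"
  unfolding word_product_def by (intro sprod_in labels_in)

lemma word_product_concat:
  "word_product Z \<sigma> th (concat ass) = sprod th (map (word_product Z \<sigma> th) (rev ass))"
proof -
  have "word_product Z \<sigma> th (concat ass)
      = sprod th (concat (map (map (passage_label A B Z \<sigma>)) (rev (map passages ass))))"
    by (simp add: word_product_def passages_concat map_concat)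
  also have "\<dots> = sprod th (map (sprod th) (map (map (passage_label A B Z \<sigma>)) (rev (map passages ass))))"
    by (rule sprod_concat) (use passage_label_in in auto)
  finally show ?thesis
    by (simp only: word_product_def[abs_def] rev_map list.map_comp o_def)
qed

text \<open>Two traversals differ by a rotation, which is proper only for a closed component. There
  it exchanges two factors of the product, and their commutator lies in the kernel of the slot; so
  the traversal chosen by \<open>SOME\<close> may be replaced by any other.\<close>

lemma component_coset:
  assumes Z: "colored_diagram Z" and as: "traversal Z i as"
  shows "coset (slot Z i) (component_product A B Z \<sigma> i) = coset (slot Z i) (word_product Z \<sigma> (thin Z ! i) as)"
proof -
  let ?th = "thin Z ! i"
  define bs where "bs = (SOME as. traversal Z i as)"
  have bs: "traversal Z i bs"
    unfolding bs_def using as by (rule someI)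
  have c: "component_product A B Z \<sigma> i = word_product Z \<sigma> ?th bs"
    by (simp add: component_product_def word_product_def sprod_def passages_def bs_def Let_def)
  obtain n where n: "bs = rotate n as" "n = 0 \<or> arc_target (last as) = arc_source (hd as)"
    using traversal_unique[OF Z as bs] by blast
  show ?thesis
  proof (cases "n = 0")
    case True
    then show ?thesis using n c by simp
  next
    case False
    then have slot: "slot Z i = commutator_span A ?th"
      using closed_no_boundary[OF Z as] n(2) by (simp add: slot_def slot_kernel_def)
    obtain xs ys where xy: "as = xs @ ys" "bs = ys @ xs"
      using n(1) by (metis append_take_drop_id rotate_drop_take)
    let ?W = "word_product Z \<sigma> ?th"
    have "?W (us @ vs) = smul ?th (?W vs) (?W us)" for us vs
      using labels_in by (simp add: word_product_def passages_append sprod_append)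
    then have "?W bs - ?W as \<in> slot Z i"
      unfolding slot xy using commutator_mem word_product_in by simp
    then show ?thesis
      unfolding c using coset_eq slot by blast
  qed
qed

text \<open>This is the shape in which the target tensor, evaluated on a form, depends on the values
  of the chains: linear in each one as long as the others stay in \<open>H(A)\<close>. By the first
  clause, values outside \<open>Q\<close> may be filled in at will.\<close>

definition multilin :: "'q set \<Rightarrow> (('q \<Rightarrow> ('k, 'a) heis) \<Rightarrow> 'k) \<Rightarrow> bool" where
  "multilin Q G \<longleftrightarrow>
     (\<forall>v w. (\<forall>q\<in>Q. v q = w q) \<longrightarrow> G v = G w) \<and>
     (\<forall>v. (\<forall>q. v q \<in> H) \<longrightarrow> (\<forall>q\<in>Q. hlin (\<lambda>s. G (v(q := s)))))"

lemma sprod_update: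
  assumes "distinct qs" "q \<in> set qs" "\<And>q. v q \<in> H"
  shows "\<exists>P\<in>H. \<exists>R\<in>H. \<forall>s\<in>H. sprod th (map (v(q := s)) qs) = smul th P (smul th s R)"
proof -
  obtain xs ys where qs: "qs = xs @ q # ys" using assms(2) by (meson split_list)
  have m: "map (v(q := s)) xs = map v xs" "map (v(q := s)) ys = map v ys" for s
    using assms(1) by (auto simp: qs)
  have in_H: "set (map v us) \<subseteq> H" for us using assms(3) by auto
  have "sprod th (map (v(q := s)) qs) = smul th (sprod th (map v xs)) (smul th s (sprod th (map v ys)))"
    if "s \<in> H" for s
  proof -
    have "set (s # map v ys) \<subseteq> H"
      using that in_H[of ys] by simp
    then show ?thesis
      using sprod_append[OF in_H[of xs], of "s # map v ys" th] by (simp add: qs m del: fun_upd_apply) (simp add: fun_upd_same)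
  qed
  then show ?thesis
    using sprod_in[OF in_H] by blast
qed

text \<open>Every match occurs once and in one component, so changing its value changes a single
  factor of a single tensorand.\<close>

lemma state_multilin:
  fixes qs :: "nat \<Rightarrow> 'q list"
  assumes phi: "multilinear_form A N m \<phi>"
    and qs: "\<And>i. i < m \<Longrightarrow> distinct (qs i)"
    and disj: "\<And>i j q. i < m \<Longrightarrow> j < m \<Longrightarrow> q \<in> set (qs i) \<Longrightarrow> q \<in> set (qs j) \<Longrightarrow> i = j"
    and Q: "Q = (\<Union>i<m. set (qs i))"
  shows "multilin Q (\<lambda>v. \<phi> (\<lambda>i\<in>{..<m}. coset (N i) (sprod (th i) (map v (qs i)))))"
  unfolding multilin_def
proof (intro conjI allI impI ballI)
  fix v w :: "'q \<Rightarrow> ('k, 'a) heis" assume "\<forall>q\<in>Q. v q = w q"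
  then have "map v (qs i) = map w (qs i)" if "i < m" for i
    using that Q by auto
  then show "\<phi> (\<lambda>i\<in>{..<m}. coset (N i) (sprod (th i) (map v (qs i)))) =
      \<phi> (\<lambda>i\<in>{..<m}. coset (N i) (sprod (th i) (map w (qs i))))"
    by (intro arg_cong[of _ _ \<phi>] restrict_ext) (simp cong: map_cong)
next
  fix v :: "'q \<Rightarrow> ('k, 'a) heis" and q assume v: "\<forall>q. v q \<in> H" and "q \<in> Q"
  then obtain i where i: "i < m" "q \<in> set (qs i)" using Q by auto
  obtain P R where PR: "P \<in> H" "R \<in> H"
    "\<And>s. s \<in> H \<Longrightarrow> sprod (th i) (map (v(q := s)) (qs i)) = smul (th i) P (smul (th i) s R)"
    using sprod_update[OF qs[OF i(1)] i(2), of v "th i"] v by blast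
  define x where "x = (\<lambda>i\<in>{..<m}. coset (N i) (sprod (th i) (map v (qs i))))"
  have x: "x \<in> (\<Pi>\<^sub>E j\<in>{..<m}. slot_space A (N j))"
    using v by (auto simp: x_def slot_space_def intro!: imageI sprod_in)
  have e: "(\<lambda>j\<in>{..<m}. coset (N j) (sprod (th j) (map (v(q := s)) (qs j))))
      = x(i := coset (N i) (smul (th i) P (smul (th i) s R)))" if s: "s \<in> H" for s
  proof
    fix j
    show "(\<lambda>j\<in>{..<m}. coset (N j) (sprod (th j) (map (v(q := s)) (qs j)))) j
        = (x(i := coset (N i) (smul (th i) P (smul (th i) s R)))) j"
    proof (cases "j = i")
      case True
      then show ?thesis using i(1) PR(3)[OF s] by simp
    next
      case False
      then have "j < m \<Longrightarrow> map (v(q := s)) (qs j) = map v (qs j)"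
        using disj[OF i(1), of j q] i(2) by auto
      then show ?thesis using False by (simp add: x_def restrict_def cong: map_cong)
    qed
  qed
  show "hlin (\<lambda>s. \<phi> (\<lambda>j\<in>{..<m}. coset (N j) (sprod (th j) (map (v(q := s)) (qs j)))))"
    unfolding hlin_def
    using phi[unfolded multilinear_form_def, rule_format, OF i(1) x]
    by (simp add: e heis_add heis_fscale smul_linear smul_in PR(1,2))
qed

lemma sprod_foldr: "set ls \<subseteq> H \<Longrightarrow> sprod th ls = foldr hm (if th then ls else rev ls) h1"
proof (cases th)
  case False
  have app: "foldr hm (us @ [s]) h1 = hm (foldr hm us h1) s" if "set us \<subseteq> H" "s \<in> H" for us s
    using that
  proof (induction us)
    case (Cons u us)
    have "foldr hm us h1 \<in> H"
      using Cons.prems by (induction us) (simp_all add: one_in hm_in)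
    then show ?case using Cons by (simp add: hm_assoc)
  qed (simp add: hm_one_left hm_one_right)
  assume "set ls \<subseteq> H"
  then show ?thesis
  proof (induction ls)
    case (Cons s ls)
    then show ?case using app[of "rev ls" s] False by (simp add: strand_mult_def)
  qed simp
next
  case True
  show ?thesis
    by (induction ls) (simp_all add: True strand_mult_def)
qed

definition flips :: "bool \<Rightarrow> dir \<Rightarrow> nat" where
  "flips th d = (if th then 0 else 1) + (if d = Up then 1 else 0)"

definition chain_value ::
  "diagram \<Rightarrow> (crossing \<Rightarrow> 'a) \<Rightarrow> (match \<Rightarrow> step list) \<Rightarrow> match \<Rightarrow> ('k, 'a) heis" where
  "chain_value Z \<sigma> f k = vprod (flips (thin Z ! fst (mstrand k)) (snd (mstrand k)))
     (map (passage_label A B Z \<sigma>) (List.map_filter (\<lambda>s. snd (snd s)) (f k)))"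

text \<open>A thin downward strand multiplies its labels from bottom to top. Reversing the
  orientation and passing to the opposite algebra each reverse this order, which is what
  \<open>flips\<close> counts.\<close>

lemma chain_value_eq:
  "word_product Z \<sigma> (thin Z ! fst (mstrand k)) (chain f k) = chain_value Z \<sigma> f k"
proof -
  let ?ps = "List.map_filter (\<lambda>s. snd (snd s)) (f k)"
  have "List.map_filter arc_passage (map (orient (mstrand k)) (f k)) = ?ps"
    by (simp add: map_filter_def o_def filter_map)
  then have "passages (chain f k) = (if snd (mstrand k) = Down then rev ?ps else ?ps)"
    by (simp add: passages_def chain_arcs_def map_filter_def rev_map[symmetric] rev_filter[symmetric])
  then show ?thesis
    using labels_in
    by (cases "thin Z ! fst (mstrand k)"; cases "snd (mstrand k)")
      (simp_all add: word_product_def chain_value_def sprod_foldr vprod_def flips_def rev_map)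
qed

lemma chain_value_in: "chain_value Z \<sigma> f k \<in> H"
  unfolding chain_value_eq[symmetric] by (rule word_product_in)

text \<open>The matches fix, for each component, an order of chains common to both diagrams. Hence
  one and the same \<open>G\<close> describes both state sums, and only the chain values
  differ.\<close>

theorem universal_invariant_transfer:
  assumes Z: "colored_diagram Z" and Z': "colored_diagram Z'"
    and th: "thin Z' = thin Z" and bd: "\<And>i. has_boundary Z' i = has_boundary Z i"
    and K: "mset (match_arcs left_steps K) = mset (arc_list Z)"
    and K': "mset (match_arcs right_steps K) = mset (arc_list Z')"
    and al: "\<And>k. k \<in> set K \<Longrightarrow> aligned \<rho> k"
    and alg: "\<And>G. multilin (set K) G \<Longrightarrow>
      (\<Sum>\<sigma>\<in>(\<Pi>\<^sub>E c\<in>crossings Z. B). G (chain_value Z \<sigma> left_steps)) =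
      (\<Sum>\<sigma>\<in>(\<Pi>\<^sub>E c\<in>crossings Z'. B). G (chain_value Z' \<sigma> right_steps))"
  shows "universal_invariant A B Z = universal_invariant A B Z'"
proof
  fix \<phi>
  let ?m = "length (thin Z)"
  have slots: "slot Z' = slot Z"
    by (auto simp: slot_def th bd fun_eq_iff)
  have eval: "universal_invariant A B Y \<phi> = (\<Sum>\<sigma>\<in>(\<Pi>\<^sub>E c\<in>crossings Y. B).
      if multilinear_form A (slot Y) (length (thin Y)) \<phi>
      then \<phi> (\<lambda>i\<in>{..<length (thin Y)}. coset (slot Y i) (component_product A B Y \<sigma> i)) else 0)" for Y
  proof -
    have "slot Y = (\<lambda>i. slot_kernel A (thin Y ! i) (has_boundary Y i))"
      by (rule ext) (simp add: slot_def)
    then show ?thesis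
      unfolding universal_invariant_def Let_def sum_fun_apply mpure_def by (simp only: cong: if_cong)
  qed
  show "universal_invariant A B Z \<phi> = universal_invariant A B Z' \<phi>"
  proof (cases "multilinear_form A (slot Z) ?m \<phi>")
    case True
    define P where "P i qs \<longleftrightarrow> distinct qs \<and> set qs = {k \<in> set K. fst (mstrand k) = i} \<and>
        traversal Z i (concat (map (chain left_steps) qs)) \<and>
        traversal Z' i (concat (map (chain right_steps) qs))" for i qs
    have "\<forall>i\<in>{..<?m}. \<exists>qs. P i qs"
      unfolding P_def by (intro ballI traversal_transfer[OF Z Z' K K' al]) simp_all
    then obtain qs where qs_P: "\<forall>i\<in>{..<?m}. P i (qs i)"
      by (rule bchoice[THEN exE])
    have qs: "distinct (qs i)" "set (qs i) = {k \<in> set K. fst (mstrand k) = i}"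
        "traversal Z i (concat (map (chain left_steps) (qs i)))"
        "traversal Z' i (concat (map (chain right_steps) (qs i)))" if "i < ?m" for i
      using bspec[OF qs_P, of i] that unfolding P_def by simp_all
    have comp: "fst (mstrand k) < ?m" if k: "k \<in> set K" for k
    proof -
      define s where "s = hd (left_steps k)"
      have "s \<in> set (left_steps k)"
        using al[OF k] unfolding s_def aligned_def by (intro hd_in_set) simp
      then have "orient (mstrand k) s \<in> set (match_arcs left_steps K)"
        unfolding set_match_arcs set_chain_arcs using k by blast
      then have "orient (mstrand k) s \<in> arcs Z"
        using mset_eq_setD[OF K] by (simp add: set_arc_list)
      then have "arc_comp (orient (mstrand k) s) < ?m"
        using Z unfolding colored_diagram_def by blast
      then show ?thesis by simp
    qed
    \<comment> \<open>The form \<open>\<phi>\<close> evaluated on the products in the common order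
      of chains; the orders are reversed since products are read against the orientation.\<close>
    define G where "G v = \<phi> (\<lambda>i\<in>{..<?m}. coset (slot Z i) (sprod (thin Z ! i) (map v (rev (qs i)))))"
      for v :: "match \<Rightarrow> ('k, 'a) heis"
    have G: "multilin (set K) G"
      unfolding G_def
    proof (rule state_multilin[OF True])
      show "set K = (\<Union>i<?m. set (rev (qs i)))"
        using qs(2) comp by auto
    qed (use qs(1,2) in auto)
    have comp_value: "coset (slot Z i) (component_product A B Y \<sigma> i)
        = coset (slot Z i) (sprod (thin Z ! i) (map (chain_value Y \<sigma> f) (rev (qs i))))"
      if i: "i < ?m" and Y: "colored_diagram Y" "thin Y = thin Z" "slot Y = slot Z"
        and t: "traversal Y i (concat (map (chain f) (qs i)))" for Y f i \<sigma>
    proof -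
      have "word_product Y \<sigma> (thin Y ! i) (chain f k) = chain_value Y \<sigma> f k" if "k \<in> set (qs i)" for k
        using chain_value_eq[of Y \<sigma> k f] qs(2)[OF i] that by simp
      then have "map (word_product Y \<sigma> (thin Y ! i)) (rev (map (chain f) (qs i)))
          = map (chain_value Y \<sigma> f) (rev (qs i))"
        by (simp add: rev_map)
      then show ?thesis
        using component_coset[OF Y(1) t, of \<sigma>] Y(2,3) by (simp add: word_product_concat)
    qed
    have "universal_invariant A B Z \<phi> = (\<Sum>\<sigma>\<in>(\<Pi>\<^sub>E c\<in>crossings Z. B). G (chain_value Z \<sigma> left_steps))"
      unfolding eval G_def if_P[OF True]
      by (intro sum.cong refl arg_cong[of _ _ \<phi>] restrict_ext comp_value Z qs(3)) simp_all
    also have "\<dots> = (\<Sum>\<sigma>\<in>(\<Pi>\<^sub>E c\<in>crossings Z'. B). G (chain_value Z' \<sigma> right_steps))"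
      by (rule alg[OF G])
    also have "\<dots> = universal_invariant A B Z' \<phi>"
      unfolding eval G_def slots th if_P[OF True]
      by (intro sum.cong refl arg_cong[of _ _ \<phi>] restrict_ext comp_value[symmetric] Z' qs(4) th slots) simp_all
    finally show ?thesis .
  next
    case False
    then show ?thesis
      unfolding eval slots th by simp
  qed
qed

end

section \<open>Local moves\<close>

definition enum_map :: "('x \<Rightarrow> nat \<Rightarrow> 'y) \<Rightarrow> nat \<Rightarrow> 'x list \<Rightarrow> 'y list" where
  "enum_map F t xs = map2 F xs [t..<t + length xs]"

lemma enum_map_simps [simp]: "enum_map F t [] = []" "enum_map F t (x # xs) = F x t # enum_map F (Suc t) xs"
  by (simp_all add: enum_map_def upt_conv_Cons del: upt_Suc)

lemma enum_map_shift: "enum_map F (t + u) xs = enum_map (\<lambda>x k. F x (k + u)) t xs"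
proof (induction xs arbitrary: t)
  case (Cons x xs)
  then show ?case using Cons[of "Suc t"] by simp
qed simp

lemma map_enum_map: "map f (enum_map F t xs) = enum_map (\<lambda>x k. f (F x k)) t xs"
  by (induction xs arbitrary: t) simp_all

lemma set_enum_map: "y \<in> set (enum_map F t xs) \<Longrightarrow> \<exists>x k. x \<in> set xs \<and> t \<le> k \<and> k < t + length xs \<and> y = F x k"
proof (induction xs arbitrary: t)
  case (Cons x xs)
  then have "y = F x t \<or> y \<in> set (enum_map F (Suc t) xs)" by simp
  then show ?case
  proof
    assume "y \<in> set (enum_map F (Suc t) xs)"
    from Cons.IH[OF this] obtain x' k where "x' \<in> set xs" "Suc t \<le> k" "k < Suc t + length xs" "y = F x' k"
      by blast
    then show ?case by (intro exI[of _ x'] exI[of _ k]) simp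
  qed (intro exI[of _ x] exI[of _ t], simp)
qed simp

lemma layer_steps_verts:
  "layer_steps r j (u + t) (d + t) (verts as) = enum_map (\<lambda>a k. (a, (r, u + k), (Suc r, d + k), None)) t as"
proof (induction as arbitrary: j t)
  case (Cons a as)
  then show ?case using Cons[of "Suc j" "Suc t"] by simp
qed simp

section \<open>Vertical translation of stacks, and the crossings they contain\<close>

abbreviation shift_point :: "nat \<Rightarrow> point \<Rightarrow> point" where
  "shift_point m p \<equiv> (fst p + m, snd p)"

definition shift_step :: "nat \<Rightarrow> step \<Rightarrow> step" where
  "shift_step m s = (shift_point m (fst s), shift_point m (fst (snd s)),
     map_option (map_prod (shift_point m) id) (snd (snd s)))"

lemma lift_step_eq: "lift_step r j u d s =
    ((r + fst (fst s), (if fst (fst s) = 0 then u else d) + snd (fst s)),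
     (r + fst (fst (snd s)), (if fst (fst (snd s)) = 0 then u else d) + snd (fst (snd s))),
     map_option (Pair (r, j)) (snd (snd s)))"
  by (cases s; cases "fst s"; cases "fst (snd s)") simp

lemma shift_lift: "lift_step (r + m) j u d s = shift_step m (lift_step r j u d s)"
  by (simp add: lift_step_eq shift_step_def option.map_comp o_def)

lemma shift_layer_steps: "layer_steps (r + m) j u d l = map (apsnd (shift_step m)) (layer_steps r j u d l)"
  by (induction l arbitrary: j u d) (simp_all add: shift_lift case_prod_unfold apsnd_def map_prod_def)

lemma shift_stack_steps: "stack_steps (r + m) k ls = map (apsnd (shift_step m)) (stack_steps r k ls)"
proof (induction ls arbitrary: r)
  case (Cons l ls)
  show ?case using Cons[of "Suc r"] by (simp add: shift_layer_steps)
qed simp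

lemma layer_steps_range:
  assumes "(a, p, q, x) \<in> set (layer_steps r j u d l)"
  shows "fst p \<in> {r, Suc r}" "fst q \<in> {r, Suc r}" "x = Some (c, \<rho>) \<Longrightarrow> fst c = r"
proof -
  obtain i s where e: "(p, q, x) = lift_step r (j + i) (u + length (uppers (take i l)))
       (d + length (lowers (take i l))) s" and s: "(a, s) \<in> set (piece_steps (l ! i))"
    using assms unfolding set_layer_steps by auto
  have "fst (fst s) \<in> {0, 1}" "fst (fst (snd s)) \<in> {0, 1}"
    using s by (cases "l ! i"; auto)+
  then show "fst p \<in> {r, Suc r}" "fst q \<in> {r, Suc r}"
    using e by (auto simp: lift_step_eq)
  show "fst c = r" if "x = Some (c, \<rho>)"
    using e that by (cases "snd (snd s)") (auto simp: lift_step_eq)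
qed

lemma stack_steps_range:
  assumes "(a, p, q, x) \<in> set (stack_steps r k ls)"
  shows "r \<le> fst p \<and> fst p \<le> r + length ls" "r \<le> fst q \<and> fst q \<le> r + length ls"
    "x = Some (c, \<rho>) \<Longrightarrow> r \<le> fst c \<and> fst c < r + length ls"
proof -
  obtain i where i: "i < length ls" "(a, p, q, x) \<in> set (layer_steps (r + i) k k k (ls ! i))"
    using assms unfolding set_stack_steps by auto
  from layer_steps_range[OF i(2)] i(1)
  show "r \<le> fst p \<and> fst p \<le> r + length ls" "r \<le> fst q \<and> fst q \<le> r + length ls"
    "x = Some (c, \<rho>) \<Longrightarrow> r \<le> fst c \<and> fst c < r + length ls"
    by auto
qed

definition step_crossings :: "(strand \<times> step) list \<Rightarrow> crossing set" where
  "step_crossings S = {c. \<exists>y\<in>set S. \<exists>\<rho>. snd (snd (snd y)) = Some (c, \<rho>)}"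

lemma step_crossings_append: "step_crossings (S @ S') = step_crossings S \<union> step_crossings S'"
  by (auto simp: step_crossings_def)

lemma step_crossings_simps [simp]: "step_crossings [] = {}"
  "step_crossings ((a, p, q, None) # S) = step_crossings S"
  "step_crossings ((a, p, q, Some (c, \<rho>)) # S) = insert c (step_crossings S)"
  by (auto simp: step_crossings_def)

definition real_crossing :: "piece \<Rightarrow> bool" where
  "real_crossing p \<longleftrightarrow> (\<exists>x a b. p = Crossing x a b \<and> x \<noteq> Virtual)"

lemma layer_crossings: "c \<in> step_crossings (layer_steps r j u d l) \<longleftrightarrow>
    (\<exists>i<length l. c = (r, j + i) \<and> real_crossing (l ! i))"
proof (induction l arbitrary: j u d)
  case (Cons p l)
  have "step_crossings (map (\<lambda>(a, s). (a, lift_step r j u d s)) (piece_steps p))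
      = (if real_crossing p then {(r, j)} else {})"
  proof (cases p)
    case (Crossing x a b)
    then show ?thesis by (cases x) (simp_all add: real_crossing_def)
  qed (simp_all add: real_crossing_def)
  then show ?case
    by (auto simp: step_crossings_append Cons Ex_less_Suc2)
qed simp

lemma stack_crossings: "c \<in> step_crossings (stack_steps r k ls) \<longleftrightarrow>
    (\<exists>i<length ls. \<exists>j<length (ls ! i). c = (r + i, k + j) \<and> real_crossing (ls ! i ! j))"
  by (induction ls arbitrary: r) (auto simp: step_crossings_append layer_crossings Ex_less_Suc2)

lemma crossings_eq: "crossings Z = step_crossings (stack_steps 0 0 (layers Z))"
  unfolding set_eq_iff stack_crossings crossings_def real_crossing_def by auto

text \<open>A vertical strand to the right of a block is displaced, from line to line, by the number
  of ends of the block. With empty layers and \<open>b = 0\<close> the same function describes the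
  strands on the left.\<close>

fun column :: "nat \<Rightarrow> nat \<Rightarrow> layer list \<Rightarrow> nat \<Rightarrow> step list" where
  "column r b [] t = []"
| "column r b (w # W) t =
     ((r, b + length (uppers w) + t), (Suc r, b + length (lowers w) + t), None) # column (Suc r) b W t"

fun side_steps :: "nat \<Rightarrow> nat \<Rightarrow> strand list \<Rightarrow> layer list \<Rightarrow> (strand \<times> step) list" where
  "side_steps r b as [] = []"
| "side_steps r b as (w # W) =
     layer_steps r 0 (b + length (uppers w)) (b + length (lowers w)) (verts as) @ side_steps (Suc r) b as W"

lemma layer_steps_verts_index: "layer_steps r j u d (verts as) = layer_steps r 0 u d (verts as)"
  using layer_steps_verts[of r j u 0 d as] layer_steps_verts[of r 0 u 0 d as] by simp

lemma mset_concat_enum_map_Cons: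
  "mset (concat (enum_map (\<lambda>a t. x a t # ys a t) u as)) = mset (enum_map x u as) + mset (concat (enum_map ys u as))"
  by (induction as arbitrary: u) (simp_all add: ac_simps)

lemma mset_columns:
  "mset (concat (enum_map (\<lambda>a t. map (orient a) (column r b W t)) 0 as)) = mset (oriented (side_steps r b as W))"
proof (induction W arbitrary: r)
  case Nil
  have "concat (enum_map (\<lambda>a t. []) u as) = []" for u
    by (induction as arbitrary: u) simp_all
  then show ?case by simp
next
  case (Cons w W)
  have "oriented (layer_steps r 0 (b + length (uppers w)) (b + length (lowers w)) (verts as))
      = enum_map (\<lambda>a t. orient a ((r, b + length (uppers w) + t), (Suc r, b + length (lowers w) + t), None)) 0 as"
    using layer_steps_verts[of r 0 "b + length (uppers w)" 0 "b + length (lowers w)" as]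
    by (simp add: map_enum_map)
  then show ?case
    using Cons[of "Suc r"] by (simp add: mset_concat_enum_map_Cons)
qed

abbreviation frame :: "strand list \<Rightarrow> strand list \<Rightarrow> layer \<Rightarrow> layer" where
  "frame L R w \<equiv> verts L @ w @ verts R"

lemma mset_framed:
  "mset (oriented (stack_steps r 0 (map (frame L R) W))) =
    mset (oriented (side_steps r 0 L (map (\<lambda>_. []) W))) + mset (oriented (stack_steps r (length L) W)) +
    mset (oriented (side_steps r (length L) R W))"
proof (induction W arbitrary: r)
  case (Cons w W)
  then show ?case
    by (simp add: layer_steps_append layer_steps_verts_index[of r "length L + length w"] add.assoc
        del: layer_steps.simps)
qed simp

lemma column_linked: "composable W \<Longrightarrow> linked step_source step_target (column r b W t)"
proof (induction W arbitrary: r)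
  case (Cons w W)
  then show ?case by (cases W) auto
qed simp

lemma column_ends:
  assumes "W \<noteq> []"
  shows "column r b W t \<noteq> []" "step_source (hd (column r b W t)) = (r, b + length (uppers (hd W)) + t)"
    "step_target (last (column r b W t)) = (r + length W, b + length (lowers (last W)) + t)"
proof -
  show "column r b W t \<noteq> []" "step_source (hd (column r b W t)) = (r, b + length (uppers (hd W)) + t)"
    using assms by (cases W; simp)+
  show "step_target (last (column r b W t)) = (r + length W, b + length (lowers (last W)) + t)"
    using assms
  proof (induction W arbitrary: r)
    case (Cons w W)
    then show ?case using Cons.IH[of "Suc r"] by (cases W) auto
  qed simp
qed

lemma column_passages: "List.map_filter (\<lambda>s. snd (snd s)) (column r b W t) = []"
  by (induction W arbitrary: r) (simp_all add: map_filter_def)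

definition columns :: "nat \<Rightarrow> nat \<Rightarrow> layer list \<Rightarrow> layer list \<Rightarrow> strand list \<Rightarrow> match list" where
  "columns h b W W' as = enum_map (\<lambda>a t. (a, column h b W t, column h b W' t)) 0 as"

lemma match_arcs_append: "match_arcs f (K @ K') = match_arcs f K @ match_arcs f K'"
  by (simp add: match_arcs_def)

lemma mset_match_columns:
  "mset (match_arcs left_steps (columns h b W W' as)) = mset (oriented (side_steps h b as W))"
  "mset (match_arcs right_steps (columns h b W W' as)) = mset (oriented (side_steps h b as W'))"
  unfolding mset_columns[symmetric] match_arcs_def columns_def by (simp_all add: map_enum_map)

text \<open>The points of two diagrams which differ in \<open>n\<close> and \<open>n'\<close> layers, respectively, below the first \<open>h\<close>.\<close>

definition relevel :: "nat \<Rightarrow> nat \<Rightarrow> nat \<Rightarrow> point \<Rightarrow> point" where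
  "relevel h n n' p = (if fst p \<le> h then p else (fst p + n' - n, snd p))"

lemma columns_aligned:
  assumes "W \<noteq> []" "W' \<noteq> []" "composable W" "composable W'"
    and "length (uppers (hd W)) = length (uppers (hd W'))" "length (lowers (last W)) = length (lowers (last W'))"
    and "k \<in> set (columns h b W W' as)"
  shows "aligned (relevel h (length W) (length W')) k" "List.map_filter (\<lambda>s. snd (snd s)) (left_steps k) = []"
    "List.map_filter (\<lambda>s. snd (snd s)) (right_steps k) = []"
proof -
  obtain a t where "k = (a, column h b W t, column h b W' t)"
    using set_enum_map[OF assms(7)[unfolded columns_def]] by blast
  moreover have "0 < length W" "0 < length W'" using assms by auto
  ultimately show "aligned (relevel h (length W) (length W')) k" "List.map_filter (\<lambda>s. snd (snd s)) (left_steps k) = []"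
    "List.map_filter (\<lambda>s. snd (snd s)) (right_steps k) = []"
    using assms by (auto simp: aligned_def column_linked column_ends column_passages relevel_def)
qed

lemma composable_append: "xs \<noteq> [] \<Longrightarrow> ys \<noteq> [] \<Longrightarrow>
    composable (xs @ ys) \<longleftrightarrow> composable xs \<and> composable ys \<and> lowers (last xs) = uppers (hd ys)"
proof (induction xs)
  case (Cons x xs)
  then show ?case by (cases xs; cases ys) auto
qed simp

lemma composable_block: "composable (ls @ W @ ls') \<Longrightarrow> composable W"
  by (cases "ls = []"; cases "W = []"; cases "ls' = []") (auto simp: composable_append)

lemma composable_frame: "composable (map (frame L R) W) \<longleftrightarrow> composable W"
proof (induction W)
  case (Cons w W)
  then show ?case by (cases W) auto
qed simp

section \<open>Sums over states\<close>

lemma sum_states_split: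
  assumes "finite E" "finite X" "E \<inter> X = {}"
  shows "(\<Sum>\<sigma>\<in>(\<Pi>\<^sub>E c\<in>E \<union> X. B). F \<sigma>) =
    (\<Sum>\<sigma>\<in>(\<Pi>\<^sub>E c\<in>E. B). \<Sum>\<tau>\<in>(\<Pi>\<^sub>E c\<in>X. B). F (\<lambda>c. if c \<in> X then \<tau> c else \<sigma> c))"
  unfolding sum.cartesian_product
proof (rule sum.reindex_bij_witness[where
      i = "\<lambda>(\<sigma>, \<tau>) c. if c \<in> X then \<tau> c else \<sigma> c" and j = "\<lambda>\<sigma>. (restrict \<sigma> E, restrict \<sigma> X)"])
  fix \<sigma> assume \<sigma>: "\<sigma> \<in> (\<Pi>\<^sub>E c\<in>E \<union> X. B)"
  show e: "(case (restrict \<sigma> E, restrict \<sigma> X) of (\<sigma>, \<tau>) \<Rightarrow> \<lambda>c. if c \<in> X then \<tau> c else \<sigma> c) = \<sigma>"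
    using \<sigma> by (auto simp: fun_eq_iff restrict_def PiE_def extensional_def)
  show "(restrict \<sigma> E, restrict \<sigma> X) \<in> (\<Pi>\<^sub>E c\<in>E. B) \<times> (\<Pi>\<^sub>E c\<in>X. B)"
    using \<sigma> by (auto simp: PiE_iff)
  show "(case (restrict \<sigma> E, restrict \<sigma> X) of (\<sigma>, \<tau>) \<Rightarrow> F (\<lambda>c. if c \<in> X then \<tau> c else \<sigma> c)) = F \<sigma>"
    using e by simp
next
  fix p assume "p \<in> (\<Pi>\<^sub>E c\<in>E. B) \<times> (\<Pi>\<^sub>E c\<in>X. B)"
  then obtain \<sigma> \<tau> where p: "p = (\<sigma>, \<tau>)" "\<sigma> \<in> (\<Pi>\<^sub>E c\<in>E. B)" "\<tau> \<in> (\<Pi>\<^sub>E c\<in>X. B)" by auto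
  show "(\<lambda>\<sigma>. (restrict \<sigma> E, restrict \<sigma> X)) (case p of (\<sigma>, \<tau>) \<Rightarrow> \<lambda>c. if c \<in> X then \<tau> c else \<sigma> c) = p"
    using p assms(3) by (auto simp: fun_eq_iff restrict_def PiE_def extensional_def)
  show "(case p of (\<sigma>, \<tau>) \<Rightarrow> \<lambda>c. if c \<in> X then \<tau> c else \<sigma> c) \<in> (\<Pi>\<^sub>E c\<in>E \<union> X. B)"
    using p by (auto simp: PiE_iff extensional_def)
qed

lemma sum_states_reindex:
  assumes "bij_betw \<kappa> E' E"
  shows "(\<Sum>\<sigma>\<in>(\<Pi>\<^sub>E c\<in>E'. B). F \<sigma>) = (\<Sum>\<sigma>\<in>(\<Pi>\<^sub>E c\<in>E. B). F (restrict (\<lambda>c. \<sigma> (\<kappa> c)) E'))"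
proof (rule sum.reindex_bij_witness[where
      i = "\<lambda>\<sigma>. restrict (\<lambda>c. \<sigma> (\<kappa> c)) E'" and j = "\<lambda>\<sigma>. restrict (\<lambda>c. \<sigma> (inv_into E' \<kappa> c)) E"])
  have inv: "c \<in> E' \<Longrightarrow> \<kappa> c \<in> E \<and> inv_into E' \<kappa> (\<kappa> c) = c"
    "e \<in> E \<Longrightarrow> inv_into E' \<kappa> e \<in> E' \<and> \<kappa> (inv_into E' \<kappa> e) = e" for c e
    using assms by (auto simp: bij_betw_def f_inv_into_f inv_into_into)
  fix \<sigma> assume \<sigma>: "\<sigma> \<in> (\<Pi>\<^sub>E c\<in>E'. B)"
  show e: "restrict (\<lambda>c. restrict (\<lambda>c. \<sigma> (inv_into E' \<kappa> c)) E (\<kappa> c)) E' = \<sigma>"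
  proof
    fix c show "restrict (\<lambda>c. restrict (\<lambda>c. \<sigma> (inv_into E' \<kappa> c)) E (\<kappa> c)) E' c = \<sigma> c"
      using \<sigma> inv(1)[of c] by (cases "c \<in> E'") (auto simp: PiE_iff extensional_def)
  qed
  show "restrict (\<lambda>c. \<sigma> (inv_into E' \<kappa> c)) E \<in> (\<Pi>\<^sub>E c\<in>E. B)"
    using \<sigma> inv(2) by (auto simp: PiE_iff)
  show "F (restrict (\<lambda>c. restrict (\<lambda>c. \<sigma> (inv_into E' \<kappa> c)) E (\<kappa> c)) E') = F \<sigma>"
    unfolding e ..
next
  have inv: "c \<in> E' \<Longrightarrow> \<kappa> c \<in> E \<and> inv_into E' \<kappa> (\<kappa> c) = c"
    "e \<in> E \<Longrightarrow> inv_into E' \<kappa> e \<in> E' \<and> \<kappa> (inv_into E' \<kappa> e) = e" for c e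
    using assms by (auto simp: bij_betw_def f_inv_into_f inv_into_into)
  fix \<sigma> assume \<sigma>: "\<sigma> \<in> (\<Pi>\<^sub>E c\<in>E. B)"
  show "restrict (\<lambda>c. restrict (\<lambda>c. \<sigma> (\<kappa> c)) E' (inv_into E' \<kappa> c)) E = \<sigma>"
  proof
    fix c show "restrict (\<lambda>c. restrict (\<lambda>c. \<sigma> (\<kappa> c)) E' (inv_into E' \<kappa> c)) E c = \<sigma> c"
      using \<sigma> inv(2)[of c] by (cases "c \<in> E") (auto simp: PiE_iff extensional_def)
  qed
  show "restrict (\<lambda>c. \<sigma> (\<kappa> c)) E' \<in> (\<Pi>\<^sub>E c\<in>E'. B)"
    using \<sigma> inv(1) by (auto simp: PiE_iff)
qed

lemma finite_step_crossings: "finite (step_crossings S)"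
  by (rule finite_subset[of _ "(\<lambda>y. fst (the (snd (snd (snd y))))) ` set S"])
    (force simp: step_crossings_def)+

text \<open>The comparison with \<open>h\<close> is strict here and weak in \<open>relevel\<close>:
  layer \<open>h\<close> is the first one of the block, while line \<open>h\<close> is its upper
  boundary and stays in place.\<close>

definition relayer :: "nat \<Rightarrow> nat \<Rightarrow> nat \<Rightarrow> crossing \<Rightarrow> crossing" where
  "relayer h n n' c = (if fst c < h then c else (fst c + n' - n, snd c))"

abbreviation step_passages :: "step list \<Rightarrow> (crossing \<times> role) list" where
  "step_passages ss \<equiv> List.map_filter (\<lambda>s. snd (snd s)) ss"

lemma set_step_passages: "p \<in> set (step_passages ss) \<longleftrightarrow> (\<exists>s\<in>set ss. snd (snd s) = Some p)"
  by (induction ss) (auto simp: map_filter_simps split: option.splits)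

lemma match_passages:
  assumes m: "mset (match_arcs f K) = mset (oriented S)" and k: "k \<in> set K"
  shows "fst ` set (step_passages (f k)) \<subseteq> step_crossings S"
proof
  fix c assume "c \<in> fst ` set (step_passages (f k))"
  then obtain s \<rho> where s: "s \<in> set (f k)" "snd (snd s) = Some (c, \<rho>)"
    by (auto simp: set_step_passages simp del: split_paired_Ex)
  then have "orient (mstrand k) s \<in> set (match_arcs f K)"
    using k unfolding match_arcs_def by auto
  then obtain y where y: "y \<in> set S" "orient (mstrand k) s = orient (fst y) (snd y)"
    using mset_eq_setD[OF m] by (auto simp: case_prod_unfold)
  then have "snd (snd (snd y)) = Some (c, \<rho>)"
    using s(2) passage_orient[of "mstrand k" s] passage_orient[of "fst y" "snd y"] by simp
  then show "c \<in> step_crossings S"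
    unfolding step_crossings_def using y(1) by blast
qed

text \<open>Each step outside the block is a chain of its own; below the block, both diagrams
  contain translates of the same stack.\<close>

definition exterior_matches :: "nat \<Rightarrow> nat \<Rightarrow> nat \<Rightarrow> layer list \<Rightarrow> layer list \<Rightarrow> match list" where
  "exterior_matches h n n' ls ls' =
     map (\<lambda>(a, s). (a, [s], [s])) (stack_steps 0 0 ls) @
     map (\<lambda>(a, s). (a, [shift_step (h + n) s], [shift_step (h + n') s])) (stack_steps 0 0 ls')"

lemma match_arcs_exterior:
  "match_arcs left_steps (exterior_matches h n n' ls ls') = oriented (stack_steps 0 0 ls @ stack_steps (h + n) 0 ls')"
  "match_arcs right_steps (exterior_matches h n n' ls ls') = oriented (stack_steps 0 0 ls @ stack_steps (h + n') 0 ls')"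
proof -
  have e: "stack_steps m 0 ls' = map (apsnd (shift_step m)) (stack_steps 0 0 ls')" for m
    using shift_stack_steps[of 0 m 0 ls'] by simp
  show "match_arcs left_steps (exterior_matches h n n' ls ls') = oriented (stack_steps 0 0 ls @ stack_steps (h + n) 0 ls')"
    "match_arcs right_steps (exterior_matches h n n' ls ls') = oriented (stack_steps 0 0 ls @ stack_steps (h + n') 0 ls')"
    unfolding e[of "h + n"] e[of "h + n'"]
    by (simp_all add: match_arcs_def exterior_matches_def o_def case_prod_unfold concat_map_singleton)
qed

lemma exterior_aligned:
  assumes "n > 0" "k \<in> set (exterior_matches (length ls) n n' ls ls')"
  shows "aligned (relevel (length ls) n n') k"
  using assms(2) unfolding exterior_matches_def set_append
proof
  assume "k \<in> set (map (\<lambda>(a, s). (a, [s], [s])) (stack_steps 0 0 ls))"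
  then obtain a p q x where "(a, p, q, x) \<in> set (stack_steps 0 0 ls)" "k = (a, [(p, q, x)], [(p, q, x)])" by auto
  then show ?thesis
    using stack_steps_range(1,2)[of a p q x 0 0 ls] by (simp add: aligned_def relevel_def)
next
  let ?h = "length ls"
  assume "k \<in> set (map (\<lambda>(a, s). (a, [shift_step (?h + n) s], [shift_step (?h + n') s])) (stack_steps 0 0 ls'))"
  then obtain a s where "k = (a, [shift_step (?h + n) s], [shift_step (?h + n') s])" by auto
  then show ?thesis
    using assms(1) by (auto simp: aligned_def relevel_def shift_step_def)
qed

lemma exterior_passages:
  assumes "k \<in> set (exterior_matches (length ls) n n' ls ls')"
  shows "\<exists>ps. step_passages (left_steps k) = ps \<and>
    step_passages (right_steps k) = map (map_prod (relayer (length ls) n n') id) ps \<and>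
    fst ` set ps \<subseteq> step_crossings (stack_steps 0 0 ls) \<union> step_crossings (stack_steps (length ls + n) 0 ls')"
  using assms unfolding exterior_matches_def set_append
proof
  assume "k \<in> set (map (\<lambda>(a, s). (a, [s], [s])) (stack_steps 0 0 ls))"
  then obtain a p q x where k: "(a, p, q, x) \<in> set (stack_steps 0 0 ls)" "k = (a, [(p, q, x)], [(p, q, x)])" by auto
  show ?thesis
  proof (cases x)
    case None
    then show ?thesis using k by (simp add: map_filter_def)
  next
    case (Some y)
    obtain c \<rho> where y: "y = (c, \<rho>)" by (cases y)
    then have "fst c < length ls" "c \<in> step_crossings (stack_steps 0 0 ls)"
      using stack_steps_range(3)[OF k(1), of c \<rho>] Some k(1) by (auto simp: step_crossings_def intro!: bexI[OF _ k(1)])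
    then show ?thesis using k Some y by (simp add: map_filter_def relayer_def)
  qed
next
  let ?h = "length ls"
  assume "k \<in> set (map (\<lambda>(a, s). (a, [shift_step (?h + n) s], [shift_step (?h + n') s])) (stack_steps 0 0 ls'))"
  then obtain a p q x where k: "(a, p, q, x) \<in> set (stack_steps 0 0 ls')"
    "k = (a, [shift_step (?h + n) (p, q, x)], [shift_step (?h + n') (p, q, x)])" by auto
  show ?thesis
  proof (cases x)
    case None
    then show ?thesis using k by (simp add: map_filter_def shift_step_def)
  next
    case (Some y)
    obtain c \<rho> where y: "y = (c, \<rho>)" by (cases y)
    have "(a, shift_step (?h + n) (p, q, x)) \<in> set (stack_steps (?h + n) 0 ls')"
      using k(1) shift_stack_steps[of 0 "?h + n" 0 ls'] by force
    then have "shift_point (?h + n) c \<in> step_crossings (stack_steps (?h + n) 0 ls')"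
      unfolding step_crossings_def using Some y
      by (auto simp: shift_step_def intro!: bexI[of _ "(a, shift_step (?h + n) (p, q, x))"])
    then show ?thesis using k Some y by (simp add: map_filter_def shift_step_def relayer_def add.commute add.left_commute)
  qed
qed

context finite_hopf
begin

lemma passage_label_cong:
  assumes "thin Z = thin Z'" "layers Z ! fst c ! snd c = layers Z' ! fst c' ! snd c'" "\<sigma> c = \<sigma>' c'"
  shows "passage_label A B Z \<sigma> (c, \<rho>) = passage_label A B Z' \<sigma>' (c', \<rho>)"
  using assms by (cases \<rho>) (simp_all add: under_label_def over_label_def strand_of_def xtype_of_def)

lemma chain_value_cong:
  assumes "thin Z = thin Z'"
    and "map (passage_label A B Z \<sigma>) (step_passages (f k)) = map (passage_label A B Z' \<sigma>') (step_passages (f' k))"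
  shows "chain_value Z \<sigma> f k = chain_value Z' \<sigma>' f' k"
  using assms by (simp add: chain_value_def)

definition local_identity ::
  "diagram \<Rightarrow> crossing set \<Rightarrow> diagram \<Rightarrow> crossing set \<Rightarrow> match list \<Rightarrow> bool" where
  "local_identity Z X Z' X' K \<longleftrightarrow> (\<forall>G. multilin (set K) G \<longrightarrow>
     (\<Sum>\<sigma>\<in>(\<Pi>\<^sub>E c\<in>X. B). G (chain_value Z \<sigma> left_steps)) =
     (\<Sum>\<sigma>\<in>(\<Pi>\<^sub>E c\<in>X'. B). G (chain_value Z' \<sigma> right_steps)))"

text \<open>The exterior steps and the vertical strands beside the block are matched once and for
  all, so a particular move only has to provide the matches of its pattern. A state splits into an
  exterior and a local part; for a fixed exterior part the exterior chain values are constants, and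
  the local identity applies to what remains of \<open>G\<close>.\<close>

theorem local_move:
  assumes Z: "colored_diagram Z" and Z': "colored_diagram Z'" and th: "thin Z' = thin Z"
    and lay: "layers Z = ls @ map (frame L R) W @ ls'" "layers Z' = ls @ map (frame L R) W' @ ls'"
    and ne: "W \<noteq> []" "W' \<noteq> []"
    and up: "uppers (hd W) = uppers (hd W')" and lo: "lowers (last W) = lowers (last W')"
    and K: "mset (match_arcs left_steps K) = mset (oriented (stack_steps (length ls) (length L) W))"
    and K': "mset (match_arcs right_steps K) = mset (oriented (stack_steps (length ls) (length L) W'))"
    and al: "\<And>k. k \<in> set K \<Longrightarrow> aligned (relevel (length ls) (length W) (length W')) k"
    and id: "local_identity Z (step_crossings (stack_steps (length ls) (length L) W))
      Z' (step_crossings (stack_steps (length ls) (length L) W')) K"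
  shows "universal_invariant A B Z = universal_invariant A B Z'"
proof -
  let ?h = "length ls" and ?n = "length W" and ?n' = "length W'" and ?b = "length L"
  let ?ext = "exterior_matches ?h ?n ?n' ls ls'"
  let ?cols = "columns ?h 0 (map (\<lambda>_. []) W) (map (\<lambda>_. []) W') L @ columns ?h ?b W W' R"
  let ?K = "?ext @ ?cols @ K"
  let ?\<kappa> = "relayer ?h ?n ?n'"
  define E where "E = step_crossings (stack_steps 0 0 ls) \<union> step_crossings (stack_steps (?h + ?n) 0 ls')"
  define E' where "E' = step_crossings (stack_steps 0 0 ls) \<union> step_crossings (stack_steps (?h + ?n') 0 ls')"
  define X where "X = step_crossings (stack_steps ?h ?b W)"
  define X' where "X' = step_crossings (stack_steps ?h ?b W')"
  have pos: "?n > 0" "?n' > 0" using ne by auto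
  have comp: "composable W" "composable W'"
    using Z Z' composable_block[of ls "map (frame L R) W" ls'] composable_block[of ls "map (frame L R) W'" ls']
    by (simp_all add: colored_diagram_def lay composable_frame)
  have all: "mset (arc_list Y) = mset (oriented (stack_steps 0 0 ls @ stack_steps (?h + length V) 0 ls')) +
      mset (oriented (side_steps ?h 0 L (map (\<lambda>_. []) V))) + mset (oriented (side_steps ?h ?b R V)) +
      mset (oriented (stack_steps ?h ?b V))"
    if "layers Y = ls @ map (frame L R) V @ ls'" for Y V
    unfolding arc_list_def that
    by (simp only: stack_steps_append map_append mset_append mset_framed length_map add_0 ac_simps)
  have cross: "crossings Y = step_crossings (stack_steps 0 0 ls) \<union> step_crossings (stack_steps (?h + length V) 0 ls') \<union>
      step_crossings (stack_steps ?h ?b V)"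
    if "layers Y = ls @ map (frame L R) V @ ls'" for Y V
  proof -
    \<comment> \<open>Framing strands are not crossings, and those on the left shift the piece
      indices by \<open>?b\<close>, which is also the offset of the unframed stack.\<close>
    have "c \<in> step_crossings (stack_steps r 0 (map (frame L R) V)) \<longleftrightarrow> c \<in> step_crossings (stack_steps r ?b V)" for c r
    proof -
      have v: "\<not> real_crossing (verts as ! j)" if "j < length as" for as j
        using that by (simp add: real_crossing_def)
      have q: "(\<exists>j<length (frame L R w). c = (i, 0 + j) \<and> real_crossing (frame L R w ! j)) \<longleftrightarrow>
          (\<exists>j<length w. c = (i, ?b + j) \<and> real_crossing (w ! j))" for w i
      proof
        assume "\<exists>j<length (frame L R w). c = (i, 0 + j) \<and> real_crossing (frame L R w ! j)"
        then obtain j where j: "j < length (frame L R w)" "c = (i, j)" "real_crossing (frame L R w ! j)" by auto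
        from j(1,3) have "?b \<le> j" "j - ?b < length w"
          using v[of j L] v[of "j - ?b - length w" R] by (auto simp: nth_append split: if_splits)
        then show "\<exists>j<length w. c = (i, ?b + j) \<and> real_crossing (w ! j)"
          using j by (intro exI[of _ "j - ?b"]) (simp add: nth_append)
      next
        assume "\<exists>j<length w. c = (i, ?b + j) \<and> real_crossing (w ! j)"
        then obtain j where "j < length w" "c = (i, ?b + j)" "real_crossing (w ! j)" by auto
        then show "\<exists>j<length (frame L R w). c = (i, 0 + j) \<and> real_crossing (frame L R w ! j)"
          by (intro exI[of _ "?b + j"]) (simp add: nth_append)
      qed
      have e: "(\<exists>j<length (map (frame L R) V ! i). c = (r + i, 0 + j) \<and> real_crossing (map (frame L R) V ! i ! j)) \<longleftrightarrow>
          (\<exists>j<length (V ! i). c = (r + i, ?b + j) \<and> real_crossing (V ! i ! j))" if "i < length V" for i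
        using q[of "V ! i" "r + i"] that by simp
      show ?thesis
        unfolding stack_crossings length_map by (rule ex_cong1, rule conj_cong[OF refl], rule e)
    qed
    then show ?thesis
      unfolding crossings_eq that by (auto simp: stack_steps_append step_crossings_append)
  qed
  have rows: "c \<in> step_crossings (stack_steps r k V) \<Longrightarrow> r \<le> fst c \<and> fst c < r + length V" for c r k V
    by (auto simp: stack_crossings)
  have XE: "E \<inter> X = {}" "E' \<inter> X' = {}"
    unfolding E_def E'_def X_def X'_def by (auto dest!: rows)
  have fin: "finite E" "finite X" "finite E'" "finite X'"
    unfolding E_def E'_def X_def X'_def by (simp_all add: finite_step_crossings)
  have ext_cases: "(fst c < ?h \<and> c \<in> step_crossings (stack_steps 0 0 ls)) \<or>
      (\<exists>i j. i < length ls' \<and> j < length (ls' ! i) \<and> real_crossing (ls' ! i ! j) \<and> c = (?h + m + i, j))"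
    if "c \<in> step_crossings (stack_steps 0 0 ls) \<union> step_crossings (stack_steps (?h + m) 0 ls')" for c m
    using that
  proof
    assume "c \<in> step_crossings (stack_steps 0 0 ls)"
    then show ?thesis using rows[of c 0 0 ls] by simp
  next
    assume "c \<in> step_crossings (stack_steps (?h + m) 0 ls')"
    then show ?thesis unfolding stack_crossings[of c "?h + m"] by auto
  qed
  have ext_map: "relayer ?h m m' c \<in> step_crossings (stack_steps 0 0 ls) \<union> step_crossings (stack_steps (?h + m') 0 ls') \<and>
      relayer ?h m' m (relayer ?h m m' c) = c"
    if "c \<in> step_crossings (stack_steps 0 0 ls) \<union> step_crossings (stack_steps (?h + m) 0 ls')" for c m m'
    using ext_cases[OF that]
  proof
    assume "\<exists>i j. i < length ls' \<and> j < length (ls' ! i) \<and> real_crossing (ls' ! i ! j) \<and> c = (?h + m + i, j)"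
    then obtain i j where ij: "i < length ls'" "j < length (ls' ! i)" "real_crossing (ls' ! i ! j)" "c = (?h + m + i, j)"
      by blast
    then have "(?h + m' + i, j) \<in> step_crossings (stack_steps (?h + m') 0 ls')"
      unfolding stack_crossings by auto
    moreover have "relayer ?h m m' c = (?h + m' + i, j)" "relayer ?h m' m (?h + m' + i, j) = c"
      by (simp_all add: relayer_def ij(4))
    ultimately show ?thesis by simp
  qed (simp add: relayer_def)
  have to_E': "?\<kappa> c \<in> E'" "relayer ?h ?n' ?n (?\<kappa> c) = c" if "c \<in> E" for c
    using ext_map[OF that[unfolded E_def], of ?n'] unfolding E'_def by simp_all
  have to_E: "relayer ?h ?n' ?n c \<in> E" "?\<kappa> (relayer ?h ?n' ?n c) = c" if "c \<in> E'" for c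
    using ext_map[OF that[unfolded E'_def], of ?n] unfolding E_def by simp_all
  have lay_ext: "layers Z ! fst c ! snd c = layers Z' ! fst (?\<kappa> c) ! snd (?\<kappa> c)" if "c \<in> E" for c
    using ext_cases[OF that[unfolded E_def]] by (auto simp: relayer_def lay nth_append)
  show ?thesis
  proof (rule universal_invariant_transfer[OF Z Z' th])
    \<comment> \<open>If \<open>ls\<close> or \<open>ls'\<close> is empty, the block itself touches
      the boundary of the square; its outer ends are the same on both sides.\<close>
    show "has_boundary Z' i = has_boundary Z i" for i
      unfolding has_boundary_def lay
      by (cases "ls = []"; cases "ls' = []") (simp_all add: ne up lo hd_map last_map)
    show "mset (match_arcs left_steps ?K) = mset (arc_list Z)"
      unfolding all[OF lay(1)]
      by (simp only: match_arcs_append match_arcs_exterior mset_append mset_match_columns K add.assoc)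
    show "mset (match_arcs right_steps ?K) = mset (arc_list Z')"
      unfolding all[OF lay(2)]
      by (simp only: match_arcs_append match_arcs_exterior mset_append mset_match_columns K' add.assoc)
    have colL: "aligned (relevel ?h ?n ?n') k" "step_passages (left_steps k) = []" "step_passages (right_steps k) = []"
      if "k \<in> set (columns ?h 0 (map (\<lambda>_. []) W) (map (\<lambda>_. []) W') L)" for k
    proof -
      have n: "composable (map (\<lambda>_. []) V)" for V :: "layer list"
        by (simp add: composable_def)
      show "aligned (relevel ?h ?n ?n') k" "step_passages (left_steps k) = []" "step_passages (right_steps k) = []"
        using columns_aligned[OF _ _ n n _ _ that] ne by (simp_all add: hd_map last_map)
    qed
    have colR: "aligned (relevel ?h ?n ?n') k" "step_passages (left_steps k) = []" "step_passages (right_steps k) = []"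
      if "k \<in> set (columns ?h ?b W W' R)" for k
      using columns_aligned[OF ne comp _ _ that] up lo by simp_all
    show "aligned (relevel ?h ?n ?n') k" if "k \<in> set ?K" for k
      using that unfolding set_append Un_iff
      by (elim disjE) (rule exterior_aligned[OF pos(1)] colL(1) colR(1) al; assumption)+
    have cols: "step_passages (left_steps k) = []" "step_passages (right_steps k) = []" if "k \<in> set ?cols" for k
    proof -
      have "k \<in> set (columns ?h 0 (map (\<lambda>_. []) W) (map (\<lambda>_. []) W') L) \<or> k \<in> set (columns ?h ?b W W' R)"
        using that unfolding set_append Un_iff .
      then show "step_passages (left_steps k) = []" "step_passages (right_steps k) = []"
        using colL(2,3)[of k] colR(2,3)[of k] by blast+
    qed
    fix G :: "(match \<Rightarrow> ('k, 'a) heis) \<Rightarrow> 'k"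
    assume G: "multilin (set ?K) G"
    show "(\<Sum>\<sigma>\<in>(\<Pi>\<^sub>E c\<in>crossings Z. B). G (chain_value Z \<sigma> left_steps)) =
        (\<Sum>\<sigma>\<in>(\<Pi>\<^sub>E c\<in>crossings Z'. B). G (chain_value Z' \<sigma> right_steps))"
    proof -
      have crs: "crossings Z = E \<union> X" "crossings Z' = E' \<union> X'"
        unfolding E_def E'_def X_def X'_def by (rule cross[OF lay(1)], rule cross[OF lay(2)])
      have in_X: "fst ` set (step_passages (left_steps k)) \<subseteq> X" "fst ` set (step_passages (right_steps k)) \<subseteq> X'"
        if k: "k \<in> set K" for k
        unfolding X_def X'_def using match_passages[OF K k] match_passages[OF K' k] by blast+
      define mrg where "mrg Y \<tau> \<sigma> c = (if c \<in> Y then \<tau> c else \<sigma> c)" for Y and \<tau> \<sigma> :: "crossing \<Rightarrow> 'a" and c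
      \<comment> \<open>An exterior state of \<open>Z\<close> transported to \<open>Z'\<close> along
        the renumbering of layers; under it the exterior chain values of \<open>Z'\<close> become
        those of \<open>Z\<close>, which \<open>G0\<close> inserts on both sides.\<close>
      define \<sigma>' where "\<sigma>' \<sigma> = restrict (\<lambda>c. \<sigma> (relayer ?h ?n' ?n c)) E'" for \<sigma> :: "crossing \<Rightarrow> 'a"
      define G0 where "G0 \<sigma> v = G (\<lambda>k. if k \<in> set K then v k else chain_value Z \<sigma> left_steps k)" for \<sigma> v
      have G0: "multilin (set K) (G0 \<sigma>)" for \<sigma>
        unfolding multilin_def
      proof (intro conjI allI impI ballI)
        fix v w :: "match \<Rightarrow> ('k, 'a) heis" assume "\<forall>q\<in>set K. v q = w q"
        then have "(\<lambda>k. if k \<in> set K then v k else chain_value Z \<sigma> left_steps k) =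
            (\<lambda>k. if k \<in> set K then w k else chain_value Z \<sigma> left_steps k)" by auto
        then show "G0 \<sigma> v = G0 \<sigma> w" unfolding G0_def by (rule arg_cong)
      next
        fix v :: "match \<Rightarrow> ('k, 'a) heis" and q assume v: "\<forall>q. v q \<in> H" and q: "q \<in> set K"
        let ?v = "\<lambda>k. if k \<in> set K then v k else chain_value Z \<sigma> left_steps k"
        have "(\<lambda>k. if k \<in> set K then (v(q := s)) k else chain_value Z \<sigma> left_steps k) = ?v(q := s)" for s
          using q by auto
        moreover have "\<forall>q. ?v q \<in> H" using v chain_value_in by simp
        then have "hlin (\<lambda>s. G (?v(q := s)))"
          using G q unfolding multilin_def by simp
        ultimately show "hlin (\<lambda>s. G0 \<sigma> (v(q := s)))"
          unfolding G0_def by (simp only:)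
      qed
      have dep: "G v = G w" if "\<And>k. k \<in> set ?K \<Longrightarrow> v k = w k" for v w
        using G that unfolding multilin_def by blast
      have left: "G (chain_value Z (mrg X \<tau> \<sigma>) left_steps) = G0 \<sigma> (chain_value Z \<tau> left_steps)" for \<sigma> \<tau>
        unfolding G0_def
      proof (rule dep)
        fix k assume k: "k \<in> set ?K"
        show "chain_value Z (mrg X \<tau> \<sigma>) left_steps k =
            (if k \<in> set K then chain_value Z \<tau> left_steps k else chain_value Z \<sigma> left_steps k)"
        proof (cases "k \<in> set K")
          case True
          have "chain_value Z (mrg X \<tau> \<sigma>) left_steps k = chain_value Z \<tau> left_steps k"
          proof (rule chain_value_cong[OF refl], rule map_cong[OF refl])
            fix p assume "p \<in> set (step_passages (left_steps k))"
            then have "fst p \<in> X" using in_X(1)[OF True] by blast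
            then show "passage_label A B Z (mrg X \<tau> \<sigma>) p = passage_label A B Z \<tau> p"
              using passage_label_cong[OF refl refl, of "mrg X \<tau> \<sigma>" "fst p" \<tau> Z "snd p"] by (simp add: mrg_def)
          qed
          then show ?thesis using True by simp
        next
          case False
          then have k': "k \<in> set ?ext \<or> k \<in> set ?cols" using k by auto
          have "fst ` set (step_passages (left_steps k)) \<subseteq> E"
          proof (cases "k \<in> set ?ext")
            case True
            then show ?thesis using exterior_passages[OF True] unfolding E_def by auto
          next
            case False
            then have "k \<in> set ?cols" using k' by blast
            then show ?thesis by (simp only: cols(1) list.set image_empty empty_subsetI)
          qed
          then have "chain_value Z (mrg X \<tau> \<sigma>) left_steps k = chain_value Z \<sigma> left_steps k"
          proof (intro chain_value_cong[OF refl] map_cong[OF refl])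
            fix p assume "fst ` set (step_passages (left_steps k)) \<subseteq> E" "p \<in> set (step_passages (left_steps k))"
            then have "fst p \<notin> X" using XE(1) by blast
            then show "passage_label A B Z (mrg X \<tau> \<sigma>) p = passage_label A B Z \<sigma> p"
              using passage_label_cong[OF refl refl, of "mrg X \<tau> \<sigma>" "fst p" \<sigma> Z "snd p"] by (simp add: mrg_def)
          qed
          then show ?thesis using False by simp
        qed
      qed
      have right: "G (chain_value Z' (mrg X' \<tau> (\<sigma>' \<sigma>)) right_steps) = G0 \<sigma> (chain_value Z' \<tau> right_steps)" for \<sigma> \<tau>
        unfolding G0_def
      proof (rule dep)
        fix k assume k: "k \<in> set ?K"
        show "chain_value Z' (mrg X' \<tau> (\<sigma>' \<sigma>)) right_steps k =
            (if k \<in> set K then chain_value Z' \<tau> right_steps k else chain_value Z \<sigma> left_steps k)"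
        proof (cases "k \<in> set K")
          case True
          have "chain_value Z' (mrg X' \<tau> (\<sigma>' \<sigma>)) right_steps k = chain_value Z' \<tau> right_steps k"
          proof (rule chain_value_cong[OF refl], rule map_cong[OF refl])
            fix p assume "p \<in> set (step_passages (right_steps k))"
            then have "fst p \<in> X'" using in_X(2)[OF True] by blast
            then show "passage_label A B Z' (mrg X' \<tau> (\<sigma>' \<sigma>)) p = passage_label A B Z' \<tau> p"
              using passage_label_cong[OF refl refl, of "mrg X' \<tau> (\<sigma>' \<sigma>)" "fst p" \<tau> Z' "snd p"]
              by (simp add: mrg_def)
          qed
          then show ?thesis using True by simp
        next
          case False
          have "chain_value Z' (mrg X' \<tau> (\<sigma>' \<sigma>)) right_steps k = chain_value Z \<sigma> left_steps k"
          proof (cases "k \<in> set ?ext")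
            case True
            obtain ps where ps: "step_passages (left_steps k) = ps"
              "step_passages (right_steps k) = map (map_prod ?\<kappa> id) ps" "fst ` set ps \<subseteq> E"
              using exterior_passages[OF True] unfolding E_def by blast
            show ?thesis
            proof (rule chain_value_cong[OF th], unfold ps map_map, rule map_cong[OF refl])
              fix p assume "p \<in> set ps"
              then have c: "fst p \<in> E" using ps(3) by blast
              then have "?\<kappa> (fst p) \<in> E'" "relayer ?h ?n' ?n (?\<kappa> (fst p)) = fst p"
                using to_E'[OF c] by blast+
              then have "mrg X' \<tau> (\<sigma>' \<sigma>) (?\<kappa> (fst p)) = \<sigma> (fst p)"
                using XE(2) unfolding mrg_def \<sigma>'_def by auto
              then have "passage_label A B Z' (mrg X' \<tau> (\<sigma>' \<sigma>)) (?\<kappa> (fst p), snd p) = passage_label A B Z \<sigma> (fst p, snd p)"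
                using passage_label_cong[OF th lay_ext[OF c, symmetric]] by blast
              then show "(passage_label A B Z' (mrg X' \<tau> (\<sigma>' \<sigma>)) \<circ> map_prod ?\<kappa> id) p = passage_label A B Z \<sigma> p"
                by (cases p) simp
            qed
          next
            case F: False
            then have "k \<in> set ?cols" using k False by auto
            then have "step_passages (left_steps k) = []" "step_passages (right_steps k) = []"
              using cols by blast+
            then show ?thesis by (intro chain_value_cong[OF th]) simp
          qed
          then show ?thesis using False by simp
        qed
      qed
      have "(\<Sum>\<sigma>\<in>(\<Pi>\<^sub>E c\<in>crossings Z. B). G (chain_value Z \<sigma> left_steps)) =
          (\<Sum>\<sigma>\<in>(\<Pi>\<^sub>E c\<in>E. B). \<Sum>\<tau>\<in>(\<Pi>\<^sub>E c\<in>X. B). G (chain_value Z (mrg X \<tau> \<sigma>) left_steps))"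
        unfolding crs mrg_def[abs_def] by (rule sum_states_split[OF fin(1,2) XE(1)])
      also have "\<dots> = (\<Sum>\<sigma>\<in>(\<Pi>\<^sub>E c\<in>E. B). \<Sum>\<tau>\<in>(\<Pi>\<^sub>E c\<in>X'. B). G0 \<sigma> (chain_value Z' \<tau> right_steps))"
        unfolding left
        by (rule sum.cong[OF refl], rule id[unfolded local_identity_def, rule_format, folded X_def X'_def, OF G0])
      also have "\<dots> = (\<Sum>\<sigma>\<in>(\<Pi>\<^sub>E c\<in>E. B). \<Sum>\<tau>\<in>(\<Pi>\<^sub>E c\<in>X'. B). G (chain_value Z' (mrg X' \<tau> (\<sigma>' \<sigma>)) right_steps))"
        unfolding right ..
      also have "\<dots> = (\<Sum>\<sigma>\<in>(\<Pi>\<^sub>E c\<in>E'. B). \<Sum>\<tau>\<in>(\<Pi>\<^sub>E c\<in>X'. B). G (chain_value Z' (mrg X' \<tau> \<sigma>) right_steps))"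
      proof -
        have "bij_betw (relayer ?h ?n' ?n) E' E"
          by (rule bij_betw_byWitness[where f' = ?\<kappa>]) (use to_E to_E' in \<open>simp_all add: image_subset_iff\<close>)
        then show ?thesis
          unfolding \<sigma>'_def by (rule sum_states_reindex[symmetric])
      qed
      also have "\<dots> = (\<Sum>\<sigma>\<in>(\<Pi>\<^sub>E c\<in>crossings Z'. B). G (chain_value Z' \<sigma> right_steps))"
        unfolding crs mrg_def[abs_def] by (rule sum_states_split[OF fin(3,4) XE(2), symmetric])
      finally show ?thesis .
    qed
  qed
qed

end

section \<open>Moves which do not change the labels\<close>

context finite_hopf
begin

text \<open>The bijection of crossings induces one of states. Since pieces and passages correspond,
  the labels and hence the chain values agree state by state.\<close>

lemma relabelling_identity:
  assumes th: "thin Z' = thin Z" and \<kappa>: "bij_betw \<kappa> X X'"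
    and pieces: "\<And>c. c \<in> X \<Longrightarrow> layers Z' ! fst (\<kappa> c) ! snd (\<kappa> c) = layers Z ! fst c ! snd c"
    and ps: "\<And>k. k \<in> set K \<Longrightarrow> step_passages (right_steps k) = map (map_prod \<kappa> id) (step_passages (left_steps k))"
    and X: "\<And>k. k \<in> set K \<Longrightarrow> fst ` set (step_passages (left_steps k)) \<subseteq> X"
  shows "local_identity Z X Z' X' K"
  unfolding local_identity_def
proof (intro allI impI)
  fix G :: "(match \<Rightarrow> ('k, 'a) heis) \<Rightarrow> 'k" assume G: "multilin (set K) G"
  have "G (chain_value Z (restrict (\<lambda>c. \<sigma> (\<kappa> c)) X) left_steps) = G (chain_value Z' \<sigma> right_steps)" for \<sigma>
  proof -
    have "chain_value Z (restrict (\<lambda>c. \<sigma> (\<kappa> c)) X) left_steps k = chain_value Z' \<sigma> right_steps k" if k: "k \<in> set K" for k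
    proof (rule chain_value_cong[OF th[symmetric]], unfold ps[OF k] map_map, rule map_cong[OF refl])
      fix p assume "p \<in> set (step_passages (left_steps k))"
      then have c: "fst p \<in> X" using X[OF k] by blast
      have "passage_label A B Z (restrict (\<lambda>c. \<sigma> (\<kappa> c)) X) (fst p, snd p) = passage_label A B Z' \<sigma> (\<kappa> (fst p), snd p)"
        by (intro passage_label_cong th[symmetric] pieces[symmetric]) (simp_all add: c)
      then show "passage_label A B Z (restrict (\<lambda>c. \<sigma> (\<kappa> c)) X) p = (passage_label A B Z' \<sigma> \<circ> map_prod \<kappa> id) p"
        by (cases p) simp
    qed
    then show ?thesis using G unfolding multilin_def by blast
  qed
  then show "(\<Sum>\<sigma>\<in>(\<Pi>\<^sub>E c\<in>X. B). G (chain_value Z \<sigma> left_steps)) = (\<Sum>\<sigma>\<in>(\<Pi>\<^sub>E c\<in>X'. B). G (chain_value Z' \<sigma> right_steps))"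
    unfolding sum_states_reindex[OF \<kappa>] by simp
qed

end

text \<open>
  \<open>extend lv v pos s\<close> prolongs a step at its ends on the line \<open>lv\<close> by vertical steps from or to the
  line \<open>v\<close>.
\<close>

definition extend :: "nat \<Rightarrow> nat \<Rightarrow> (nat \<Rightarrow> nat) \<Rightarrow> step \<Rightarrow> step list" where
  "extend lv v pos s =
     (if fst (fst s) = lv then [((v, pos (snd (fst s))), fst s, None)] else []) @ [s] @
     (if fst (fst (snd s)) = lv then [(fst (snd s), (v, pos (snd (fst (snd s)))), None)] else [])"

text \<open>Each lower end of the layer is the end of one step, so prolonging the steps uses up each
  of the vertical strands below exactly once.\<close>

lemma mset_extend_lower:
  "mset (concat (map (\<lambda>(a, s). map (orient a) (extend (Suc r) v pos s)) (layer_steps r j u d l))) =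
    mset (oriented (layer_steps r j u d l)) +
    mset (enum_map (\<lambda>a t. orient a ((Suc r, t), (v, pos t), None)) d (lowers l))"
proof (induction l arbitrary: j u d)
  case (Cons p l)
  then show ?case
    by (cases p) (simp_all add: extend_def)
qed simp

lemma mset_extend_upper:
  "mset (concat (map (\<lambda>(a, s). map (orient a) (extend r v pos s)) (layer_steps r j u d l))) =
    mset (oriented (layer_steps r j u d l)) +
    mset (enum_map (\<lambda>a t. orient a ((v, pos t), (r, t), None)) u (uppers l))"
proof (induction l arbitrary: j u d)
  case (Cons p l)
  then show ?case
    by (cases p) (simp_all add: extend_def)
qed simp

type_synonym base = "nat \<times> nat \<times> nat \<times> nat"

text \<open>The layer number and the offsets of pieces, upper ends and lower ends.\<close>

fun move_point :: "base \<Rightarrow> base \<Rightarrow> point \<Rightarrow> point" where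
  "move_point (r, j, u, d) (r', j', u', d') p =
     (if fst p = r then (r', snd p + u' - u) else (Suc r', snd p + d' - d))"

fun move_crossing :: "base \<Rightarrow> base \<Rightarrow> crossing \<Rightarrow> crossing" where
  "move_crossing (r, j, u, d) (r', j', u', d') c = (r', snd c + j' - j)"

definition move_step :: "base \<Rightarrow> base \<Rightarrow> step \<Rightarrow> step" where
  "move_step \<beta> \<beta>' s = (move_point \<beta> \<beta>' (fst s), move_point \<beta> \<beta>' (fst (snd s)),
     map_option (map_prod (move_crossing \<beta> \<beta>') id) (snd (snd s)))"

lemma move_layer_steps: "layer_steps r' (i + j') (k + u') (m + d') l =
    map (apsnd (move_step (r, j, u, d) (r', j', u', d'))) (layer_steps r (i + j) (k + u) (m + d) l)"
proof (induction l arbitrary: i k m)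
  case (Cons p l)
  have "map (\<lambda>(a, s). (a, lift_step r' (i + j') (k + u') (m + d') s)) (piece_steps p) =
      map (apsnd (move_step (r, j, u, d) (r', j', u', d')))
        (map (\<lambda>(a, s). (a, lift_step r (i + j) (k + u) (m + d) s)) (piece_steps p))"
  proof (cases p)
    case (Crossing x a b)
    then show ?thesis by (cases x) (simp_all add: move_step_def)
  qed (simp_all add: move_step_def)
  then show ?case
    using Cons[of "Suc i" "k + length (upper p)" "m + length (lower p)"]
    by (simp add: ac_simps)
qed simp

text \<open>In the first diagram the steps absorb the vertical strands of the adjacent layer, in the
  second they stand alone in the position \<open>\<beta>'\<close>. Thus no chain ends on the line
  \<open>lv\<close>, which disappears when the layers are merged.\<close>

fun extended_matches :: "base \<Rightarrow> base \<Rightarrow> nat \<Rightarrow> nat \<Rightarrow> (nat \<Rightarrow> nat) \<Rightarrow> layer \<Rightarrow> match list" where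
  "extended_matches (r, j, u, d) \<beta>' lv v pos l =
     map (\<lambda>(a, s). (a, extend lv v pos s, [move_step (r, j, u, d) \<beta>' s])) (layer_steps r j u d l)"

lemma match_arcs_extended:
  "match_arcs right_steps (extended_matches (r, j, u, d) (r', j', u', d') lv v pos l)
    = oriented (layer_steps r' j' u' d' l)"
  "mset (match_arcs left_steps (extended_matches (r, j, u, d) \<beta>' (Suc r) v pos l)) =
    mset (oriented (layer_steps r j u d l)) +
    mset (enum_map (\<lambda>a t. orient a ((Suc r, t), (v, pos t), None)) d (lowers l))"
  "mset (match_arcs left_steps (extended_matches (r, j, u, d) \<beta>' r v pos l)) =
    mset (oriented (layer_steps r j u d l)) +
    mset (enum_map (\<lambda>a t. orient a ((v, pos t), (r, t), None)) u (uppers l))"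
proof -
  show "match_arcs right_steps (extended_matches (r, j, u, d) (r', j', u', d') lv v pos l)
      = oriented (layer_steps r' j' u' d' l)"
    using move_layer_steps[of r' 0 j' 0 u' 0 d' l r j u d]
    by (simp add: match_arcs_def o_def case_prod_unfold concat_map_singleton)
  show "mset (match_arcs left_steps (extended_matches (r, j, u, d) \<beta>' (Suc r) v pos l)) =
    mset (oriented (layer_steps r j u d l)) +
    mset (enum_map (\<lambda>a t. orient a ((Suc r, t), (v, pos t), None)) d (lowers l))"
    unfolding mset_extend_lower[symmetric] by (simp add: match_arcs_def o_def case_prod_unfold)
  show "mset (match_arcs left_steps (extended_matches (r, j, u, d) \<beta>' r v pos l)) =
    mset (oriented (layer_steps r j u d l)) +
    mset (enum_map (\<lambda>a t. orient a ((v, pos t), (r, t), None)) u (uppers l))"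
    unfolding mset_extend_upper[symmetric] by (simp add: match_arcs_def o_def case_prod_unfold)
qed

lemma extended_match:
  assumes k: "k \<in> set (extended_matches (r, j, u, d) \<beta>' lv v pos l)"
    and \<rho>: "\<And>p. fst p \<in> {r, Suc r} \<Longrightarrow>
      \<rho> (if fst p = lv then (v, pos (snd p)) else p) = move_point (r, j, u, d) \<beta>' p"
  shows "aligned \<rho> k"
    "step_passages (right_steps k) = map (map_prod (move_crossing (r, j, u, d) \<beta>') id) (step_passages (left_steps k))"
    "p \<in> set (step_passages (left_steps k)) \<Longrightarrow> fst (fst p) = r"
proof -
  obtain a s where s: "(a, s) \<in> set (layer_steps r j u d l)"
    and k: "k = (a, extend lv v pos s, [move_step (r, j, u, d) \<beta>' s])"
    using k by auto
  obtain p q x where pq: "s = (p, q, x)" by (cases s)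
  have rng: "fst p \<in> {r, Suc r}" "fst q \<in> {r, Suc r}" "\<And>c \<rho>. x = Some (c, \<rho>) \<Longrightarrow> fst c = r"
    using layer_steps_range[of a p q x r j u d l] s pq by auto
  show "aligned \<rho> k"
    using \<rho>[OF rng(1)] \<rho>[OF rng(2)] unfolding k pq
    by (auto simp: aligned_def extend_def move_step_def)
  have e: "step_passages (extend lv v pos s) = (case x of None \<Rightarrow> [] | Some y \<Rightarrow> [y])"
    by (simp add: extend_def pq map_filter_def split: option.split)
  show "step_passages (right_steps k) = map (map_prod (move_crossing (r, j, u, d) \<beta>') id) (step_passages (left_steps k))"
    unfolding k fst_conv snd_conv e by (simp add: move_step_def pq map_filter_def split: option.split)
  show "p \<in> set (step_passages (left_steps k)) \<Longrightarrow> fst (fst p) = r" for p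
    unfolding k fst_conv snd_conv e using rng(3)[of "fst p" "snd p"] by (auto split: option.splits)
qed

lemma extended_match_relabel:
  assumes "k \<in> set (extended_matches (r, j, u, d) \<beta>' lv v pos l)"
    and "\<And>p. fst p \<in> {r, Suc r} \<Longrightarrow>
      \<rho> (if fst p = lv then (v, pos (snd p)) else p) = move_point (r, j, u, d) \<beta>' p"
    and \<kappa>: "\<And>c. fst c = r \<Longrightarrow> \<kappa> c = move_crossing (r, j, u, d) \<beta>' c"
  shows "aligned \<rho> k \<and> step_passages (right_steps k) = map (map_prod \<kappa> id) (step_passages (left_steps k))"
proof -
  note e = extended_match[OF assms(1,2)]
  have "map (map_prod (move_crossing (r, j, u, d) \<beta>') id) (step_passages (left_steps k))
      = map (map_prod \<kappa> id) (step_passages (left_steps k))"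
    using e(3) \<kappa> by (intro map_cong[OF refl]) (auto simp: map_prod_def)
  then show ?thesis
    using e(1,2) by simp
qed

lemma vert_crossings: "step_crossings (layer_steps r j u d (verts as)) = {}"
  by (auto simp: layer_crossings real_crossing_def)

context finite_hopf
begin

theorem relabelling_move:
  assumes Z: "colored_diagram Z" and Z': "colored_diagram Z'" and th: "thin Z' = thin Z"
    and lay: "layers Z = ls @ map (frame L R) W @ ls'" "layers Z' = ls @ map (frame L R) W' @ ls'"
    and bd: "W \<noteq> []" "W' \<noteq> []" "uppers (hd W) = uppers (hd W')" "lowers (last W) = lowers (last W')"
    and K: "mset (match_arcs left_steps K) = mset (oriented (stack_steps (length ls) (length L) W))"
    and K': "mset (match_arcs right_steps K) = mset (oriented (stack_steps (length ls) (length L) W'))"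
    and al: "\<And>k. k \<in> set K \<Longrightarrow> aligned (relevel (length ls) (length W) (length W')) k \<and>
      step_passages (right_steps k) = map (map_prod \<kappa> id) (step_passages (left_steps k))"
    and X: "step_crossings (stack_steps (length ls) (length L) W) = X"
      "step_crossings (stack_steps (length ls) (length L) W') = X'"
    and \<kappa>: "bij_betw \<kappa> X X'"
    and pieces: "\<And>c. c \<in> X \<Longrightarrow> layers Z' ! fst (\<kappa> c) ! snd (\<kappa> c) = layers Z ! fst c ! snd c"
  shows "universal_invariant A B Z = universal_invariant A B Z'"
proof (rule local_move[OF Z Z' th lay bd K K'])
  show "aligned (relevel (length ls) (length W) (length W')) k" if "k \<in> set K" for k
    using al[OF that] by simp
  show "local_identity Z (step_crossings (stack_steps (length ls) (length L) W))
      Z' (step_crossings (stack_steps (length ls) (length L) W')) K"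
    unfolding X
  proof (rule relabelling_identity[OF th \<kappa> pieces])
    show "step_passages (right_steps k) = map (map_prod \<kappa> id) (step_passages (left_steps k))" if "k \<in> set K" for k
      using al[OF that] by simp
    show "fst ` set (step_passages (left_steps k)) \<subseteq> X" if "k \<in> set K" for k
      using match_passages[OF K that] unfolding X .
  qed
qed

text \<open>The line between the two layers disappears, so the steps of \<open>f\<close> are
  prolonged downwards and those of \<open>g\<close> upwards across it.\<close>

lemma height_left_move:
  assumes Z: "colored_diagram Z" and Z': "colored_diagram Z'" and th: "thin Z' = thin Z"
    and lay: "layers Z = ls @ map (frame L R) [f @ verts (uppers g), verts (lowers f) @ g] @ ls'"
      "layers Z' = ls @ map (frame L R) [f @ g] @ ls'"
  shows "universal_invariant A B Z = universal_invariant A B Z'"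
proof -
  define h b uf lf where "h = length ls" and "b = length L"
    and "uf = length (uppers f)" and "lf = length (lowers f)"
  let ?W = "[f @ verts (uppers g), verts (lowers f) @ g]" and ?W' = "[f @ g]"
  \<comment> \<open>In the lower layer \<open>g\<close> stands behind vertical strands, one for each
    lower end of \<open>f\<close>, so its three offsets coincide; in the merged layer it stands
    behind the pieces of \<open>f\<close>, with three separate counts.\<close>
  let ?\<beta> = "(Suc h, b + lf, b + lf, b + lf)" and ?\<beta>' = "(h, b + length f, b + uf, b + lf)"
  \<comment> \<open>On the line above, the lower ends of \<open>f\<close> are replaced by its upper
    ends, which displaces the strands leading to \<open>g\<close>.\<close>
  let ?pos = "\<lambda>c. c + (b + uf) - (b + lf)"
  let ?K1 = "extended_matches (h, b, b, b) (h, b, b, b) (Suc h) (Suc (Suc h)) id f"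
  let ?K2 = "extended_matches ?\<beta> ?\<beta>' (Suc h) h ?pos g"
  define \<kappa> where "\<kappa> c = (if fst c = h then c else move_crossing ?\<beta> ?\<beta>' c)" for c
  have W: "stack_steps h b ?W = layer_steps h b b b f @ layer_steps h (b + length f) (b + uf) (b + lf) (verts (uppers g)) @
      layer_steps (Suc h) b b b (verts (lowers f)) @ layer_steps (Suc h) (b + lf) (b + lf) (b + lf) g"
    and W': "stack_steps h b ?W' = layer_steps h b b b f @ layer_steps h (b + length f) (b + uf) (b + lf) g"
    by (simp_all add: layer_steps_append uf_def lf_def)
  define X where "X = {c. (\<exists>i<length f. c = (h, b + i) \<and> real_crossing (f ! i)) \<or>
      (\<exists>i<length g. c = (Suc h, b + lf + i) \<and> real_crossing (g ! i))}"
  define X' where "X' = {c. (\<exists>i<length f. c = (h, b + i) \<and> real_crossing (f ! i)) \<or>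
      (\<exists>i<length g. c = (h, b + length f + i) \<and> real_crossing (g ! i))}"
  have v1: "oriented (layer_steps (Suc h) b b b (verts (lowers f)))
      = enum_map (\<lambda>a t. orient a ((Suc h, t), (Suc (Suc h), id t), None)) b (lowers f)"
    using layer_steps_verts[of "Suc h" b 0 b 0 "lowers f"] by (simp add: map_enum_map)
  have v2: "oriented (layer_steps h (b + length f) (b + uf) (b + lf) (verts (uppers g)))
      = enum_map (\<lambda>a t. orient a ((h, ?pos t), (Suc h, t), None)) (b + lf) (uppers g)"
  proof -
    have "?pos (t + (b + lf)) = b + uf + t" "t + (b + lf) = b + lf + t" for t by simp_all
    then have "oriented (layer_steps h (b + length f) (b + uf) (b + lf) (verts (uppers g)))
        = enum_map (\<lambda>a t. orient a ((h, ?pos (t + (b + lf))), (Suc h, t + (b + lf)), None)) 0 (uppers g)"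
      using layer_steps_verts[of h "b + length f" "b + uf" 0 "b + lf" "uppers g"]
      by (simp only: map_enum_map add_0_right case_prod_conv)
    also have "\<dots> = enum_map (\<lambda>a t. orient a ((h, ?pos t), (Suc h, t), None)) (0 + (b + lf)) (uppers g)"
      by (rule enum_map_shift[symmetric])
    finally show ?thesis by (simp only: add_0)
  qed
  show ?thesis
  proof (rule relabelling_move[OF Z Z' th lay, where K = "?K1 @ ?K2" and X = X and X' = X' and \<kappa> = \<kappa>];
      (fold h_def b_def)?)
    show "mset (match_arcs left_steps (?K1 @ ?K2)) = mset (oriented (stack_steps h b ?W))"
      unfolding W map_append mset_append match_arcs_append match_arcs_extended lf_def[symmetric]
      unfolding v1 v2 by (simp only: ac_simps)
    show "mset (match_arcs right_steps (?K1 @ ?K2)) = mset (oriented (stack_steps h b ?W'))"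
      unfolding W' map_append mset_append match_arcs_append match_arcs_extended ..
    have 1: "aligned (relevel h (length ?W) (length ?W')) k \<and>
        step_passages (right_steps k) = map (map_prod \<kappa> id) (step_passages (left_steps k))" if "k \<in> set ?K1" for k
      by (rule extended_match_relabel[OF that]) (auto simp: relevel_def \<kappa>_def)
    have 2: "aligned (relevel h (length ?W) (length ?W')) k \<and>
        step_passages (right_steps k) = map (map_prod \<kappa> id) (step_passages (left_steps k))" if "k \<in> set ?K2" for k
      by (rule extended_match_relabel[OF that]) (auto simp: relevel_def \<kappa>_def)
    show "aligned (relevel h (length ?W) (length ?W')) k \<and>
        step_passages (right_steps k) = map (map_prod \<kappa> id) (step_passages (left_steps k))" if "k \<in> set (?K1 @ ?K2)" for k
      using that 1 2 unfolding set_append Un_iff by blast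
    show "step_crossings (stack_steps h b ?W) = X"
      unfolding W X_def by (auto simp: step_crossings_append vert_crossings layer_crossings)
    show "step_crossings (stack_steps h b ?W') = X'"
      unfolding W' X'_def by (auto simp: step_crossings_append layer_crossings)
    \<comment> \<open>In the merged layer all crossings have the same row; the inverse recognises
      those of \<open>f\<close> by an index below \<open>b + length f\<close>.\<close>
    show "bij_betw \<kappa> X X'"
      by (rule bij_betw_byWitness[where f' = "\<lambda>c. if snd c < b + length f then c else (Suc h, snd c + lf - length f)"])
        (auto simp: X_def X'_def \<kappa>_def)
    show "layers Z' ! fst (\<kappa> c) ! snd (\<kappa> c) = layers Z ! fst c ! snd c" if "c \<in> X" for c
      using that unfolding X_def lay mem_Collect_eq
      by (elim disjE exE conjE) (simp_all add: \<kappa>_def h_def b_def lf_def nth_append)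
  qed simp_all
qed

text \<open>Here \<open>f\<close> lies below and is prolonged upwards, \<open>g\<close> downwards,
  and the vertical strands beside \<open>g\<close> stand for the upper ends of
  \<open>f\<close>.\<close>

lemma height_right_move:
  assumes Z: "colored_diagram Z" and Z': "colored_diagram Z'" and th: "thin Z' = thin Z"
    and lay: "layers Z = ls @ map (frame L R) [verts (uppers f) @ g, f @ verts (lowers g)] @ ls'"
      "layers Z' = ls @ map (frame L R) [f @ g] @ ls'"
  shows "universal_invariant A B Z = universal_invariant A B Z'"
proof -
  define h b uf lf where "h = length ls" and "b = length L"
    and "uf = length (uppers f)" and "lf = length (lowers f)"
  let ?W = "[verts (uppers f) @ g, f @ verts (lowers g)]" and ?W' = "[f @ g]"
  let ?\<beta> = "(h, b + uf, b + uf, b + uf)" and ?\<beta>' = "(h, b + length f, b + uf, b + lf)"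
  let ?pos = "\<lambda>c. c + (b + lf) - (b + uf)"
  let ?K1 = "extended_matches (Suc h, b, b, b) (h, b, b, b) (Suc h) h id f"
  let ?K2 = "extended_matches ?\<beta> ?\<beta>' (Suc h) (Suc (Suc h)) ?pos g"
  define \<kappa> where "\<kappa> c = (if fst c = h then move_crossing ?\<beta> ?\<beta>' c else (h, snd c))" for c
  have W: "stack_steps h b ?W = layer_steps h b b b (verts (uppers f)) @ layer_steps h (b + uf) (b + uf) (b + uf) g @
      layer_steps (Suc h) b b b f @ layer_steps (Suc h) (b + length f) (b + uf) (b + lf) (verts (lowers g))"
    and W': "stack_steps h b ?W' = layer_steps h b b b f @ layer_steps h (b + length f) (b + uf) (b + lf) g"
    by (simp_all add: layer_steps_append uf_def lf_def)
  define X where "X = {c. (\<exists>i<length f. c = (Suc h, b + i) \<and> real_crossing (f ! i)) \<or>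
      (\<exists>i<length g. c = (h, b + uf + i) \<and> real_crossing (g ! i))}"
  define X' where "X' = {c. (\<exists>i<length f. c = (h, b + i) \<and> real_crossing (f ! i)) \<or>
      (\<exists>i<length g. c = (h, b + length f + i) \<and> real_crossing (g ! i))}"
  have v1: "oriented (layer_steps h b b b (verts (uppers f)))
      = enum_map (\<lambda>a t. orient a ((h, id t), (Suc h, t), None)) b (uppers f)"
    using layer_steps_verts[of h b 0 b 0 "uppers f"] by (simp add: map_enum_map)
  have v2: "oriented (layer_steps (Suc h) (b + length f) (b + uf) (b + lf) (verts (lowers g)))
      = enum_map (\<lambda>a t. orient a ((Suc h, t), (Suc (Suc h), ?pos t), None)) (b + uf) (lowers g)"
  proof -
    have "?pos (t + (b + uf)) = b + lf + t" "t + (b + uf) = b + uf + t" for t by simp_all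
    then have "oriented (layer_steps (Suc h) (b + length f) (b + uf) (b + lf) (verts (lowers g)))
        = enum_map (\<lambda>a t. orient a ((Suc h, t + (b + uf)), (Suc (Suc h), ?pos (t + (b + uf))), None)) 0 (lowers g)"
      using layer_steps_verts[of "Suc h" "b + length f" "b + uf" 0 "b + lf" "lowers g"]
      by (simp only: map_enum_map add_0_right case_prod_conv)
    also have "\<dots> = enum_map (\<lambda>a t. orient a ((Suc h, t), (Suc (Suc h), ?pos t), None)) (0 + (b + uf)) (lowers g)"
      by (rule enum_map_shift[symmetric])
    finally show ?thesis by (simp only: add_0)
  qed
  show ?thesis
  proof (rule relabelling_move[OF Z Z' th lay, where K = "?K1 @ ?K2" and X = X and X' = X' and \<kappa> = \<kappa>];
      (fold h_def b_def)?)
    show "mset (match_arcs left_steps (?K1 @ ?K2)) = mset (oriented (stack_steps h b ?W))"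
      unfolding W map_append mset_append match_arcs_append match_arcs_extended uf_def[symmetric]
      unfolding v1 v2 by (simp only: ac_simps)
    show "mset (match_arcs right_steps (?K1 @ ?K2)) = mset (oriented (stack_steps h b ?W'))"
      unfolding W' map_append mset_append match_arcs_append match_arcs_extended ..
    have 1: "aligned (relevel h (length ?W) (length ?W')) k \<and>
        step_passages (right_steps k) = map (map_prod \<kappa> id) (step_passages (left_steps k))" if "k \<in> set ?K1" for k
      by (rule extended_match_relabel[OF that]) (auto simp: relevel_def \<kappa>_def)
    have 2: "aligned (relevel h (length ?W) (length ?W')) k \<and>
        step_passages (right_steps k) = map (map_prod \<kappa> id) (step_passages (left_steps k))" if "k \<in> set ?K2" for k
      by (rule extended_match_relabel[OF that]) (auto simp: relevel_def \<kappa>_def)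
    show "aligned (relevel h (length ?W) (length ?W')) k \<and>
        step_passages (right_steps k) = map (map_prod \<kappa> id) (step_passages (left_steps k))" if "k \<in> set (?K1 @ ?K2)" for k
      using that 1 2 unfolding set_append Un_iff by blast
    show "step_crossings (stack_steps h b ?W) = X"
      unfolding W X_def by (auto simp: step_crossings_append vert_crossings layer_crossings)
    show "step_crossings (stack_steps h b ?W') = X'"
      unfolding W' X'_def by (auto simp: step_crossings_append layer_crossings)
    show "bij_betw \<kappa> X X'"
      by (rule bij_betw_byWitness[where f' = "\<lambda>c. if snd c < b + length f then (Suc h, snd c) else (h, snd c + uf - length f)"])
        (auto simp: X_def X'_def \<kappa>_def)
    show "layers Z' ! fst (\<kappa> c) ! snd (\<kappa> c) = layers Z ! fst c ! snd c" if "c \<in> X" for c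
      using that unfolding X_def lay mem_Collect_eq
      by (elim disjE exE conjE) (simp_all add: \<kappa>_def h_def b_def uf_def nth_append)
  qed simp_all
qed

end

section \<open>The patterns\<close>

text \<open>The path of a strand that descends at every layer: its positions on successive lines
  and, between them, the index of the real crossing and the role in it, all relative to the offset
  \<open>b\<close>.\<close>

fun descent :: "nat \<Rightarrow> nat \<Rightarrow> nat list \<Rightarrow> (nat \<times> role) option list \<Rightarrow> step list" where
  "descent r b (p # q # ps) (x # xs) =
     ((r, b + p), (Suc r, b + q), map_option (map_prod (\<lambda>j. (r, b + j)) id) x) # descent (Suc r) b (q # ps) xs"
| "descent r b _ _ = []"

abbreviation role_at :: "nat \<Rightarrow> role option \<Rightarrow> (nat \<times> role) option" where
  "role_at j \<equiv> map_option (Pair j)"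

lemmas match_simps = match_arcs_def aligned_def relevel_def eval_nat_numeral
  map_filter_simps map_option.compositionality o_def

context finite_hopf
begin

context
  fixes Z Z' :: diagram and ls ls' :: "layer list" and L R :: "strand list"
  assumes Z: "colored_diagram Z" and Z': "colored_diagram Z'" and th: "thin Z' = thin Z"
begin

section \<open>Symmetry moves and zigzags\<close>

lemma sym_sym_move:
  assumes "layers Z = ls @ map (frame L R) [[Sy a b], [Sy b a]] @ ls'"
    and "layers Z' = ls @ map (frame L R) [[Vert a, Vert b]] @ ls'"
  shows "universal_invariant A B Z = universal_invariant A B Z'"
  by (rule relabelling_move[OF Z Z' th assms, where X = "{}" and X' = "{}" and \<kappa> = id and
        K = "[(a, descent (length ls) (length L) [0, 1, 0] [None, None], descent (length ls) (length L) [0, 0] [None]),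
              (b, descent (length ls) (length L) [1, 0, 1] [None, None], descent (length ls) (length L) [1, 1] [None])]"])
    (auto simp: match_simps add_mset_commute)

text \<open>The pattern contains at most one real crossing, so the bijection of crossings can be a
  constant map; for virtual \<open>x\<close> it joins empty sets.\<close>

lemma sym_crossing_1_move:
  assumes lay: "layers Z = ls @ map (frame L R)
      [[Crossing x a b, Vert c], [Vert b, Sy a c], [Sy b c, Vert a]] @ ls'"
    "layers Z' = ls @ map (frame L R)
      [[Vert a, Sy b c], [Sy a c, Vert b], [Vert c, Crossing x a b]] @ ls'"
  shows "universal_invariant A B Z = universal_invariant A B Z'"
proof -
  let ?h = "length ls" and ?n = "length L"
  let ?K = "[(a, descent ?h ?n [0, 1, 2, 2] [role_at 0 (role_left x), None, None],
                 descent ?h ?n [0, 0, 1, 2] [None, None, role_at 1 (role_left x)]),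
             (b, descent ?h ?n [1, 0, 0, 1] [role_at 0 (role_right x), None, None],
                 descent ?h ?n [1, 2, 2, 1] [None, None, role_at 1 (role_right x)]),
             (c, descent ?h ?n [2, 2, 1, 0] [None, None, None], descent ?h ?n [2, 1, 0, 0] [None, None, None])]"
  show ?thesis
    by (rule relabelling_move[OF Z Z' th lay, where K = ?K and \<kappa> = "\<lambda>_. (?h + 2, ?n + 1)" and
          X = "if x = Virtual then {} else {(?h, ?n)}" and X' = "if x = Virtual then {} else {(?h + 2, ?n + 1)}"])
      (cases x; auto simp: match_simps add_mset_commute lay nth_append bij_betw_def)+
qed

lemma sym_crossing_2_move:
  assumes lay: "layers Z = ls @ map (frame L R)
      [[Vert a, Crossing x b c], [Sy a c, Vert b], [Vert c, Sy a b]] @ ls'"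
    "layers Z' = ls @ map (frame L R)
      [[Sy a b, Vert c], [Vert b, Sy a c], [Crossing x b c, Vert a]] @ ls'"
  shows "universal_invariant A B Z = universal_invariant A B Z'"
proof -
  let ?h = "length ls" and ?n = "length L"
  let ?K = "[(a, descent ?h ?n [0, 0, 1, 2] [None, None, None], descent ?h ?n [0, 1, 2, 2] [None, None, None]),
             (b, descent ?h ?n [1, 2, 2, 1] [role_at 1 (role_left x), None, None], descent ?h ?n [1, 0, 0, 1] [None, None, role_at 0 (role_left x)]),
             (c, descent ?h ?n [2, 1, 0, 0] [role_at 1 (role_right x), None, None], descent ?h ?n [2, 2, 1, 0] [None, None, role_at 0 (role_right x)])]"
  show ?thesis
    by (rule relabelling_move[OF Z Z' th lay, where K = ?K and \<kappa> = "\<lambda>_. (?h + 2, ?n)" and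
          X = "if x = Virtual then {} else {(?h, ?n + 1)}" and X' = "if x = Virtual then {} else {(?h + 2, ?n)}"])
      (cases x; auto simp: match_simps add_mset_commute lay nth_append bij_betw_def)+
qed

lemma sym_crossing_3_move:
  assumes lay: "layers Z = ls @ map (frame L R)
      [[Sy a b, Vert c], [Vert b, Crossing x a c], [Sy b c, Vert a]] @ ls'"
    "layers Z' = ls @ map (frame L R)
      [[Vert a, Sy b c], [Crossing x a c, Vert b], [Vert c, Sy a b]] @ ls'"
  shows "universal_invariant A B Z = universal_invariant A B Z'"
proof -
  let ?h = "length ls" and ?n = "length L"
  let ?K = "[(a, descent ?h ?n [0, 1, 2, 2] [None, role_at 1 (role_left x), None], descent ?h ?n [0, 0, 1, 2] [None, role_at 0 (role_left x), None]),
             (b, descent ?h ?n [1, 0, 0, 1] [None, None, None], descent ?h ?n [1, 2, 2, 1] [None, None, None]),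
             (c, descent ?h ?n [2, 2, 1, 0] [None, role_at 1 (role_right x), None], descent ?h ?n [2, 1, 0, 0] [None, role_at 0 (role_right x), None])]"
  show ?thesis
    by (rule relabelling_move[OF Z Z' th lay, where K = ?K and \<kappa> = "\<lambda>_. (?h + 1, ?n)" and
          X = "if x = Virtual then {} else {(?h + 1, ?n + 1)}" and X' = "if x = Virtual then {} else {(?h + 1, ?n)}"])
      (cases x; auto simp: match_simps add_mset_commute lay nth_append bij_betw_def)+
qed

text \<open>The chain goes down, through the minimum, through the maximum and down again. Its inner
  ends lie on the middle line, and it is matched with a single vertical step.\<close>

lemma zigzag_1_move:
  assumes "layers Z = ls @ map (frame L R) [[Vert a, Cap (reverse a)], [Cup a, Vert a]] @ ls'"
    and "layers Z' = ls @ map (frame L R) [[Vert a]] @ ls'"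
  shows "universal_invariant A B Z = universal_invariant A B Z'"
  by (rule relabelling_move[OF Z Z' th assms, where X = "{}" and X' = "{}" and \<kappa> = id and
        K = "let h = length ls; n = length L in
          [(a, [((h, n), (h + 1, n), None), ((h + 1, n), (h + 1, n + 1), None),
                ((h + 1, n + 1), (h + 1, n + 2), None), ((h + 1, n + 2), (h + 2, n), None)],
            descent h n [0, 0] [None])]"])
    (auto simp: match_simps add_mset_commute Let_def)

lemma zigzag_2_move:
  assumes "layers Z = ls @ map (frame L R) [[Cap a, Vert a], [Vert a, Cup (reverse a)]] @ ls'"
    and "layers Z' = ls @ map (frame L R) [[Vert a]] @ ls'"
  shows "universal_invariant A B Z = universal_invariant A B Z'"
  by (rule relabelling_move[OF Z Z' th assms, where X = "{}" and X' = "{}" and \<kappa> = id and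
        K = "let h = length ls; n = length L in
          [(a, [((h, n), (h + 1, n + 2), None), ((h + 1, n + 2), (h + 1, n + 1), None),
                ((h + 1, n + 1), (h + 1, n), None), ((h + 1, n), (h + 2, n), None)],
            descent h n [0, 0] [None])]"])
    (auto simp: match_simps add_mset_commute Let_def)

section \<open>Moves with real crossings\<close>

lemma sum_states_insert:
  "c \<notin> X \<Longrightarrow> (\<Sum>\<sigma>\<in>(\<Pi>\<^sub>E c\<in>insert c X. B). F \<sigma>) = (\<Sum>x\<in>B. \<Sum>\<sigma>\<in>(\<Pi>\<^sub>E c\<in>X. B). F (\<sigma>(c := x)))"
proof -
  assume c: "c \<notin> X"
  have "(\<Sum>\<sigma>\<in>(\<Pi>\<^sub>E c\<in>insert c X. B). F \<sigma>) = (\<Sum>(x, \<sigma>)\<in>B \<times> (\<Pi>\<^sub>E c\<in>X. B). F (\<sigma>(c := x)))"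
    unfolding PiE_insert_eq sum.reindex[OF inj_combinator[OF c, of "\<lambda>_. B"]]
    by (simp add: case_prod_unfold o_def)
  then show ?thesis by (simp add: sum.cartesian_product)
qed

text \<open>Dependence on two distinct matches is a bilinear map \<open>F\<close> of their values;
  the values elsewhere, which do not affect \<open>G\<close>, are set to the unit.\<close>

lemma local_identity_2:
  assumes kl: "k \<noteq> l"
    and F: "\<And>F. (\<And>t. t \<in> H \<Longrightarrow> hlin (\<lambda>s. F s t)) \<Longrightarrow> (\<And>s. s \<in> H \<Longrightarrow> hlin (F s)) \<Longrightarrow>
      (\<Sum>\<sigma>\<in>(\<Pi>\<^sub>E c\<in>X. B). F (chain_value Y \<sigma> left_steps k) (chain_value Y \<sigma> left_steps l)) =
      (\<Sum>\<sigma>\<in>(\<Pi>\<^sub>E c\<in>X'. B). F (chain_value Y' \<sigma> right_steps k) (chain_value Y' \<sigma> right_steps l))"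
  shows "local_identity Y X Y' X' [k, l]"
  unfolding local_identity_def
proof (intro allI impI)
  fix G :: "(match \<Rightarrow> ('k, 'a) heis) \<Rightarrow> 'k" assume "multilin (set [k, l]) G"
  then have G: "multilin {k, l} G" by simp
  define F where "F s t = G ((\<lambda>_. h1)(k := s, l := t))" for s t
  have GF: "G v = F (v k) (v l)" for v
  proof -
    have "\<forall>q\<in>{k, l}. v q = ((\<lambda>_. h1)(k := v k, l := v l)) q"
      using kl by simp
    then show ?thesis using G unfolding multilin_def F_def by blast
  qed
  have lin: "hlin (\<lambda>s. G (v(q := s)))" if "\<forall>q. v q \<in> H" "q \<in> {k, l}" for v q
    using G that unfolding multilin_def by blast
  have l1: "hlin (\<lambda>s. F s t)" if "t \<in> H" for t
  proof -
    have "(\<lambda>_. h1)(k := s, l := t) = ((\<lambda>_. h1)(l := t))(k := s)" for s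
      using kl by (auto simp: fun_eq_iff)
    then show ?thesis
      unfolding F_def using lin[of "(\<lambda>_. h1)(l := t)" k] that one_in by simp
  qed
  have l2: "hlin (F s)" if "s \<in> H" for s
    unfolding F_def using lin[of "(\<lambda>_. h1)(k := s)" l] that one_in by simp
  show "(\<Sum>\<sigma>\<in>(\<Pi>\<^sub>E c\<in>X. B). G (chain_value Y \<sigma> left_steps)) =
      (\<Sum>\<sigma>\<in>(\<Pi>\<^sub>E c\<in>X'. B). G (chain_value Y' \<sigma> right_steps))"
    unfolding GF by (rule assms(2)[OF l1 l2])
qed

lemma local_identity_3:
  assumes kl: "k \<noteq> l" "k \<noteq> m" "l \<noteq> m"
    and F: "\<And>F. (\<And>t r. t \<in> H \<Longrightarrow> r \<in> H \<Longrightarrow> hlin (\<lambda>s. F s t r)) \<Longrightarrow>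
      (\<And>s r. s \<in> H \<Longrightarrow> r \<in> H \<Longrightarrow> hlin (\<lambda>t. F s t r)) \<Longrightarrow>
      (\<And>s t. s \<in> H \<Longrightarrow> t \<in> H \<Longrightarrow> hlin (F s t)) \<Longrightarrow>
      (\<Sum>\<sigma>\<in>(\<Pi>\<^sub>E c\<in>X. B). F (chain_value Y \<sigma> left_steps k) (chain_value Y \<sigma> left_steps l)
        (chain_value Y \<sigma> left_steps m)) =
      (\<Sum>\<sigma>\<in>(\<Pi>\<^sub>E c\<in>X'. B). F (chain_value Y' \<sigma> right_steps k) (chain_value Y' \<sigma> right_steps l)
        (chain_value Y' \<sigma> right_steps m))"
  shows "local_identity Y X Y' X' [k, l, m]"
  unfolding local_identity_def
proof (intro allI impI)
  fix G :: "(match \<Rightarrow> ('k, 'a) heis) \<Rightarrow> 'k" assume "multilin (set [k, l, m]) G"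
  then have G: "multilin {k, l, m} G" by simp
  define F where "F s t r = G ((\<lambda>_. h1)(k := s, l := t, m := r))" for s t r
  have GF: "G v = F (v k) (v l) (v m)" for v
  proof -
    have "\<forall>q\<in>{k, l, m}. v q = ((\<lambda>_. h1)(k := v k, l := v l, m := v m)) q"
      using kl by simp
    then show ?thesis using G unfolding multilin_def F_def by blast
  qed
  have lin: "hlin (\<lambda>s. G (v(q := s)))" if "\<forall>q. v q \<in> H" "q \<in> {k, l, m}" for v q
    using G that unfolding multilin_def by blast
  have l1: "hlin (\<lambda>s. F s t r)" if "t \<in> H" "r \<in> H" for t r
  proof -
    have "(\<lambda>_. h1)(k := s, l := t, m := r) = ((\<lambda>_. h1)(l := t, m := r))(k := s)" for s
      using kl by (auto simp: fun_eq_iff)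
    then show ?thesis
      unfolding F_def using lin[of "(\<lambda>_. h1)(l := t, m := r)" k] that one_in by simp
  qed
  have l2: "hlin (\<lambda>t. F s t r)" if "s \<in> H" "r \<in> H" for s r
  proof -
    have "(\<lambda>_. h1)(k := s, l := t, m := r) = ((\<lambda>_. h1)(k := s, m := r))(l := t)" for t
      using kl by (auto simp: fun_eq_iff)
    then show ?thesis
      unfolding F_def using lin[of "(\<lambda>_. h1)(k := s, m := r)" l] that one_in by simp
  qed
  have l3: "hlin (F s t)" if "s \<in> H" "t \<in> H" for s t
    unfolding F_def using lin[of "(\<lambda>_. h1)(k := s, l := t)" m] that one_in by simp
  show "(\<Sum>\<sigma>\<in>(\<Pi>\<^sub>E c\<in>X. B). G (chain_value Y \<sigma> left_steps)) =
      (\<Sum>\<sigma>\<in>(\<Pi>\<^sub>E c\<in>X'. B). G (chain_value Y' \<sigma> right_steps))"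
    unfolding GF by (rule assms(4)[OF l1 l2 l3])
qed

abbreviation "sflips Y a \<equiv> flips (thin Y ! fst a) (snd a)"

text \<open>Thickness and upward orientation contribute one antipode each, so the exponent is
  \<open>flips\<close>, the same number that governs the order of multiplication in
  \<open>vprod\<close>.\<close>

lemma label_XPlus:
  assumes "layers Y ! r ! j = Crossing XPlus a b"
  shows "under_label A Y (r, j) e = sp (sflips Y a) e" "over_label A B Y (r, j) e = tp (sflips Y b) (ds e)"
  using assms by (simp_all add: under_label_def over_label_def strand_of_def xtype_of_def flips_def sp_simps
      tp_simps antipode_inv_dual_def eval_nat_numeral)

lemma label_XMinus:
  assumes "layers Y ! r ! j = Crossing XMinus a b"
  shows "under_label A Y (r, j) e = sp (sflips Y b) (S e)" "over_label A B Y (r, j) e = tp (sflips Y a) (ds e)"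
  using assms by (simp_all add: under_label_def over_label_def strand_of_def xtype_of_def flips_def sp_simps
      tp_simps antipode_inv_dual_def eval_nat_numeral)

lemma hlin_pair:
  assumes "\<And>t. t \<in> H \<Longrightarrow> hlin (\<lambda>s. F s t)" "\<And>s. s \<in> H \<Longrightarrow> hlin (F s)"
  shows "lform f \<Longrightarrow> lform (\<lambda>u. F (of_alg A (sp n u)) (of_dual A (tp m f)))"
    "dlin (\<lambda>f. F (of_alg A (sp n u)) (of_dual A (tp m f)))"
proof -
  show "lform f \<Longrightarrow> lform (\<lambda>u. F (of_alg A (sp n u)) (of_dual A (tp m f)))"
    by (rule lform_comp[OF hlin_of(2)[OF assms(1)] llin_sp]) (intro of_dual_in lform_tp)
  show "dlin (\<lambda>f. F (of_alg A (sp n u)) (of_dual A (tp m f)))"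
    by (intro dlin_tp hlin_of(1) assms(2) of_alg_in)
qed

lemma zero_two_1_move:
  assumes lay: "layers Z = ls @ map (frame L R) [[XP a b], [XM b a]] @ ls'"
    "layers Z' = ls @ map (frame L R) [[Vert a, Vert b]] @ ls'"
  shows "universal_invariant A B Z = universal_invariant A B Z'"
proof -
  let ?h = "length ls" and ?n = "length L"
  let ?k = "(a, descent ?h ?n [0, 1, 0] [Some (0, Under), Some (0, Under)], descent ?h ?n [0, 0] [None]) :: match"
  let ?l = "(b, descent ?h ?n [1, 0, 1] [Some (0, Over), Some (0, Over)], descent ?h ?n [1, 1] [None]) :: match"
  let ?p = "(?h, ?n)" and ?q = "(Suc ?h, ?n)"
  have c: "layers Z ! ?h ! ?n = XP a b" "layers Z ! Suc ?h ! ?n = XM b a"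
    by (simp_all add: lay nth_append)
  have val: "chain_value Z \<sigma> left_steps ?k = of_alg A (sp (sflips Z a) (S (\<sigma> ?q) * \<sigma> ?p))"
      "chain_value Z \<sigma> left_steps ?l = of_dual A (tp (sflips Z b) (dm (ds (\<sigma> ?q)) (ds (\<sigma> ?p))))"
      "chain_value Z' \<sigma>' right_steps ?k = h1" "chain_value Z' \<sigma>' right_steps ?l = h1" for \<sigma> \<sigma>'
    by (simp_all add: chain_value_def map_filter_simps label_XPlus[OF c(1)] label_XMinus[OF c(2)]
        vprod_alg vprod_dual dual_basis_lform vprod_simps)
  have id: "local_identity Z {?p, ?q} Z' {} [?k, ?l]"
  proof (rule local_identity_2)
    fix F assume F: "\<And>t. t \<in> H \<Longrightarrow> hlin (\<lambda>s. F s t)" "\<And>s. s \<in> H \<Longrightarrow> hlin (F s)"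
    let ?\<Phi> = "\<lambda>u f. F (of_alg A (sp (sflips Z a) u)) (of_dual A (tp (sflips Z b) f))"
    \<comment> \<open>The state sum has the upper crossing outermost, whereas the label of the lower
      crossing is the left factor.\<close>
    have "(\<Sum>y\<in>B. \<Sum>x\<in>B. ?\<Phi> (S x * y) (dm (ds x) (ds y))) = (\<Sum>x\<in>B. \<Sum>y\<in>B. ?\<Phi> (S x * y) (dm (ds x) (ds y)))"
      by (rule sum.swap)
    also have "\<dots> = ?\<Phi> 1 eps"
      by (rule zero_two_identity(1)[of ?\<Phi>]) (intro hlin_pair F; assumption)+
    finally show "(\<Sum>\<sigma>\<in>(\<Pi>\<^sub>E c\<in>{?p, ?q}. B). F (chain_value Z \<sigma> left_steps ?k) (chain_value Z \<sigma> left_steps ?l)) =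
        (\<Sum>\<sigma>\<in>(\<Pi>\<^sub>E c\<in>{}. B). F (chain_value Z' \<sigma> right_steps ?k) (chain_value Z' \<sigma> right_steps ?l))"
      unfolding val by (simp add: sum_states_insert sp_one tp_eps of_alg_one of_dual_eps)
  qed simp
  show ?thesis
    by (rule local_move[OF Z Z' th lay, where K = "[?k, ?l]"])
      (use id in \<open>auto simp: match_simps add_mset_commute insert_commute\<close>)
qed

lemma zero_two_2_move:
  assumes lay: "layers Z = ls @ map (frame L R) [[XM a b], [XP b a]] @ ls'"
    "layers Z' = ls @ map (frame L R) [[Vert a, Vert b]] @ ls'"
  shows "universal_invariant A B Z = universal_invariant A B Z'"
proof -
  let ?h = "length ls" and ?n = "length L"
  let ?k = "(b, descent ?h ?n [1, 0, 1] [Some (0, Under), Some (0, Under)], descent ?h ?n [1, 1] [None]) :: match"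
  let ?l = "(a, descent ?h ?n [0, 1, 0] [Some (0, Over), Some (0, Over)], descent ?h ?n [0, 0] [None]) :: match"
  let ?p = "(?h, ?n)" and ?q = "(Suc ?h, ?n)"
  have c: "layers Z ! ?h ! ?n = XM a b" "layers Z ! Suc ?h ! ?n = XP b a"
    by (simp_all add: lay nth_append)
  have val: "chain_value Z \<sigma> left_steps ?k = of_alg A (sp (sflips Z b) (\<sigma> ?q * S (\<sigma> ?p)))"
      "chain_value Z \<sigma> left_steps ?l = of_dual A (tp (sflips Z a) (dm (ds (\<sigma> ?q)) (ds (\<sigma> ?p))))"
      "chain_value Z' \<sigma>' right_steps ?k = h1" "chain_value Z' \<sigma>' right_steps ?l = h1" for \<sigma> \<sigma>'
    by (simp_all add: chain_value_def map_filter_simps label_XMinus[OF c(1)] label_XPlus[OF c(2)]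
        vprod_alg vprod_dual dual_basis_lform vprod_simps)
  have id: "local_identity Z {?p, ?q} Z' {} [?k, ?l]"
  proof (rule local_identity_2)
    fix F assume F: "\<And>t. t \<in> H \<Longrightarrow> hlin (\<lambda>s. F s t)" "\<And>s. s \<in> H \<Longrightarrow> hlin (F s)"
    let ?\<Phi> = "\<lambda>u f. F (of_alg A (sp (sflips Z b) u)) (of_dual A (tp (sflips Z a) f))"
    have "(\<Sum>y\<in>B. \<Sum>x\<in>B. ?\<Phi> (x * S y) (dm (ds x) (ds y))) = (\<Sum>x\<in>B. \<Sum>y\<in>B. ?\<Phi> (x * S y) (dm (ds x) (ds y)))"
      by (rule sum.swap)
    also have "\<dots> = ?\<Phi> 1 eps"
      by (rule zero_two_identity(2)[of ?\<Phi>]) (intro hlin_pair F; assumption)+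
    finally show "(\<Sum>\<sigma>\<in>(\<Pi>\<^sub>E c\<in>{?p, ?q}. B). F (chain_value Z \<sigma> left_steps ?k) (chain_value Z \<sigma> left_steps ?l)) =
        (\<Sum>\<sigma>\<in>(\<Pi>\<^sub>E c\<in>{}. B). F (chain_value Z' \<sigma> right_steps ?k) (chain_value Z' \<sigma> right_steps ?l))"
      unfolding val by (simp add: sum_states_insert sp_one tp_eps of_alg_one of_dual_eps)
  qed simp
  show ?thesis
    by (rule local_move[OF Z Z' th lay, where K = "[?k, ?l]"])
      (use id in \<open>auto simp: match_simps add_mset_commute insert_commute\<close>)
qed

lemma trilin_labels:
  assumes "\<And>t r. t \<in> H \<Longrightarrow> r \<in> H \<Longrightarrow> hlin (\<lambda>s. F s t r)"
    "\<And>s r. s \<in> H \<Longrightarrow> r \<in> H \<Longrightarrow> hlin (\<lambda>t. F s t r)" "\<And>s t. s \<in> H \<Longrightarrow> t \<in> H \<Longrightarrow> hlin (F s t)"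
  shows "trilin (\<lambda>u s f. F (of_alg A (sp n u)) s (of_dual A (tp m f)))"
  unfolding trilin_def
proof (intro conjI allI impI ballI)
  show "lform (\<lambda>u. F (of_alg A (sp n u)) s (of_dual A (tp m f)))" if "s \<in> H" "lform f" for s f
    by (rule lform_comp[OF hlin_of(2)[OF assms(1)] llin_sp]) (intro that of_dual_in lform_tp)+
  show "hlin (\<lambda>s. F (of_alg A (sp n u)) s (of_dual A (tp m f)))" if "lform f" for u f
    by (intro assms(2) of_alg_in of_dual_in lform_tp that)
  show "dlin (\<lambda>f. F (of_alg A (sp n u)) s (of_dual A (tp m f)))" if "s \<in> H" for u s
    by (intro dlin_tp hlin_of(1) assms(3) of_alg_in that)
qed

text \<open>An even number of antipodes means that the middle strand is thin and downward or thick
  and upward. The crossings of \<open>a\<close> with \<open>b\<close>, of \<open>a\<close> with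
  \<open>c\<close> and of \<open>b\<close> with \<open>c\<close> carry the summation indices
  \<open>x\<close>, \<open>y\<close>, \<open>z\<close> of \<open>twisted_pentagon\<close>.\<close>

lemma pachner_A_move:
  assumes b: "even (sflips Z b)"
    and lay: "layers Z = ls @ map (frame L R) [[Vert a, XP b c], [XP a c, Vert b], [Vert c, XP a b]] @ ls'"
    "layers Z' = ls @ map (frame L R) [[XP a b, Vert c], [Vert b, Sy a c], [XP b c, Vert a]] @ ls'"
  shows "universal_invariant A B Z = universal_invariant A B Z'"
proof -
  let ?h = "length ls" and ?n = "length L"
  let ?k = "(a, descent ?h ?n [0, 0, 1, 2] [None, Some (0, Under), Some (1, Under)],
      descent ?h ?n [0, 1, 2, 2] [Some (0, Under), None, None]) :: match"
  let ?l = "(b, descent ?h ?n [1, 2, 2, 1] [Some (1, Under), None, Some (1, Over)],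
      descent ?h ?n [1, 0, 0, 1] [Some (0, Over), None, Some (0, Under)]) :: match"
  let ?m = "(c, descent ?h ?n [2, 1, 0, 0] [Some (1, Over), Some (0, Over), None],
      descent ?h ?n [2, 2, 1, 0] [None, None, Some (0, Over)]) :: match"
  let ?z = "(?h, Suc ?n)" and ?y = "(Suc ?h, ?n)" and ?x = "(Suc (Suc ?h), Suc ?n)"
  let ?x' = "(?h, ?n)" and ?z' = "(Suc (Suc ?h), ?n)"
  have c: "layers Z ! ?h ! Suc ?n = XP b c" "layers Z ! Suc ?h ! ?n = XP a c" "layers Z ! Suc (Suc ?h) ! Suc ?n = XP a b"
      "layers Z' ! ?h ! ?n = XP a b" "layers Z' ! Suc (Suc ?h) ! ?n = XP b c"
    by (simp_all add: lay nth_append)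
  have val: "chain_value Z \<sigma> left_steps ?k = of_alg A (sp (sflips Z a) (\<sigma> ?x * \<sigma> ?y))"
      "chain_value Z \<sigma> left_steps ?l =
        hm (of_dual A (tp (sflips Z b) (ds (\<sigma> ?x)))) (of_alg A (sp (sflips Z b) (\<sigma> ?z)))"
      "chain_value Z \<sigma> left_steps ?m = of_dual A (tp (sflips Z c) (dm (ds (\<sigma> ?y)) (ds (\<sigma> ?z))))"
      "chain_value Z' \<sigma> right_steps ?k = of_alg A (sp (sflips Z a) (\<sigma> ?x'))"
      "chain_value Z' \<sigma> right_steps ?l =
        hm (of_alg A (sp (sflips Z b) (\<sigma> ?z'))) (of_dual A (tp (sflips Z b) (ds (\<sigma> ?x'))))"
      "chain_value Z' \<sigma> right_steps ?m = of_dual A (tp (sflips Z c) (ds (\<sigma> ?z')))" for \<sigma>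
    using b by (simp_all add: chain_value_def map_filter_simps label_XPlus[OF c(1)] label_XPlus[OF c(2)]
        label_XPlus[OF c(3)] label_XPlus[OF c(4)] label_XPlus[OF c(5)] th
        vprod_simps of_alg_in of_dual_in lform_tp dual_basis_lform of_alg_mult sp_mult of_dual_mult tp_dm)
  have id: "local_identity Z {?x, ?y, ?z} Z' {?x', ?z'} [?k, ?l, ?m]"
  proof (rule local_identity_3)
    fix F assume F: "\<And>t r. t \<in> H \<Longrightarrow> r \<in> H \<Longrightarrow> hlin (\<lambda>s. F s t r)"
      "\<And>s r. s \<in> H \<Longrightarrow> r \<in> H \<Longrightarrow> hlin (\<lambda>t. F s t r)" "\<And>s t. s \<in> H \<Longrightarrow> t \<in> H \<Longrightarrow> hlin (F s t)"
    show "(\<Sum>\<sigma>\<in>(\<Pi>\<^sub>E c\<in>{?x, ?y, ?z}. B). F (chain_value Z \<sigma> left_steps ?k)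
          (chain_value Z \<sigma> left_steps ?l) (chain_value Z \<sigma> left_steps ?m)) =
        (\<Sum>\<sigma>\<in>(\<Pi>\<^sub>E c\<in>{?x', ?z'}. B). F (chain_value Z' \<sigma> right_steps ?k)
          (chain_value Z' \<sigma> right_steps ?l) (chain_value Z' \<sigma> right_steps ?m))"
      unfolding val using twisted_pentagon[OF trilin_labels[OF F], of "sflips Z a" "sflips Z b" "sflips Z c"] b
      by (simp add: sum_states_insert)
  qed simp_all
  show ?thesis
    by (rule local_move[OF Z Z' th lay, where K = "[?k, ?l, ?m]"])
      (use id in \<open>auto simp: match_simps add_mset_commute insert_commute\<close>)
qed

text \<open>With an odd number of antipodes the middle strand multiplies from top to bottom. The
  vertical order of the crossings is opposite too, so the middle factors keep their order, while the
  products on the outer strands are reversed, as in the odd case of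
  \<open>twisted_pentagon\<close>.\<close>

lemma pachner_B_move:
  assumes b: "odd (sflips Z b)"
    and lay: "layers Z = ls @ map (frame L R) [[XP a b, Vert c], [Vert b, XP a c], [XP b c, Vert a]] @ ls'"
    "layers Z' = ls @ map (frame L R) [[Vert a, XP b c], [Sy a c, Vert b], [Vert c, XP a b]] @ ls'"
  shows "universal_invariant A B Z = universal_invariant A B Z'"
proof -
  let ?h = "length ls" and ?n = "length L"
  let ?k = "(a, descent ?h ?n [0, 1, 2, 2] [Some (0, Under), Some (1, Under), None],
      descent ?h ?n [0, 0, 1, 2] [None, None, Some (1, Under)]) :: match"
  let ?l = "(b, descent ?h ?n [1, 0, 0, 1] [Some (0, Over), None, Some (0, Under)],
      descent ?h ?n [1, 2, 2, 1] [Some (1, Under), None, Some (1, Over)]) :: match"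
  let ?m = "(c, descent ?h ?n [2, 2, 1, 0] [None, Some (1, Over), Some (0, Over)],
      descent ?h ?n [2, 1, 0, 0] [Some (1, Over), None, None]) :: match"
  let ?x = "(?h, ?n)" and ?y = "(Suc ?h, Suc ?n)" and ?z = "(Suc (Suc ?h), ?n)"
  let ?z' = "(?h, Suc ?n)" and ?x' = "(Suc (Suc ?h), Suc ?n)"
  have c: "layers Z ! ?h ! ?n = XP a b" "layers Z ! Suc ?h ! Suc ?n = XP a c" "layers Z ! Suc (Suc ?h) ! ?n = XP b c"
      "layers Z' ! ?h ! Suc ?n = XP b c" "layers Z' ! Suc (Suc ?h) ! Suc ?n = XP a b"
    by (simp_all add: lay nth_append)
  have val: "chain_value Z \<sigma> left_steps ?k = of_alg A (sp (sflips Z a) (\<sigma> ?y * \<sigma> ?x))"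
      "chain_value Z \<sigma> left_steps ?l =
        hm (of_dual A (tp (sflips Z b) (ds (\<sigma> ?x)))) (of_alg A (sp (sflips Z b) (\<sigma> ?z)))"
      "chain_value Z \<sigma> left_steps ?m = of_dual A (tp (sflips Z c) (dm (ds (\<sigma> ?z)) (ds (\<sigma> ?y))))"
      "chain_value Z' \<sigma> right_steps ?k = of_alg A (sp (sflips Z a) (\<sigma> ?x'))"
      "chain_value Z' \<sigma> right_steps ?l =
        hm (of_alg A (sp (sflips Z b) (\<sigma> ?z'))) (of_dual A (tp (sflips Z b) (ds (\<sigma> ?x'))))"
      "chain_value Z' \<sigma> right_steps ?m = of_dual A (tp (sflips Z c) (ds (\<sigma> ?z')))" for \<sigma>
    using b by (simp_all add: chain_value_def map_filter_simps label_XPlus[OF c(1)] label_XPlus[OF c(2)]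
        label_XPlus[OF c(3)] label_XPlus[OF c(4)] label_XPlus[OF c(5)] th
        vprod_simps of_alg_in of_dual_in lform_tp dual_basis_lform of_alg_mult sp_mult of_dual_mult tp_dm)
  have id: "local_identity Z {?x, ?y, ?z} Z' {?x', ?z'} [?k, ?l, ?m]"
  proof (rule local_identity_3)
    fix F assume F: "\<And>t r. t \<in> H \<Longrightarrow> r \<in> H \<Longrightarrow> hlin (\<lambda>s. F s t r)"
      "\<And>s r. s \<in> H \<Longrightarrow> r \<in> H \<Longrightarrow> hlin (\<lambda>t. F s t r)" "\<And>s t. s \<in> H \<Longrightarrow> t \<in> H \<Longrightarrow> hlin (F s t)"
    show "(\<Sum>\<sigma>\<in>(\<Pi>\<^sub>E c\<in>{?x, ?y, ?z}. B). F (chain_value Z \<sigma> left_steps ?k)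
          (chain_value Z \<sigma> left_steps ?l) (chain_value Z \<sigma> left_steps ?m)) =
        (\<Sum>\<sigma>\<in>(\<Pi>\<^sub>E c\<in>{?x', ?z'}. B). F (chain_value Z' \<sigma> right_steps ?k)
          (chain_value Z' \<sigma> right_steps ?l) (chain_value Z' \<sigma> right_steps ?m))"
      unfolding val using twisted_pentagon[OF trilin_labels[OF F], of "sflips Z a" "sflips Z b" "sflips Z c"] b
      by (simp add: sum_states_insert)
  qed simp_all
  show ?thesis
    by (rule local_move[OF Z Z' th lay, where K = "[?k, ?l, ?m]"])
      (use id in \<open>auto simp: match_simps add_mset_commute insert_commute\<close>)
qed

text \<open>The change of crossing type alters the under-label by one antipode, and the reversal of
  the over-strand alters the over-label by one. In the first identity both antipodes stand on the
  same side and cancel by \<open>basis_twist\<close>; in the second they stand on opposite sides,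
  and applying the first with one more \<open>S\<close> produces a square of the antipode.\<close>

lemma slide_identity:
  assumes F: "\<And>t. t \<in> H \<Longrightarrow> hlin (\<lambda>s. F s t)" "\<And>s. s \<in> H \<Longrightarrow> hlin (F s)"
  shows "(\<Sum>e\<in>B. F (of_alg A (sp n (S e))) (of_dual A (tp (Suc m) (ds e)))) =
      (\<Sum>e\<in>B. F (of_alg A (sp n e)) (of_dual A (tp m (ds e))))"
    and "(\<And>y. S (S y) = y) \<Longrightarrow> (\<Sum>e\<in>B. F (of_alg A (sp n e)) (of_dual A (tp (Suc m) (ds e)))) =
      (\<Sum>e\<in>B. F (of_alg A (sp n (S e))) (of_dual A (tp m (ds e))))"
proof -
  show *: "(\<Sum>e\<in>B. F (of_alg A (sp n (S e))) (of_dual A (tp (Suc m) (ds e)))) =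
      (\<Sum>e\<in>B. F (of_alg A (sp n e)) (of_dual A (tp m (ds e))))" for n
    unfolding tp_simps
    by (rule basis_twist(2)[of "\<lambda>u f. F (of_alg A (sp n u)) (of_dual A (tp m f))"]) (intro hlin_pair F; assumption)+
  show "(\<Sum>e\<in>B. F (of_alg A (sp n e)) (of_dual A (tp (Suc m) (ds e)))) =
      (\<Sum>e\<in>B. F (of_alg A (sp n (S e))) (of_dual A (tp m (ds e))))" if "\<And>y. S (S y) = y"
    using *[of "Suc n"] that by (simp add: sp_simps)
qed

lemma sflips_reverse: "snd l = Down \<Longrightarrow> sflips Y (reverse l) = Suc (sflips Y l)"
    "snd l = Up \<Longrightarrow> sflips Y l = Suc (sflips Y (reverse l))"
  by (simp_all add: flips_def)

text \<open>If \<open>l\<close> points down, the right leg carries one antipode more than the left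
  one, which balances the antipode in the label of an \<open>XMinus\<close>. If \<open>l\<close>
  points up it carries one less, and the imbalance is the square of the antipode. When the leg
  passes under, the labels are compared term by term; when it passes over, only their sums over the
  basis are.\<close>

lemma cap_slide_move:
  assumes inv: "\<And>y. x \<noteq> Virtual \<Longrightarrow> snd l = Up \<Longrightarrow> S (S y) = y"
    and lay: "layers Z = ls @ map (frame L R) [[Vert t, Cap l], [Crossing x t l, Vert (reverse l)]] @ ls'"
    "layers Z' = ls @ map (frame L R) [[Cap l, Vert t], [Vert l, Crossing (flip x) (reverse l) t]] @ ls'"
  shows "universal_invariant A B Z = universal_invariant A B Z'"
proof -
  let ?h = "length ls" and ?n = "length L"
  let ?t = "(t, descent ?h ?n [0, 0, 1] [None, role_at 0 (role_left x)],
      descent ?h ?n [0, 2, 1] [None, role_at 1 (role_right (flip x))]) :: match"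
  \<comment> \<open>Steps through \<open>Cap l\<close> belong to \<open>reverse l\<close>, so the
    chain begins at the lower end of the left leg and ends at that of the right leg.\<close>
  let ?l = "(reverse l,
      [((?h + 2, ?n), (?h + 1, ?n + 1), map_option (Pair (?h + 1, ?n)) (role_right x)),
       ((?h + 1, ?n + 1), (?h + 1, ?n + 2), None), ((?h + 1, ?n + 2), (?h + 2, ?n + 2), None)],
      [((?h + 2, ?n), (?h + 1, ?n), None), ((?h + 1, ?n), (?h + 1, ?n + 1), None),
       ((?h + 1, ?n + 1), (?h + 2, ?n + 2), map_option (Pair (?h + 1, ?n + 1)) (role_left (flip x)))]) :: match"
  let ?p = "(Suc ?h, ?n)" and ?q = "(Suc ?h, Suc ?n)"
  show ?thesis
  proof (cases x)
    case XPlus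
    have c: "layers Z ! Suc ?h ! ?n = XP t l" "layers Z' ! Suc ?h ! Suc ?n = XM (reverse l) t"
      by (simp_all add: lay nth_append XPlus flip_def)
    have val: "chain_value Z \<sigma> left_steps ?t = of_alg A (sp (sflips Z t) (\<sigma> ?p))"
        "chain_value Z \<sigma> left_steps ?l = of_dual A (tp (sflips Z l) (ds (\<sigma> ?p)))"
        "chain_value Z' \<sigma> right_steps ?t = of_alg A (sp (sflips Z t) (S (\<sigma> ?q)))"
        "chain_value Z' \<sigma> right_steps ?l = of_dual A (tp (sflips Z (reverse l)) (ds (\<sigma> ?q)))" for \<sigma>
      by (simp_all add: chain_value_def map_filter_simps XPlus flip_def label_XPlus[OF c(1)] label_XMinus[OF c(2)]
          th vprod_simps of_alg_in of_dual_in lform_tp dual_basis_lform)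
    have id: "local_identity Z {?p} Z' {?q} [?t, ?l]"
    proof (rule local_identity_2)
      fix F assume F: "\<And>t. t \<in> H \<Longrightarrow> hlin (\<lambda>s. F s t)" "\<And>s. s \<in> H \<Longrightarrow> hlin (F s)"
      note slide = slide_identity[OF F]
      have "(\<Sum>e\<in>B. F (of_alg A (sp (sflips Z t) e)) (of_dual A (tp (sflips Z l) (ds e)))) =
          (\<Sum>e\<in>B. F (of_alg A (sp (sflips Z t) (S e))) (of_dual A (tp (sflips Z (reverse l)) (ds e))))"
      proof (cases "snd l")
        case Down
        show ?thesis
          unfolding sflips_reverse(1)[OF Down] by (rule slide(1)[symmetric])
      next
        case Up
        have i: "S (S y) = y" for y
          by (rule inv) (simp_all add: XPlus Up)
        show ?thesis
          unfolding sflips_reverse(2)[OF Up] by (rule slide(2)) (assumption | rule i)+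
      qed
      then show "(\<Sum>\<sigma>\<in>(\<Pi>\<^sub>E c\<in>{?p}. B). F (chain_value Z \<sigma> left_steps ?t) (chain_value Z \<sigma> left_steps ?l)) =
          (\<Sum>\<sigma>\<in>(\<Pi>\<^sub>E c\<in>{?q}. B). F (chain_value Z' \<sigma> right_steps ?t) (chain_value Z' \<sigma> right_steps ?l))"
        unfolding val by (simp add: sum_states_insert)
    qed simp
    show ?thesis
      by (rule local_move[OF Z Z' th lay, where K = "[?t, ?l]"])
        (use id in \<open>auto simp: match_simps add_mset_commute XPlus flip_def\<close>)
  next
    case XMinus
    have c: "layers Z ! Suc ?h ! ?n = XM t l" "layers Z' ! Suc ?h ! Suc ?n = XP (reverse l) t"
      by (simp_all add: lay nth_append XMinus flip_def)
    have val: "chain_value Z \<sigma> left_steps ?l = of_alg A (sp (sflips Z l) (S (\<sigma> ?p)))"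
        "chain_value Z \<sigma> left_steps ?t = of_dual A (tp (sflips Z t) (ds (\<sigma> ?p)))"
        "chain_value Z' \<sigma> right_steps ?l = of_alg A (sp (sflips Z (reverse l)) (\<sigma> ?q))"
        "chain_value Z' \<sigma> right_steps ?t = of_dual A (tp (sflips Z t) (ds (\<sigma> ?q)))" for \<sigma>
      by (simp_all add: chain_value_def map_filter_simps XMinus flip_def label_XPlus[OF c(2)] label_XMinus[OF c(1)]
          th vprod_simps of_alg_in of_dual_in lform_tp dual_basis_lform)
    have id: "local_identity Z {?p} Z' {?q} [?l, ?t]"
    proof (rule local_identity_2)
      fix F assume F: "\<And>t. t \<in> H \<Longrightarrow> hlin (\<lambda>s. F s t)" "\<And>s. s \<in> H \<Longrightarrow> hlin (F s)"
      note slide = slide_identity[OF F]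
      have "(\<Sum>e\<in>B. F (of_alg A (sp (sflips Z l) (S e))) (of_dual A (tp (sflips Z t) (ds e)))) =
          (\<Sum>e\<in>B. F (of_alg A (sp (sflips Z (reverse l)) e)) (of_dual A (tp (sflips Z t) (ds e))))"
      proof (cases "snd l")
        case Down
        show ?thesis
          unfolding sflips_reverse(1)[OF Down] by (simp add: sp_simps)
      next
        case Up
        show ?thesis
          unfolding sflips_reverse(2)[OF Up] using inv XMinus Up by (simp add: sp_simps)
      qed
      then show "(\<Sum>\<sigma>\<in>(\<Pi>\<^sub>E c\<in>{?p}. B). F (chain_value Z \<sigma> left_steps ?l) (chain_value Z \<sigma> left_steps ?t)) =
          (\<Sum>\<sigma>\<in>(\<Pi>\<^sub>E c\<in>{?q}. B). F (chain_value Z' \<sigma> right_steps ?l) (chain_value Z' \<sigma> right_steps ?t))"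
        unfolding val by (simp add: sum_states_insert)
    qed simp
    show ?thesis
      by (rule local_move[OF Z Z' th lay, where K = "[?l, ?t]"])
        (use id in \<open>auto simp: match_simps add_mset_commute XMinus flip_def\<close>)
  next
    case Virtual
    show ?thesis
      by (rule relabelling_move[OF Z Z' th lay, where K = "[?t, ?l]" and X = "{}" and X' = "{}" and \<kappa> = id])
        (auto simp: match_simps add_mset_commute Virtual flip_def)
  qed
qed

text \<open>Here \<open>l\<close> is the upper left strand of the crossing, hence passes under at an
  \<open>XPlus\<close>, whereas at a maximum it passes over there. This exchanges the two
  orientations, so the square of the antipode appears for \<open>l\<close> pointing down.\<close>

lemma cup_slide_move:
  assumes inv: "\<And>y. x \<noteq> Virtual \<Longrightarrow> snd l = Down \<Longrightarrow> S (S y) = y"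
    and lay: "layers Z = ls @ map (frame L R) [[Crossing x l t, Vert (reverse l)], [Vert t, Cup l]] @ ls'"
    "layers Z' = ls @ map (frame L R) [[Vert l, Crossing (flip x) t (reverse l)], [Cup l, Vert t]] @ ls'"
  shows "universal_invariant A B Z = universal_invariant A B Z'"
proof -
  let ?h = "length ls" and ?n = "length L"
  let ?t = "(t, descent ?h ?n [1, 0, 0] [role_at 0 (role_right x), None],
      descent ?h ?n [1, 2, 0] [role_at 1 (role_left (flip x)), None]) :: match"
  let ?l = "(l,
      [((?h, ?n), (?h + 1, ?n + 1), map_option (Pair (?h, ?n)) (role_left x)),
       ((?h + 1, ?n + 1), (?h + 1, ?n + 2), None), ((?h + 1, ?n + 2), (?h, ?n + 2), None)],
      [((?h, ?n), (?h + 1, ?n), None), ((?h + 1, ?n), (?h + 1, ?n + 1), None),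
       ((?h + 1, ?n + 1), (?h, ?n + 2), map_option (Pair (?h, ?n + 1)) (role_right (flip x)))]) :: match"
  let ?p = "(?h, ?n)" and ?q = "(?h, Suc ?n)"
  show ?thesis
  proof (cases x)
    case XPlus
    have c: "layers Z ! ?h ! ?n = XP l t" "layers Z' ! ?h ! Suc ?n = XM t (reverse l)"
      by (simp_all add: lay nth_append XPlus flip_def)
    have val: "chain_value Z \<sigma> left_steps ?l = of_alg A (sp (sflips Z l) (\<sigma> ?p))"
        "chain_value Z \<sigma> left_steps ?t = of_dual A (tp (sflips Z t) (ds (\<sigma> ?p)))"
        "chain_value Z' \<sigma> right_steps ?l = of_alg A (sp (sflips Z (reverse l)) (S (\<sigma> ?q)))"
        "chain_value Z' \<sigma> right_steps ?t = of_dual A (tp (sflips Z t) (ds (\<sigma> ?q)))" for \<sigma>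
      by (simp_all add: chain_value_def map_filter_simps XPlus flip_def label_XPlus[OF c(1)] label_XMinus[OF c(2)]
          th vprod_simps of_alg_in of_dual_in lform_tp dual_basis_lform)
    have id: "local_identity Z {?p} Z' {?q} [?l, ?t]"
    proof (rule local_identity_2)
      fix F assume F: "\<And>t. t \<in> H \<Longrightarrow> hlin (\<lambda>s. F s t)" "\<And>s. s \<in> H \<Longrightarrow> hlin (F s)"
      note slide = slide_identity[OF F]
      have "(\<Sum>e\<in>B. F (of_alg A (sp (sflips Z l) e)) (of_dual A (tp (sflips Z t) (ds e)))) =
          (\<Sum>e\<in>B. F (of_alg A (sp (sflips Z (reverse l)) (S e))) (of_dual A (tp (sflips Z t) (ds e))))"
      proof (cases "snd l")
        case Down
        show ?thesis
          unfolding sflips_reverse(1)[OF Down] using inv XPlus Down by (simp add: sp_simps)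
      next
        case Up
        show ?thesis
          unfolding sflips_reverse(2)[OF Up] by (simp add: sp_simps)
      qed
      then show "(\<Sum>\<sigma>\<in>(\<Pi>\<^sub>E c\<in>{?p}. B). F (chain_value Z \<sigma> left_steps ?l) (chain_value Z \<sigma> left_steps ?t)) =
          (\<Sum>\<sigma>\<in>(\<Pi>\<^sub>E c\<in>{?q}. B). F (chain_value Z' \<sigma> right_steps ?l) (chain_value Z' \<sigma> right_steps ?t))"
        unfolding val by (simp add: sum_states_insert)
    qed simp
    show ?thesis
      by (rule local_move[OF Z Z' th lay, where K = "[?l, ?t]"])
        (use id in \<open>auto simp: match_simps add_mset_commute XPlus flip_def\<close>)
  next
    case XMinus
    have c: "layers Z ! ?h ! ?n = XM l t" "layers Z' ! ?h ! Suc ?n = XP t (reverse l)"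
      by (simp_all add: lay nth_append XMinus flip_def)
    have val: "chain_value Z \<sigma> left_steps ?t = of_alg A (sp (sflips Z t) (S (\<sigma> ?p)))"
        "chain_value Z \<sigma> left_steps ?l = of_dual A (tp (sflips Z l) (ds (\<sigma> ?p)))"
        "chain_value Z' \<sigma> right_steps ?t = of_alg A (sp (sflips Z t) (\<sigma> ?q))"
        "chain_value Z' \<sigma> right_steps ?l = of_dual A (tp (sflips Z (reverse l)) (ds (\<sigma> ?q)))" for \<sigma>
      by (simp_all add: chain_value_def map_filter_simps XMinus flip_def label_XPlus[OF c(2)] label_XMinus[OF c(1)]
          th vprod_simps of_alg_in of_dual_in lform_tp dual_basis_lform)
    have id: "local_identity Z {?p} Z' {?q} [?t, ?l]"
    proof (rule local_identity_2)
      fix F assume F: "\<And>t. t \<in> H \<Longrightarrow> hlin (\<lambda>s. F s t)" "\<And>s. s \<in> H \<Longrightarrow> hlin (F s)"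
      note slide = slide_identity[OF F]
      have "(\<Sum>e\<in>B. F (of_alg A (sp (sflips Z t) (S e))) (of_dual A (tp (sflips Z l) (ds e)))) =
          (\<Sum>e\<in>B. F (of_alg A (sp (sflips Z t) e)) (of_dual A (tp (sflips Z (reverse l)) (ds e))))"
      proof (cases "snd l")
        case Down
        have i: "S (S y) = y" for y
          by (rule inv) (simp_all add: XMinus Down)
        show ?thesis
          unfolding sflips_reverse(1)[OF Down] by (rule slide(2)[symmetric]) (assumption | rule i)+
      next
        case Up
        show ?thesis
          unfolding sflips_reverse(2)[OF Up] by (rule slide(1))
      qed
      then show "(\<Sum>\<sigma>\<in>(\<Pi>\<^sub>E c\<in>{?p}. B). F (chain_value Z \<sigma> left_steps ?t) (chain_value Z \<sigma> left_steps ?l)) =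
          (\<Sum>\<sigma>\<in>(\<Pi>\<^sub>E c\<in>{?q}. B). F (chain_value Z' \<sigma> right_steps ?t) (chain_value Z' \<sigma> right_steps ?l))"
        unfolding val by (simp add: sum_states_insert)
    qed simp
    show ?thesis
      by (rule local_move[OF Z Z' th lay, where K = "[?t, ?l]"])
        (use id in \<open>auto simp: match_simps add_mset_commute XMinus flip_def\<close>)
  next
    case Virtual
    show ?thesis
      by (rule relabelling_move[OF Z Z' th lay, where K = "[?t, ?l]" and X = "{}" and X' = "{}" and \<kappa> = id])
        (auto simp: match_simps add_mset_commute Virtual flip_def)
  qed
qed

end

end

section \<open>Invariance\<close>

context finite_hopf
begin

text \<open>A layer of vertical strands is merged into a neighbouring layer, which exists because
  diagrams have at least one layer; this is a height move with empty \<open>g\<close>.\<close>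

lemma stretch_move:
  assumes Z: "colored_diagram Z" and Z': "colored_diagram Z'" and th: "thin Z' = thin Z"
    and lay: "layers Z = ls @ [frame L R (verts as)] @ ls'" "layers Z' = ls @ ls'"
  shows "universal_invariant A B Z = universal_invariant A B Z'"
proof (cases "ls = []")
  case True
  then obtain l ls0 where ls': "ls' = l # ls0"
    using Z' lay(2) by (cases ls') (auto simp: colored_diagram_def)
  have "uppers l = L @ as @ R"
    using Z by (simp add: colored_diagram_def lay True ls')
  then show ?thesis
    by (intro height_right_move[OF Z Z' th, where ls = "[]" and L = "[]" and R = "[]" and f = l and g = "[]" and ls' = ls0])
      (simp_all add: lay True ls')
next
  case False
  then obtain ls0 l where ls: "ls = ls0 @ [l]"
    by (cases ls rule: rev_cases) auto
  have "composable ([l] @ [frame L R (verts as)])"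
    using Z composable_block[of ls0 "[l] @ [frame L R (verts as)]" ls'] by (simp add: colored_diagram_def lay ls)
  then have "lowers l = L @ as @ R"
    by simp
  then show ?thesis
    by (intro height_left_move[OF Z Z' th, where ls = ls0 and L = "[]" and R = "[]" and f = l and g = "[]" and ls' = ls'])
      (simp_all add: lay ls)
qed

lemma even_flips: "even (flips th d) \<longleftrightarrow> th = (d = Down)"
  by (cases th; cases d) (simp_all add: flips_def)

lemma colored_pattern_invariant:
  assumes Z: "colored_diagram Z" and Z': "colored_diagram Z'" and th: "thin Z' = thin Z"
    and lay: "layers Z = ls @ map (frame L R) W @ ls'" "layers Z' = ls @ map (frame L R) W' @ ls'"
  shows "basic_pattern (\<lambda>i. thin Z ! i) W W' \<Longrightarrow> universal_invariant A B Z = universal_invariant A B Z'"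
    and "colored_pattern (\<lambda>i. thin Z ! i) W W' \<Longrightarrow> (\<And>y. S (S y) = y) \<Longrightarrow>
      universal_invariant A B Z = universal_invariant A B Z'"
proof -
  \<comment> \<open>The condition on \<open>b\<close> covers thin downward and thick upward strands
    at once, by \<open>even_flips\<close>; its negation in \<open>pB\<close> covers the other two
    kinds.\<close>
  have pA: "universal_invariant A B Z = universal_invariant A B Z'"
    if "pachner_A a b c W W'" "thin Z ! fst b = (snd b = Down)" for a b c
    using that(1) lay
    by (cases rule: pachner_A.cases) (rule pachner_A_move[OF Z Z' th], simp_all add: even_flips that(2))
  have pB: "universal_invariant A B Z = universal_invariant A B Z'"
    if "pachner_B a b c W W'" "thin Z ! fst b \<noteq> (snd b = Down)" for a b c
    using that(1) lay
    by (cases rule: pachner_B.cases) (rule pachner_B_move[OF Z Z' th], simp_all add: even_flips that(2))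
  have cap: "universal_invariant A B Z = universal_invariant A B Z'"
    if "cap_slide x t l W W'" "x = Virtual \<or> snd l = Down \<or> (\<forall>y. S (S y) = y)" for x t l
    using that(1) lay
    by (cases rule: cap_slide.cases) (rule cap_slide_move[OF Z Z' th, where x = x and t = t and l = l];
        use that(2) in auto)
  have cup: "universal_invariant A B Z = universal_invariant A B Z'"
    if "cup_slide x t l W W'" "x = Virtual \<or> snd l = Up \<or> (\<forall>y. S (S y) = y)" for x t l
    using that(1) lay
    by (cases rule: cup_slide.cases) (rule cup_slide_move[OF Z Z' th, where x = x and t = t and l = l];
        use that(2) in auto)
  show basic: "universal_invariant A B Z = universal_invariant A B Z'" if "basic_pattern (\<lambda>i. thin Z ! i) W W'"
    using that
  proof cases
    case (pachner_thin b a c)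
    then show ?thesis by (intro pA) auto
  next
    case (pachner_thick b a c)
    then show ?thesis by (intro pB) auto
  next
    case (zero_two_1 a b)
    then show ?thesis using lay by (intro zero_two_1_move[OF Z Z' th]) auto
  next
    case (zero_two_2 a b)
    then show ?thesis using lay by (intro zero_two_2_move[OF Z Z' th]) auto
  next
    case (sym_sym a b)
    then show ?thesis using lay by (intro sym_sym_move[OF Z Z' th]) auto
  next
    case (sym_crossing_1 x a b c)
    then show ?thesis using lay by (intro sym_crossing_1_move[OF Z Z' th]) auto
  next
    case (sym_crossing_2 a x b c)
    then show ?thesis using lay by (intro sym_crossing_2_move[OF Z Z' th]) auto
  next
    case (sym_crossing_3 a b c x)
    then show ?thesis using lay by (intro sym_crossing_3_move[OF Z Z' th]) auto
  next
    case (cap_slide x l t)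
    then show ?thesis by (intro cap) auto
  next
    case (cup_slide x l t)
    then show ?thesis by (intro cup) auto
  next
    case (zigzag_1 a)
    then show ?thesis using lay by (intro zigzag_1_move[OF Z Z' th]) auto
  next
    case (zigzag_2 a)
    then show ?thesis using lay by (intro zigzag_2_move[OF Z Z' th]) auto
  next
    case (stretch as)
    then show ?thesis using lay by (intro stretch_move[OF Z Z' th]) auto
  next
    case (height_left f g)
    then show ?thesis using lay by (intro height_left_move[OF Z Z' th]) auto
  next
    case (height_right f g)
    then show ?thesis using lay by (intro height_right_move[OF Z Z' th]) auto
  qed
  show "universal_invariant A B Z = universal_invariant A B Z'"
    if "colored_pattern (\<lambda>i. thin Z ! i) W W'" and inv: "\<And>y. S (S y) = y"
    using that(1)
  proof cases
    case basic
    then show ?thesis by (rule \<open>basic_pattern _ W W' \<Longrightarrow> _\<close>)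
  next
    case (pachner_thin_up b a c)
    then show ?thesis by (intro pB) auto
  next
    case (pachner_thick_up b a c)
    then show ?thesis by (intro pA) auto
  next
    case (cap_slide_right x t l)
    then show ?thesis using inv by (intro cap) auto
  next
    case (cup_slide_right x t l)
    then show ?thesis using inv by (intro cup) auto
  qed
qed

text \<open>The composite map sees a triangulation only through its type, so a move of
  triangulations is used through the underlying move of diagrams.\<close>

lemma ct_move_invariant:
  "ct_move basic_pattern X Y \<Longrightarrow> universal_invariant A B (ct_type X) = universal_invariant A B (ct_type Y)"
  "ct_move colored_pattern X Y \<Longrightarrow> (\<And>y. S (S y) = y) \<Longrightarrow>
    universal_invariant A B (ct_type X) = universal_invariant A B (ct_type Y)"
proof -
  have *: "colored_diagram (ct_type X) \<and> colored_diagram (ct_type Y) \<and>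
      (\<exists>ls ls' W W' L R. thin (ct_type Y) = thin (ct_type X) \<and> P (\<lambda>i. thin (ct_type X) ! i) W W' \<and>
        layers (ct_type X) = ls @ map (frame L R) W @ ls' \<and> layers (ct_type Y) = ls @ map (frame L R) W' @ ls')"
    if "ct_move P X Y" for P
    using that unfolding ct_move_def move_at_def CT_def ct_type_def mem_Collect_eq split_beta by blast
  show "universal_invariant A B (ct_type X) = universal_invariant A B (ct_type Y)" if "ct_move basic_pattern X Y"
    using *[OF that] colored_pattern_invariant(1) by blast
  show "universal_invariant A B (ct_type X) = universal_invariant A B (ct_type Y)"
    if "ct_move colored_pattern X Y" "\<And>y. S (S y) = y"
    using *[OF that(1)] colored_pattern_invariant(2)[OF _ _ _ _ _ _ that(2)] by blast
qed

lemma invariant_equivclp: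
  assumes "\<And>X Y. r X Y \<Longrightarrow> f X = f Y" "equivclp r X Y"
  shows "f X = f Y"
  using assms(2) by (induction rule: equivclp_induct) (use assms(1) in \<open>force+\<close>)

lemma universal_invariant_in_target:
  assumes Z: "Z \<in> CD \<mu> \<nu>"
  shows "universal_invariant A B Z \<in> target A \<mu> \<nu>"
proof -
  let ?m = "length \<mu>"
  define N where "N i = slot_kernel A (\<mu> ! i) (\<nu> ! i)" for i
  have th: "thin Z = \<mu>" and bd: "i < ?m \<Longrightarrow> \<nu> ! i = has_boundary Z i" for i
    using Z by (auto simp: CD_def)
  \<comment> \<open>The two families of kernels are compared only at indices of components, since
    list entries beyond the length are unspecified; this is enough for the product of slots and for
    the multilinear forms on it.\<close>
  have N: "i < ?m \<Longrightarrow> slot Z i = N i" for i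
    by (simp add: slot_def N_def th bd)
  have PiE: "(\<Pi>\<^sub>E j\<in>{..<?m}. slot_space A (slot Z j)) = (\<Pi>\<^sub>E j\<in>{..<?m}. slot_space A (N j))"
    by (rule PiE_cong) (simp add: N)
  have "multilinear_form A (slot Z) ?m = multilinear_form A N ?m"
    unfolding multilinear_form_def fun_eq_iff PiE using N by simp
  then have mpure: "mpure A (slot Z) ?m = mpure A N ?m"
    by (simp add: mpure_def fun_eq_iff)
  have "universal_invariant A B Z = (\<Sum>\<sigma>\<in>(\<Pi>\<^sub>E c\<in>crossings Z. B).
      mpure A (slot Z) ?m (\<lambda>i\<in>{..<?m}. coset (slot Z i) (component_product A B Z \<sigma> i)))"
    unfolding universal_invariant_def Let_def th slot_def[abs_def] ..
  also have "\<dots> \<in> module.span fscale (mpure A N ?m ` (\<Pi>\<^sub>E j\<in>{..<?m}. slot_space A (N j)))"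
    unfolding mpure
  proof (intro module.span_sum[OF fscale_module] module.span_base[OF fscale_module] imageI)
    fix \<sigma>
    have "component_product A B Z \<sigma> i \<in> H" for i
      unfolding component_product_def Let_def sprod_def[symmetric] by (intro sprod_in labels_in)
    then show "(\<lambda>i\<in>{..<?m}. coset (slot Z i) (component_product A B Z \<sigma> i)) \<in> (\<Pi>\<^sub>E j\<in>{..<?m}. slot_space A (N j))"
      unfolding PiE[symmetric] by (auto simp: slot_space_def)
  qed
  finally show ?thesis
    by (simp add: target_def Let_def N_def[abs_def])
qed

end

theorem proposition6p2:
  fixes A :: "('k::field, 'a::ring_1) hopf"
    and B :: "'a set"
    and m :: nat
    and \<mu> \<nu> :: "bool list"
  assumes "hopf_algebra A"
    and "finite_dimensional_vector_space (smult A) B"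
    and "bij (antipode A)"
    and "length \<mu> = m" and "length \<nu> = m"
  shows "(universal_invariant A B \<circ> ct_type) ` CT_of \<mu> \<nu> \<subseteq> target A \<mu> \<nu> \<and>
    (\<forall>X\<in>CT_of \<mu> \<nu>. \<forall>Y\<in>CT_of \<mu> \<nu>. ct_equiv' X Y \<longrightarrow>
       (universal_invariant A B \<circ> ct_type) X = (universal_invariant A B \<circ> ct_type) Y) \<and>
    ((\<forall>x. antipode A (antipode A x) = x) \<longrightarrow>
       (\<forall>X\<in>CT_of \<mu> \<nu>. \<forall>Y\<in>CT_of \<mu> \<nu>. ct_equiv X Y \<longrightarrow>
          (universal_invariant A B \<circ> ct_type) X = (universal_invariant A B \<circ> ct_type) Y))"
proof -
  interpret finite_hopf A B
    using assms(1-3) by (simp add: finite_hopf_def finite_hopf_axioms_def)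
  have "(universal_invariant A B \<circ> ct_type) ` CT_of \<mu> \<nu> \<subseteq> target A \<mu> \<nu>"
    using universal_invariant_in_target by (auto simp: CT_of_def)
  moreover have "universal_invariant A B (ct_type X) = universal_invariant A B (ct_type Y)" if "ct_equiv' X Y" for X Y
    using invariant_equivclp[of "ct_move basic_pattern" "\<lambda>X. universal_invariant A B (ct_type X)"]
      ct_move_invariant(1) that
    unfolding ct_equiv'_def by blast
  moreover have "universal_invariant A B (ct_type X) = universal_invariant A B (ct_type Y)"
    if "\<forall>x. antipode A (antipode A x) = x" "ct_equiv X Y" for X Y
    using invariant_equivclp[of "ct_move colored_pattern" "\<lambda>X. universal_invariant A B (ct_type X)"]
      ct_move_invariant(2) that
    unfolding ct_equiv_def by blast
  ultimately show ?thesis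
    by simp
qed

end
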